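(* Let $\alpha\in\mathbb{R}\setminus\{0\}$. Then there exists $\varepsilon_0>0$ such that any steady solution to the non-rotating Euler equations on $\mathbb{S}^2$ whose vorticity $\overline\Omega$ satisfies $$\|\overline\Omega+2\alpha Y_1^0\|_{H^4}\le\varepsilon_0,\qquad\langle\overline\Omega,Y_1^m\rangle_{L^2(\mathbb{S}^2)}=0\ \text{ for }|m|=1,$$ must be zonal, that is, $\overline U=\overline U(\theta)\mathbf{e}_\varphi$ and $\overline\Omega=\overline\Omega(\theta)$.
   Context: $\mathbb{S}^2$ is the unit sphere with colatitude $\theta$ and longitude $\varphi$, coordinates $(\sin\theta\cos\varphi,\sin\theta\sin\varphi,\cos\theta)$; $\mathbf{e}_\theta=\partial_\theta$, $\mathbf{e}_\varphi=\frac{1}{\sin\theta}\partial_\varphi$; $\nabla f=\partial_\theta f\,\mathbf{e}_\theta+\frac1{\sin\theta}\partial_\varphi f\,\mathbf{e}_\varphi$, $\nabla^\perp f=J\nabla f$ with $J\mathbf{e}_\theta=-\mathbf{e}_\varphi$, $J\mathbf{e}_\varphi=\mathbf{e}_\theta$; $\Delta$ is the Laplace-Beltrami operator. The non-rotating Euler equations are $\partial_t\overline\Omega+\overline U\cdot\nabla\overline\Omega=0$, $\overline U=\nabla^\perp\overline\Psi$, $\Delta\overline\Psi=\overline\Omega$; steady means time-independent. $\{Y_n^m:n\ge0,|m|\le n\}$ is the $L^2(\mathbb{S}^2)$-orthonormal basis of real spherical harmonics, $-\Delta Y_n^m=n(n+1)Y_n^m$; $Y_1^0=\frac12\sqrt{\frac3\pi}\cos\theta$,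 and $Y_1^{1}$, $Y_1^{-1}$ are nonzero multiples of $\sin\theta\cos\varphi$ and $\sin\theta\sin\varphi$. For $u=\sum u_n^mY_n^m$, $\|u\|_{H^k}^2=\sum_{n\ge0}\sum_{|m|\le n}\mu_n^k|u_n^m|^2$ with $\mu_n=n(n+1)+1$. *)

theory Defs
  imports "HOL-Analysis.Analysis" "HOL-Computational_Algebra.Polynomial"
begin

text \<open>
  Scalar and vector fields on the unit sphere are functions on \<open>real^3\<close> of which only the
  values on \<open>sphere 0 1\<close> matter.
\<close>

definition sph :: "real \<Rightarrow> real \<Rightarrow> real^3" where
  "sph \<theta> \<phi> = vector [sin \<theta> * cos \<phi>, sin \<theta> * sin \<phi>, cos \<theta>]"

definition e_theta :: "real \<Rightarrow> real \<Rightarrow> real^3" where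
  "e_theta \<theta> \<phi> = vector [cos \<theta> * cos \<phi>, cos \<theta> * sin \<phi>, - sin \<theta>]"

definition e_phi :: "real \<Rightarrow> real \<Rightarrow> real^3" where
  "e_phi \<theta> \<phi> = vector [- sin \<phi>, cos \<phi>, 0]"

lemma has_vector_derivative_sph_theta:
  "((\<lambda>t. sph t \<phi>) has_vector_derivative e_theta \<theta> \<phi>) (at \<theta>)"
  unfolding has_vector_derivative_def has_derivative_componentwise_within[of "\<lambda>t. sph t \<phi>"]
  by (auto simp: Basis_vec_def inner_axis sph_def e_theta_def forall_3 UNIV_3
      intro!: derivative_eq_intros)

lemma has_vector_derivative_sph_phi:
  "((\<lambda>p. sph \<theta> p) has_vector_derivative (sin \<theta> *\<^sub>R e_phi \<theta> \<phi>)) (at \<phi>)"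
  unfolding has_vector_derivative_def has_derivative_componentwise_within[of "\<lambda>p. sph \<theta> p"]
  by (auto simp: Basis_vec_def inner_axis sph_def e_phi_def forall_3 UNIV_3
      intro!: derivative_eq_intros)

fun Ck_on :: "nat \<Rightarrow> ('a::euclidean_space \<Rightarrow> real) \<Rightarrow> 'a set \<Rightarrow> bool" where
  "Ck_on 0 f S \<longleftrightarrow> continuous_on S f"
| "Ck_on (Suc k) f S \<longleftrightarrow> (\<forall>x\<in>S. f differentiable (at x)) \<and>
     (\<forall>b\<in>Basis. Ck_on k (\<lambda>x. frechet_derivative f (at x) b) S)"

text \<open>
  A function is \<open>C\<^sup>k\<close> on the sphere (poles included) iff its extension that is constant along
  rays is \<open>C\<^sup>k\<close> on the complement of the origin, because \<open>x \<mapsto> x / \<bar>x\<bar>\<close> is smooth there.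
\<close>
definition Ck_sphere :: "nat \<Rightarrow> (real^3 \<Rightarrow> real) \<Rightarrow> bool" where
  "Ck_sphere k f \<longleftrightarrow> Ck_on k (\<lambda>x. f (x /\<^sub>R norm x)) (- {0})"

text \<open>The operators below are meaningful for \<open>0 < \<theta> < \<pi>\<close>, that is, off the poles.\<close>

definition d_theta :: "(real^3 \<Rightarrow> real) \<Rightarrow> real \<Rightarrow> real \<Rightarrow> real" where
  "d_theta f \<theta> \<phi> = deriv (\<lambda>t. f (sph t \<phi>)) \<theta>"

definition d_phi :: "(real^3 \<Rightarrow> real) \<Rightarrow> real \<Rightarrow> real \<Rightarrow> real" where
  "d_phi f \<theta> \<phi> = deriv (\<lambda>p. f (sph \<theta> p)) \<phi>"

definition sph_grad :: "(real^3 \<Rightarrow> real) \<Rightarrow> real \<Rightarrow> real \<Rightarrow> real^3" where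
  "sph_grad f \<theta> \<phi> =
     d_theta f \<theta> \<phi> *\<^sub>R e_theta \<theta> \<phi> + (1 / sin \<theta> * d_phi f \<theta> \<phi>) *\<^sub>R e_phi \<theta> \<phi>"

text \<open>The rotation of the tangent plane sending \<open>e_theta\<close> to \<open>- e_phi\<close> and \<open>e_phi\<close> to \<open>e_theta\<close>.\<close>
definition sph_J :: "real \<Rightarrow> real \<Rightarrow> real^3 \<Rightarrow> real^3" where
  "sph_J \<theta> \<phi> v = (v \<bullet> e_phi \<theta> \<phi>) *\<^sub>R e_theta \<theta> \<phi> - (v \<bullet> e_theta \<theta> \<phi>) *\<^sub>R e_phi \<theta> \<phi>"

definition sph_perp_grad :: "(real^3 \<Rightarrow> real) \<Rightarrow> real \<Rightarrow> real \<Rightarrow> real^3" where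
  "sph_perp_grad f \<theta> \<phi> = sph_J \<theta> \<phi> (sph_grad f \<theta> \<phi>)"

definition sph_laplacian :: "(real^3 \<Rightarrow> real) \<Rightarrow> real \<Rightarrow> real \<Rightarrow> real" where
  "sph_laplacian f \<theta> \<phi> =
     1 / sin \<theta> * deriv (\<lambda>t. sin t * d_theta f t \<phi>) \<theta> +
     1 / (sin \<theta>)\<^sup>2 * deriv (\<lambda>p. d_phi f \<theta> p) \<phi>"

text \<open>
  Classical solutions with velocity \<open>U\<close>, stream function \<open>\<Psi>\<close> and vorticity \<open>\<Omega>\<close>, the first
  argument of each being time. The equations are imposed off the poles, where the frame is
  defined; the fields themselves are regular on the whole sphere, so that their values at the
  poles are determined by continuity.
\<close>
definition euler_solution ::
  "(real \<Rightarrow> real^3 \<Rightarrow> real^3) \<Rightarrow> (real \<Rightarrow> real^3 \<Rightarrow> real) \<Rightarrow> (real \<Rightarrow> real^3 \<Rightarrow> real) \<Rightarrow> bool" where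
  "euler_solution U \<Psi> \<Omega> \<longleftrightarrow>
     (\<forall>t. continuous_on (sphere 0 1) (U t) \<and> Ck_sphere 2 (\<Psi> t) \<and> Ck_sphere 1 (\<Omega> t)) \<and>
     (\<forall>t \<theta> \<phi>. 0 < \<theta> \<and> \<theta> < pi \<longrightarrow>
        U t (sph \<theta> \<phi>) = sph_perp_grad (\<Psi> t) \<theta> \<phi> \<and>
        sph_laplacian (\<Psi> t) \<theta> \<phi> = \<Omega> t (sph \<theta> \<phi>) \<and>
        (\<exists>D. ((\<lambda>s. \<Omega> s (sph \<theta> \<phi>)) has_real_derivative D) (at t) \<and>
             D + U t (sph \<theta> \<phi>) \<bullet> sph_grad (\<Omega> t) \<theta> \<phi> = 0))"

definition steady_euler_solution ::
  "(real^3 \<Rightarrow> real^3) \<Rightarrow> (real^3 \<Rightarrow> real) \<Rightarrow> (real^3 \<Rightarrow> real) \<Rightarrow> bool" where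
  "steady_euler_solution U \<Psi> \<Omega> \<longleftrightarrow> euler_solution (\<lambda>_. U) (\<lambda>_. \<Psi>) (\<lambda>_. \<Omega>)"

lemma steady_euler_solution_iff:
  "steady_euler_solution U \<Psi> \<Omega> \<longleftrightarrow>
     continuous_on (sphere 0 1) U \<and> Ck_sphere 2 \<Psi> \<and> Ck_sphere 1 \<Omega> \<and>
     (\<forall>\<theta> \<phi>. 0 < \<theta> \<and> \<theta> < pi \<longrightarrow>
        U (sph \<theta> \<phi>) = sph_perp_grad \<Psi> \<theta> \<phi> \<and>
        sph_laplacian \<Psi> \<theta> \<phi> = \<Omega> (sph \<theta> \<phi>) \<and>
        U (sph \<theta> \<phi>) \<bullet> sph_grad \<Omega> \<theta> \<phi> = 0)"
proof -
  have "(\<exists>D. ((\<lambda>_. c) has_real_derivative D) (at t) \<and> D + a = 0) \<longleftrightarrow> a = 0" for c t a :: real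
  proof
    assume "\<exists>D. ((\<lambda>_. c) has_real_derivative D) (at t) \<and> D + a = 0"
    then obtain D where D: "((\<lambda>_. c) has_real_derivative D) (at t)" "D + a = 0"
      by blast
    have "D = 0"
      by (rule DERIV_unique[OF D(1) DERIV_const])
    with D show "a = 0" by simp
  next
    assume "a = 0"
    then show "\<exists>D. ((\<lambda>_. c) has_real_derivative D) (at t) \<and> D + a = 0"
      by (intro exI[of _ 0]) simp
  qed
  then show ?thesis
    unfolding steady_euler_solution_def euler_solution_def by auto
qed

definition zonal_vector_field :: "(real^3 \<Rightarrow> real^3) \<Rightarrow> bool" where
  "zonal_vector_field U \<longleftrightarrow>
     (\<exists>u. \<forall>\<theta> \<phi>. 0 < \<theta> \<and> \<theta> < pi \<longrightarrow> U (sph \<theta> \<phi>) = u \<theta> *\<^sub>R e_phi \<theta> \<phi>)"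

definition zonal_function :: "(real^3 \<Rightarrow> real) \<Rightarrow> bool" where
  "zonal_function f \<longleftrightarrow> (\<exists>w. \<forall>\<theta> \<phi>. 0 \<le> \<theta> \<and> \<theta> \<le> pi \<longrightarrow> f (sph \<theta> \<phi>) = w \<theta>)"

text \<open>
  Surface measure \<open>sin \<theta> d\<theta> d\<phi>\<close>, carried by the sphere alone, so that measurability does not
  depend on the values of a function off the sphere.
\<close>
definition sphere_measure :: "(real^3) measure" where
  "sphere_measure =
     distr (density lborel (\<lambda>(\<theta>, \<phi>). indicator ({0..pi} \<times> {0..2 * pi}) (\<theta>, \<phi>) * ennreal (sin \<theta>)))
       (restrict_space borel (sphere 0 1)) (\<lambda>(\<theta>, \<phi>). sph \<theta> \<phi>)"

lemma sph_in_sphere: "sph \<theta> \<phi> \<in> sphere 0 1"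
proof -
  have "(sin \<theta> * cos \<phi>)\<^sup>2 + (sin \<theta> * sin \<phi>)\<^sup>2 + (cos \<theta>)\<^sup>2
      = (sin \<theta>)\<^sup>2 * ((cos \<phi>)\<^sup>2 + (sin \<phi>)\<^sup>2) + (cos \<theta>)\<^sup>2"
    by (simp only: power_mult_distrib distrib_left)
  also have "\<dots> = 1" by simp
  finally show ?thesis
    by (simp add: norm_eq_1 inner_vec_def sum_3 sph_def power2_eq_square)
qed

lemma measurable_sph:
  "(\<lambda>(\<theta>, \<phi>). sph \<theta> \<phi>) \<in> borel \<rightarrow>\<^sub>M restrict_space borel (sphere 0 1)"
proof (rule measurable_restrict_space2)
  have "continuous_on UNIV (\<lambda>p. sph (fst p) (snd p))"
    unfolding continuous_on_componentwise[of UNIV "\<lambda>p. sph (fst p) (snd p)"]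
    by (auto simp: Basis_vec_def inner_axis sph_def UNIV_3 intro!: continuous_intros)
  then show "(\<lambda>(\<theta>, \<phi>). sph \<theta> \<phi>) \<in> borel_measurable borel"
    by (simp add: case_prod_unfold borel_measurable_continuous_onI)
qed (use sph_in_sphere in auto)

lemma integral_sphere_measure:
  fixes f :: "real^3 \<Rightarrow> real"
  assumes "f \<in> borel_measurable (restrict_space borel (sphere 0 1))"
  shows "integral\<^sup>L sphere_measure f =
    (LINT (\<theta>, \<phi>):{0..pi} \<times> {0..2 * pi}|lborel. f (sph \<theta> \<phi>) * sin \<theta>)"
proof -
  let ?w = "\<lambda>p :: real \<times> real. indicator ({0..pi} \<times> {0..2 * pi}) p * sin (fst p)"
  have w: "?w \<in> borel_measurable lborel"
    by (intro borel_measurable_times borel_measurable_indicator)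
       (auto intro!: borel_measurable_continuous_onI continuous_intros
             borel_closed closed_Times)
  have eq: "(\<lambda>(\<theta>, \<phi>). indicator ({0..pi} \<times> {0..2 * pi}) (\<theta>, \<phi>) * ennreal (sin \<theta>))
      = (\<lambda>p. ennreal (?w p))"
    by (auto simp: fun_eq_iff indicator_def)
  have pos: "0 \<le> ?w p" for p
    by (auto simp: indicator_def sin_ge_zero)
  have m: "(\<lambda>(\<theta>, \<phi>). sph \<theta> \<phi>)
      \<in> density lborel (\<lambda>p. ennreal (?w p)) \<rightarrow>\<^sub>M restrict_space borel (sphere 0 1)"
    using measurable_sph by (simp cong: measurable_cong_sets)
  have fm: "(\<lambda>p. f (sph (fst p) (snd p))) \<in> borel_measurable lborel"
    using measurable_compose[OF measurable_sph assms] by (simp add: case_prod_unfold)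
  show ?thesis
    unfolding sphere_measure_def eq integral_distr[OF m assms]
    using integral_density[OF fm w] pos
    by (simp add: case_prod_unfold set_lebesgue_integral_def mult_ac)
qed

definition sph_inner :: "(real^3 \<Rightarrow> real) \<Rightarrow> (real^3 \<Rightarrow> real) \<Rightarrow> real" where
  "sph_inner f g = (\<integral>x. f x * g x \<partial>sphere_measure)"

text \<open>Rodrigues' formula.\<close>
definition legendre :: "nat \<Rightarrow> real poly" where
  "legendre n = smult (1 / (2 ^ n * fact n)) ((pderiv ^^ n) ([:-1, 0, 1:] ^ n))"

text \<open>
  Real orthonormal spherical harmonics. In coordinates, the real and imaginary parts of
  \<open>(x\<^sub>1 + \<i> x\<^sub>2) ^ k\<close> are \<open>sin \<theta> ^ k * cos (k * \<phi>)\<close> and \<open>sin \<theta> ^ k * sin (k * \<phi>)\<close>;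
  see \<open>sph_harm_sph\<close> below.
\<close>
definition sph_harm :: "nat \<Rightarrow> int \<Rightarrow> real^3 \<Rightarrow> real" where
  "sph_harm n m x = (let k = nat \<bar>m\<bar> in
     sqrt ((2 * real n + 1) / (4 * pi) * (fact (n - k) / fact (n + k))) *
     (if m = 0 then 1 else sqrt 2) *
     poly ((pderiv ^^ k) (legendre n)) (x $ 3) *
     (if 0 \<le> m then Re (Complex (x $ 1) (x $ 2) ^ k) else Im (Complex (x $ 1) (x $ 2) ^ k)))"

lemma sph_harm_sph:
  "sph_harm n m (sph \<theta> \<phi>) =
     sqrt ((2 * real n + 1) / (4 * pi) * (fact (n - nat \<bar>m\<bar>) / fact (n + nat \<bar>m\<bar>))) *
     (if m = 0 then 1 else sqrt 2) *
     ((sin \<theta>) ^ nat \<bar>m\<bar> * poly ((pderiv ^^ nat \<bar>m\<bar>) (legendre n)) (cos \<theta>)) *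
     (if 0 \<le> m then cos (\<bar>m\<bar> * \<phi>) else sin (\<bar>m\<bar> * \<phi>))"
proof -
  have "Complex (sin \<theta> * cos \<phi>) (sin \<theta> * sin \<phi>) = of_real (sin \<theta>) * cis \<phi>"
    by (simp add: complex_eq_iff)
  then have "Complex (sin \<theta> * cos \<phi>) (sin \<theta> * sin \<phi>) ^ k
      = of_real (sin \<theta> ^ k) * cis (real k * \<phi>)" for k
    by (simp add: power_mult_distrib Complex.DeMoivre)
  then show ?thesis
    by (simp add: sph_harm_def sph_def Let_def)
qed

lemma sph_harm_1:
  "sph_harm 1 0 (sph \<theta> \<phi>) = 1 / 2 * sqrt (3 / pi) * cos \<theta>"
  "sph_harm 1 1 (sph \<theta> \<phi>) = 1 / 2 * sqrt (3 / pi) * (sin \<theta> * cos \<phi>)"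
  "sph_harm 1 (- 1) (sph \<theta> \<phi>) = 1 / 2 * sqrt (3 / pi) * (sin \<theta> * sin \<phi>)"
proof -
  have "sqrt 8 = 2 * sqrt (2 :: real)"
    using real_sqrt_mult[of 4 2] by simp
  then show
    "sph_harm 1 0 (sph \<theta> \<phi>) = 1 / 2 * sqrt (3 / pi) * cos \<theta>"
    "sph_harm 1 1 (sph \<theta> \<phi>) = 1 / 2 * sqrt (3 / pi) * (sin \<theta> * cos \<phi>)"
    "sph_harm 1 (- 1) (sph \<theta> \<phi>) = 1 / 2 * sqrt (3 / pi) * (sin \<theta> * sin \<phi>)"
    by (simp_all add: sph_harm_sph legendre_def pderiv_pCons real_sqrt_divide real_sqrt_mult)
qed

definition sph_coeff :: "(real^3 \<Rightarrow> real) \<Rightarrow> nat \<Rightarrow> int \<Rightarrow> real" where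
  "sph_coeff u n m = sph_inner u (sph_harm n m)"

definition sobolev_term :: "nat \<Rightarrow> (real^3 \<Rightarrow> real) \<Rightarrow> nat \<Rightarrow> real" where
  "sobolev_term k u n =
     (\<Sum>m\<in>{- int n..int n}. (real n * (real n + 1) + 1) ^ k * (sph_coeff u n m)\<^sup>2)"

text \<open>Membership in \<open>H\<^sup>k\<close>; \<open>sobolev_norm\<close> is only meaningful for such functions.\<close>
definition in_sobolev :: "nat \<Rightarrow> (real^3 \<Rightarrow> real) \<Rightarrow> bool" where
  "in_sobolev k u \<longleftrightarrow>
     u \<in> borel_measurable sphere_measure \<and> integrable sphere_measure (\<lambda>x. (u x)\<^sup>2) \<and>
     summable (sobolev_term k u)"

definition sobolev_norm :: "nat \<Rightarrow> (real^3 \<Rightarrow> real) \<Rightarrow> real" where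
  "sobolev_norm k u = sqrt (\<Sum>n. sobolev_term k u n)"

end

theory Submission imports Defs begin

text \<open>
  Write \<open>\<Psi> = \<alpha> Y\<^sub>1\<^sup>0 + \<psi>\<close> and \<open>g = \<Omega> + 2 \<Psi>\<close>, so that \<open>g = (\<Delta> + 2) \<psi>\<close> is small together with
  \<open>\<Omega> + 2 \<alpha> Y\<^sub>1\<^sup>0\<close>. Since \<open>{\<Psi>, \<Psi>} = 0\<close>, the steady equation reads \<open>{\<Psi>, g} = 0\<close>, which up to constants is
  \<open>\<alpha> \<partial>\<^sub>\<phi> g = {\<psi>, g}\<close>. Split \<open>\<psi>\<close> and \<open>g\<close> into zonal and nonzonal parts. The bracket of the zonal parts
  vanishes, and the other brackets are at most a small constant times \<open>\<bar>\<partial>\<^sub>\<phi> g\<bar> + \<bar>\<nabla> \<psi>\<^sub>1\<bar>\<close>, where \<open>\<psi>\<^sub>1\<close> is the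
  nonzonal part of \<open>\<psi>\<close>: the \<open>H\<^sup>4\<close> bound controls the gradients of \<open>\<psi>\<close> and \<open>g\<close> uniformly, and also
  \<open>\<partial>\<^sub>\<theta> / sin \<theta>\<close> of their zonal parts. By hypothesis \<open>\<psi>\<^sub>1\<close> has no modes with \<open>n = 1\<close>, which form the
  kernel of \<open>\<Delta> + 2\<close>, so the \<open>L\<^sup>2\<close> norm of \<open>\<nabla> \<psi>\<^sub>1\<close> is bounded by that of \<open>\<partial>\<^sub>\<phi> g\<close>. Hence
  \<open>\<partial>\<^sub>\<phi> g = 0\<close> and \<open>\<psi>\<^sub>1 = 0\<close>.
\<close>

section \<open>Legendre polynomials\<close>

text \<open>The obstacle is the degeneration at the poles. The bracket divides by
  \<open>sin \<theta>\<close>, while the quantity to be controlled, the longitude derivative of g,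
  does not. A uniform bound for the zonal derivative of psi would therefore not absorb its product
  with that quantity; a bound by a small multiple of \<open>sin \<theta>\<close> does. In the other
  terms one factor is bounded uniformly and the other is a component of the gradient of the nonzonal
  part of psi, kept for the integral estimate. The exponent 4 makes termwise estimates sufficient.
  Coefficients in degree n are O(n^-4), first derivatives of harmonics are O(n^(3/2)), and there are
  2n+1 orders, so degree n contributes O(n^(-3/2)), which is summable. Dividing a zonal derivative
  by \<open>sin \<theta>\<close> costs one more power of n, but each degree has a single zonal mode,
  so the same series results. The norm speaks of coefficients only. Passing back to functions
  requires completeness of the harmonics; uniform convergence of the series reduces it to the
  density of polynomials.\<close>

lemma higher_pderiv_ode:
  fixes F :: "real poly" and c e :: real
  assumes "[:1, 0, -1:] * pderiv (pderiv F) - smult (2 * c) ([:0, 1:] * pderiv F) + smult e F = 0"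
  shows "[:1, 0, -1:] * (pderiv ^^ Suc (Suc j)) F
      - smult (2 * (c + real j)) ([:0, 1:] * (pderiv ^^ Suc j) F)
      + smult (e - 2 * real j * c - real j * (real j - 1)) ((pderiv ^^ j) F) = 0"
proof (induction j)
  case 0
  then show ?case using assms by simp
next
  case (Suc j)
  let ?D = "\<lambda>i. (pderiv ^^ i) F"
  \<comment> \<open>Differentiating once more raises the middle parameter \<open>c + j\<close> by
    one and lowers the last coefficient by \<open>2 * (c + j)\<close>, which accounts for the
    quadratic expression in \<open>j\<close>.\<close>
  have "pderiv ([:1, 0, -1:] * ?D (Suc (Suc j))
      - smult (2 * (c + real j)) ([:0, 1:] * ?D (Suc j))
      + smult (e - 2 * real j * c - real j * (real j - 1)) (?D j)) = 0"
    by (simp only: Suc pderiv_0)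
  then have D: "poly (pderiv ([:1, 0, -1:] * ?D (Suc (Suc j))
      - smult (2 * (c + real j)) ([:0, 1:] * ?D (Suc j))
      + smult (e - 2 * real j * c - real j * (real j - 1)) (?D j))) x = 0" for x
    by simp
  have "poly ([:1, 0, -1:] * ?D (Suc (Suc (Suc j)))
      - smult (2 * (c + real (Suc j))) ([:0, 1:] * ?D (Suc (Suc j)))
      + smult (e - 2 * real (Suc j) * c - real (Suc j) * (real (Suc j) - 1)) (?D (Suc j))) x = 0"
          for x
    using D[of x] by (simp add: pderiv_add pderiv_diff pderiv_minus pderiv_mult pderiv_smult
        pderiv_pCons algebra_simps)
  then show ?case
    by (metis poly_all_0_iff_0)
qed

lemma pderiv_weight_power:
  "[:-1, 0, 1:] * pderiv ([:-1, 0, 1:] ^ n) = smult (2 * real n) ([:0, 1::real:] * [:-1, 0, 1:] ^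
      n)"
proof (cases n)
  case (Suc m)
  have "pderiv [:-1, 0, 1::real:] = smult 2 [:0, 1:]"
    by (simp add: pderiv_pCons)
  then show ?thesis
    unfolding Suc pderiv_power_Suc by (simp add: mult_ac)
qed simp

text \<open>W = (x^2 - 1)^n satisfies the first-order equation (x^2 - 1) W' = 2 n x W. One
  differentiation puts it into the form of \<open>higher_pderiv_ode\<close> with c = 1 - n and e =
  2n, and n further ones give Legendre's equation.\<close>

lemma legendre_ode:
  "[:1, 0, -1:] * pderiv (pderiv (legendre n)) - smult 2 ([:0, 1:] * pderiv (legendre n))
     + smult (real n * (real n + 1)) (legendre n) = 0"
proof -
  let ?W = "[:-1, 0, 1::real:] ^ n" and ?c = "1 / (2 ^ n * fact n) :: real"
  have D: "poly (pderiv ([:-1, 0, 1:] * pderiv ?W)) x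
      = poly (pderiv (smult (2 * real n) ([:0, 1::real:] * ?W))) x" for x
    by (simp only: pderiv_weight_power)
  have "poly ([:1, 0, -1:] * pderiv (pderiv ?W)
      - smult (2 * (1 - real n)) ([:0, 1:] * pderiv ?W) + smult (2 * real n) ?W) x = 0" for x
    using D[of x] by (simp add: pderiv_mult pderiv_diff pderiv_add pderiv_smult pderiv_pCons
        algebra_simps del: poly_power)
  then have "[:1, 0, -1:] * pderiv (pderiv ?W)
      - smult (2 * (1 - real n)) ([:0, 1:] * pderiv ?W) + smult (2 * real n) ?W = 0"
    by (metis poly_all_0_iff_0)
  from higher_pderiv_ode[OF this, of n]
  have "[:1, 0, -1:] * (pderiv ^^ Suc (Suc n)) ?W - smult 2 ([:0, 1:] * (pderiv ^^ Suc n) ?W)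
      + smult (real n * (real n + 1)) ((pderiv ^^ n) ?W) = 0"
    by (simp add: algebra_simps)
  then have "smult ?c ([:1, 0, -1:] * (pderiv ^^ Suc (Suc n)) ?W - smult 2 ([:0, 1:] * (pderiv ^^
      Suc n) ?W)
      + smult (real n * (real n + 1)) ((pderiv ^^ n) ?W)) = 0"
    by (simp only: smult_0_right)
  then show ?thesis
    unfolding legendre_def pderiv_smult
    by (simp add: smult_add_right smult_diff_right mult_ac)
qed

definition dlegendre :: "nat \<Rightarrow> nat \<Rightarrow> real \<Rightarrow> real" where
  "dlegendre n k = poly ((pderiv ^^ k) (legendre n))"

lemma dlegendre_ode:
  "(1 - x\<^sup>2) * dlegendre n (Suc (Suc k)) x - 2 * (real k + 1) * x * dlegendre n (Suc k) x
     + (real n * (real n + 1) - real k * (real k + 1)) * dlegendre n k x = 0"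
proof -
  have "[:1, 0, -1:] * pderiv (pderiv (legendre n)) - smult (2 * 1) ([:0, 1:] * pderiv (legendre n))
     + smult (real n * (real n + 1)) (legendre n) = 0"
    using legendre_ode[of n] by simp
  from arg_cong[OF higher_pderiv_ode[OF this, of k], of "\<lambda>p. poly p x"]
  show ?thesis by (simp add: dlegendre_def algebra_simps power2_eq_square)
qed

lemma dlegendre_deriv: "(dlegendre n k has_real_derivative dlegendre n (Suc k) x) (at x)"
  unfolding dlegendre_def by (simp add: poly_DERIV)

lemma degree_weight_power: "degree ([:-1, 0, 1::real:] ^ n) = 2 * n"
  by (simp add: degree_power_eq)

lemma degree_legendre: "degree ((pderiv ^^ k) (legendre n)) = n - k"
  by (simp add: legendre_def higher_pderiv_smult degree_higher_pderiv degree_weight_power)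

lemma dlegendre_eq_0: "n < k \<Longrightarrow> dlegendre n k x = 0"
proof -
  assume "n < k"
  then obtain j where k: "k = Suc j" "n \<le> j" by (cases k) auto
  have "degree ((pderiv ^^ j) (legendre n)) = 0"
    using k by (simp add: degree_legendre)
  then have "pderiv ((pderiv ^^ j) (legendre n)) = 0"
    by (simp add: pderiv_eq_0_iff)
  then show ?thesis by (simp add: dlegendre_def k)
qed

text \<open>Put X = x^2 - 1. Since (2x)^2 = 4X + 4, the second derivative of X^(n+2) is a
  combination of X^(n+1) and X^n, and n+1 further derivatives turn these into Rodrigues'
  expressions. The recurrence later yields endpoint values, the derivative bound and the
  norm.\<close>

lemma pderiv_legendre_rec:
  "pderiv (legendre (Suc (Suc n)))
     = pderiv (legendre n) + smult (2 * real n + 3) (legendre (Suc n))"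
proof -
  let ?X = "[:-1, 0, 1::real:]"
  have dX: "pderiv ?X = [:0, 2:]" by (simp add: pderiv_pCons)
  have sq: "[:0, 2:] * [:0, 2:] = smult 4 ?X + 4"
    by (simp add: numeral_poly)
  have "pderiv (pderiv (?X ^ Suc (Suc n)))
      = smult (real (n + 2)) (pderiv (?X ^ Suc n * [:0, 2:]))"
    by (simp only: pderiv_power_Suc dX pderiv_smult mult_smult_left) simp
  also have "pderiv (?X ^ Suc n * [:0, 2:])
      = ?X ^ Suc n * 2 + smult (real (n + 1)) (?X ^ n * ([:0, 2:] * [:0, 2:]))"
    by (simp only: pderiv_mult pderiv_power_Suc dX) (simp add: pderiv_pCons numeral_poly mult_ac
        del: power_Suc)
  also have "\<dots> = smult (4 * real n + 6) (?X ^ Suc n) + smult (4 * real (n + 1)) (?X ^ n)"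
    unfolding sq
    by (simp add: poly_eq_poly_eq_iff[symmetric] fun_eq_iff algebra_simps numeral_poly)
  finally have D2: "pderiv (pderiv (?X ^ Suc (Suc n)))
      = smult (real (n + 2)) (smult (4 * real n + 6) (?X ^ Suc n) + smult (4 * real (n + 1)) (?X ^
          n))" .
  have sh: "pderiv ((pderiv ^^ k) p) = (pderiv ^^ k) (pderiv p)" for k and p :: "real poly"
    by (simp add: funpow_swap1)
  have "pderiv ((pderiv ^^ Suc (Suc n)) (?X ^ Suc (Suc n)))
      = (pderiv ^^ Suc n) (pderiv (pderiv (?X ^ Suc (Suc n))))"
    by (subst sh, subst funpow.simps(2), subst o_apply, rule sh)
  also have "\<dots> = smult (real (n + 2) * (4 * real n + 6)) ((pderiv ^^ Suc n) (?X ^ Suc n))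
      + smult (real (n + 2) * (4 * real (n + 1))) (pderiv ((pderiv ^^ n) (?X ^ n)))"
    unfolding D2 higher_pderiv_smult higher_pderiv_add
    by (simp only: smult_add_right smult_smult) simp
  finally have E: "pderiv ((pderiv ^^ Suc (Suc n)) (?X ^ Suc (Suc n))) = \<dots>" .
  have c1: "real (n + 2) * (4 * real n + 6) / (2 ^ Suc (Suc n) * fact (Suc (Suc n)))
      = (2 * real n + 3) / (2 ^ Suc n * fact (Suc n))"
    by (simp add: field_simps del: of_nat_Suc)
  have c2: "real (n + 2) * (4 * real (n + 1)) / (2 ^ Suc (Suc n) * fact (Suc (Suc n)))
      = 1 / (2 ^ n * fact n)"
  proof -
    have "2 ^ Suc (Suc n) * fact (Suc (Suc n)) = (real (n + 2) * (4 * real (n + 1))) * (2 ^ n *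
        fact n)"
      by (simp add: algebra_simps)
    then show ?thesis
      by (elim ssubst, intro nonzero_divide_mult_cancel_left) simp
  qed
  have "pderiv (legendre (Suc (Suc n)))
      = smult (real (n + 2) * (4 * real n + 6) / (2 ^ Suc (Suc n) * fact (Suc (Suc n)))) ((pderiv
          ^^ Suc n) (?X ^ Suc n))
      + smult (real (n + 2) * (4 * real (n + 1)) / (2 ^ Suc (Suc n) * fact (Suc (Suc n)))) (pderiv
          ((pderiv ^^ n) (?X ^ n)))"
    unfolding legendre_def pderiv_smult E smult_add_right smult_smult
    by (simp del: fact_Suc power_Suc funpow.simps)
  then show ?thesis
    unfolding c1 c2 legendre_def pderiv_smult smult_smult
    by (simp add: add.commute)
qed

lemma dlegendre_rec: "dlegendre (Suc (Suc n)) 1 x = dlegendre n 1 x + (2 * real n + 3) * dlegendre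
    (Suc n) 0 x"
  using arg_cong[OF pderiv_legendre_rec[of n], of "\<lambda>p. poly p x"] by (simp add: dlegendre_def)

section \<open>Values of Legendre polynomials at the endpoints\<close>

lemma legendre_0: "legendre 0 = 1" and legendre_1: "legendre 1 = [:0, 1:]"
  by (simp_all add: legendre_def pderiv_pCons)

lemma dlegendre_0: "dlegendre 0 0 x = 1" "dlegendre 0 (Suc k) x = 0" and dlegendre_1: "dlegendre
    (Suc 0) 0 x = x" "dlegendre (Suc 0) (Suc 0) x = 1"
proof -
  show "dlegendre 0 0 x = 1" by (simp add: dlegendre_def legendre_0)
  show "dlegendre 0 (Suc k) x = 0" by (simp add: dlegendre_eq_0)
  show "dlegendre (Suc 0) 0 x = x" "dlegendre (Suc 0) (Suc 0) x = 1"
    using legendre_1 by (simp_all add: dlegendre_def pderiv_pCons)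
qed

lemma dlegendre_deriv_at_1: "2 * dlegendre n 1 1 = real n * (real n + 1) * dlegendre n 0 1"
  using dlegendre_ode[of 1 n 0] by simp

lemma dlegendre_deriv_at_m1: "2 * dlegendre n 1 (-1) = - (real n * (real n + 1) * dlegendre n 0
    (-1))"
  using dlegendre_ode[of "-1" n 0] by simp

text \<open>At an endpoint the leading coefficient of Legendre's equation vanishes, so the
  derivative there is a multiple of the value. The recurrence for derivatives thereby becomes one
  for values.\<close>

lemma dlegendre_at_1: "dlegendre n 0 1 = 1"
proof (induction n rule: less_induct)
  case (less n)
  consider "n = 0" | "n = Suc 0" | m where "n = Suc (Suc m)"
    by (metis not0_implies_Suc)
  then show ?case
  proof cases
    case 3
    have "dlegendre m 0 1 = 1" "dlegendre (Suc m) 0 1 = 1"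
      using less[of m] less[of "Suc m"] 3 by simp_all
    then have "2 * dlegendre n 1 1 = (real m + 2) * (real m + 3)"
      using dlegendre_deriv_at_1[of m] dlegendre_rec[of m 1] unfolding 3 by (simp add:
          algebra_simps)
    then have "(real m + 2) * (real m + 3) * dlegendre n 0 1 = (real m + 2) * (real m + 3)"
      unfolding dlegendre_deriv_at_1 3 by (simp add: algebra_simps)
    moreover have "(real m + 2) * (real m + 3) \<noteq> 0"
      by (simp add: add_nonneg_eq_0_iff)
    ultimately show ?thesis
      using mult_cancel_left2 by blast
  qed (simp_all add: dlegendre_0 dlegendre_1)
qed

lemma dlegendre_at_m1: "dlegendre n 0 (-1) = (-1) ^ n"
proof (induction n rule: less_induct)
  case (less n)
  consider "n = 0" | "n = Suc 0" | m where "n = Suc (Suc m)"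
    by (metis not0_implies_Suc)
  then show ?case
  proof cases
    case 3
    have "dlegendre m 0 (-1) = (-1) ^ n" "dlegendre (Suc m) 0 (-1) = - ((-1) ^ n)"
      using less[of m] less[of "Suc m"] 3 by simp_all
    then have "2 * dlegendre n 1 (-1) = - ((real m + 2) * (real m + 3) * (-1) ^ n)"
      using dlegendre_deriv_at_m1[of m] dlegendre_rec[of m "-1"] unfolding 3 by (simp add:
          algebra_simps)
    then have "(real m + 2) * (real m + 3) * dlegendre n 0 (-1) = (real m + 2) * (real m + 3) *
        (-1) ^ n"
      unfolding dlegendre_deriv_at_m1 3 by (simp add: algebra_simps)
    moreover have "(real m + 2) * (real m + 3) \<noteq> 0"
      by (simp add: add_nonneg_eq_0_iff)
    ultimately show ?thesis
      using mult_left_cancel by blast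
  qed (simp_all add: dlegendre_0 dlegendre_1)
qed

section \<open>Bounds on spherical harmonics\<close>

text \<open>The associated Legendre function of degree n and order k, without the alternating
  Condon-Shortley sign.\<close>

definition assoc_leg :: "nat \<Rightarrow> nat \<Rightarrow> real \<Rightarrow> real" where
  "assoc_leg n k \<theta> = sin \<theta> ^ k * dlegendre n k (cos \<theta>)"

text \<open>The quotient of \<open>assoc_leg\<close> by \<open>sin \<theta>\<close>, written so that
  it stays regular at the poles. For k = 0 the truncated subtraction makes it no quotient, but there
  it only meets a factor 0.\<close>

definition assoc_leg_quot :: "nat \<Rightarrow> nat \<Rightarrow> real \<Rightarrow> real" where
  "assoc_leg_quot n k \<theta> = sin \<theta> ^ (k - 1) * dlegendre n k (cos \<theta>)"

definition dassoc_leg :: "nat \<Rightarrow> nat \<Rightarrow> real \<Rightarrow> real" where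
  "dassoc_leg n k \<theta> = real k * cos \<theta> * assoc_leg_quot n k \<theta> - assoc_leg n (Suc k) \<theta>"

text \<open>The coefficient (n - k)(n + k + 1) of the angular momentum ladder operators between the
  orders k and k + 1.\<close>

definition ladder_coeff :: "nat \<Rightarrow> nat \<Rightarrow> real" where
  "ladder_coeff n k = real n * (real n + 1) - real k * (real k + 1)"

text \<open>The square of the normalising constant in \<open>sph_harm\<close>, without the factor 2
  that belongs to nonzero orders.\<close>

definition harm_norm :: "nat \<Rightarrow> nat \<Rightarrow> real" where
  "harm_norm n k = (2 * real n + 1) / (4 * pi) * (fact (n - k) / fact (n + k))"

lemma dlegendre_cos_deriv:
  "((\<lambda>t. dlegendre n k (cos t)) has_real_derivative - sin \<theta> * dlegendre n (Suc k) (cos \<theta>)) (at \<theta>)"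
  using DERIV_chain2[OF dlegendre_deriv DERIV_cos] by (simp add: mult.commute)

lemma continuous_on_dlegendre_cos [continuous_intros]:
  fixes f :: "'a :: t2_space \<Rightarrow> real"
  assumes "continuous_on S f"
  shows "continuous_on S (\<lambda>x. dlegendre n k (cos (f x)))"
  unfolding dlegendre_def by (intro continuous_on_poly continuous_on_cos assms)

lemma assoc_leg_deriv: "(assoc_leg n k has_real_derivative dassoc_leg n k \<theta>) (at \<theta>)"
proof -
  have "((\<lambda>t. sin t ^ k * dlegendre n k (cos t)) has_real_derivative dassoc_leg n k \<theta>) (at \<theta>)"
    by (rule derivative_eq_intros dlegendre_cos_deriv refl)+
       (simp add: dassoc_leg_def assoc_leg_def assoc_leg_quot_def algebra_simps)
  then show ?thesis by (simp add: assoc_leg_def[abs_def])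
qed

lemma assoc_leg_sin_assoc_leg_quot: "0 < k \<Longrightarrow> assoc_leg n k \<theta> = sin \<theta> * assoc_leg_quot n k \<theta>"
  by (cases k) (simp_all add: assoc_leg_def assoc_leg_quot_def)

text \<open>This is the equation of \<open>dlegendre_ode\<close> times a power of
  \<open>sin \<theta>\<close>. The two gradient components of a harmonic become half the sum and
  half the difference of the neighbouring orders, so no division by \<open>sin \<theta>\<close>
  remains.\<close>

lemma cos_assoc_leg_quot_ladder:
  "2 * real (Suc j) * cos \<theta> * assoc_leg_quot n (Suc j) \<theta> = assoc_leg n (Suc (Suc j)) \<theta> +
      ladder_coeff n j * assoc_leg n j \<theta>"
proof -
  have "(sin \<theta>)\<^sup>2 * dlegendre n (Suc (Suc j)) (cos \<theta>) - 2 * (real j + 1) * cos \<theta> * dlegendre n (Suc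
      j) (cos \<theta>)
      + ladder_coeff n j * dlegendre n j (cos \<theta>) = 0"
    using dlegendre_ode[of "cos \<theta>" n j] by (simp add: ladder_coeff_def sin_squared_eq)
  then have "sin \<theta> ^ j * ((sin \<theta>)\<^sup>2 * dlegendre n (Suc (Suc j)) (cos \<theta>)
      - 2 * (real j + 1) * cos \<theta> * dlegendre n (Suc j) (cos \<theta>) + ladder_coeff n j * dlegendre n j
          (cos \<theta>)) = 0"
    by simp
  then show ?thesis
    by (simp add: assoc_leg_def assoc_leg_quot_def algebra_simps power2_eq_square)
qed

lemma dassoc_leg_Suc: "dassoc_leg n (Suc j) \<theta> = (ladder_coeff n j * assoc_leg n j \<theta> - assoc_leg n
    (Suc (Suc j)) \<theta>) / 2"
proof -
  have "a - b = (l - b) / 2" if "2 * a = b + l" for a b l :: real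
    using that by simp
  then show ?thesis
    unfolding dassoc_leg_def using cos_assoc_leg_quot_ladder[of j \<theta> n] by (simp only: mult.assoc)
qed

lemma dassoc_leg_0: "dassoc_leg n 0 \<theta> = - assoc_leg n 1 \<theta>"
  by (simp add: dassoc_leg_def)

text \<open>Splitting the squared quotient by sin^2 + cos^2 = 1 leaves the squares of a half sum and
  a half difference; their mixed terms cancel. This expresses the squared gradient through
  \<open>assoc_leg\<close> alone.\<close>

lemma dassoc_leg_assoc_leg_quot_squares:
  "(dassoc_leg n (Suc j) \<theta>)\<^sup>2 + (real (Suc j) * assoc_leg_quot n (Suc j) \<theta>)\<^sup>2
     = ((ladder_coeff n j * assoc_leg n j \<theta>)\<^sup>2 + (assoc_leg n (Suc (Suc j)) \<theta>)\<^sup>2) / 2 + (real (Suc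
         j) * assoc_leg n (Suc j) \<theta>)\<^sup>2"
proof -
  let ?b = "real (Suc j) * assoc_leg_quot n (Suc j) \<theta>"
  have "?b\<^sup>2 = ?b\<^sup>2 * ((sin \<theta>)\<^sup>2 + (cos \<theta>)\<^sup>2)" by simp
  also have "\<dots> = (real (Suc j) * assoc_leg n (Suc j) \<theta>)\<^sup>2 + (cos \<theta> * ?b)\<^sup>2"
    by (simp only: assoc_leg_sin_assoc_leg_quot[of "Suc j"] zero_less_Suc power_mult_distrib
        distrib_left) (simp add: algebra_simps)
  also have "cos \<theta> * ?b = (assoc_leg n (Suc (Suc j)) \<theta> + ladder_coeff n j * assoc_leg n j \<theta>) / 2"
    using cos_assoc_leg_quot_ladder[of j \<theta> n] by (simp add: algebra_simps)
  finally have "?b\<^sup>2 = (real (Suc j) * assoc_leg n (Suc j) \<theta>)\<^sup>2 + ((assoc_leg n (Suc (Suc j)) \<theta> +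
      ladder_coeff n j * assoc_leg n j \<theta>) / 2)\<^sup>2" .
  then show ?thesis
    unfolding dassoc_leg_Suc by (simp add: power2_eq_square field_simps)
qed

lemma ladder_coeff_factor: "j \<le> n \<Longrightarrow> ladder_coeff n j = real (n - j) * real (n + j + 1)"
  by (simp add: ladder_coeff_def of_nat_diff algebra_simps)

text \<open>Ladder coefficients are exactly the ratios of consecutive squared normalising constants;
  this is what lets the sum over orders telescope and makes norms independent of the order.\<close>

lemma harm_norm_ladder_coeff: "j < n \<Longrightarrow> harm_norm n (Suc j) * ladder_coeff n j = harm_norm n j"
proof -
  assume j: "j < n"
  have f: "fact (n - j) = real (n - j) * fact (n - Suc j)"
    using j by (metis Suc_diff_Suc fact_Suc of_nat_fact of_nat_mult)
  have "fact (n - Suc j) / fact (n + Suc j) * ladder_coeff n j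
     = (real (n - j) * fact (n - Suc j)) / (fact (n + Suc j) / real (n + j + 1))"
    using j by (simp add: ladder_coeff_factor)
  also have "fact (n + Suc j) / real (n + j + 1) = fact (n + j)"
    by (simp add: field_simps)
  finally have "fact (n - Suc j) / fact (n + Suc j) * ladder_coeff n j = fact (n - j) / fact (n +
      j)"
    by (simp only: f)
  then show ?thesis by (simp only: harm_norm_def mult.assoc)
qed

lemma harm_norm_pos: "harm_norm n k > 0"
  by (simp add: harm_norm_def)

lemma harm_norm_0: "harm_norm n 0 = (2 * real n + 1) / (4 * pi)"
  by (simp add: harm_norm_def)

lemma assoc_leg_eq_0: "n < k \<Longrightarrow> assoc_leg n k \<theta> = 0"
  by (simp add: assoc_leg_def dlegendre_eq_0)

text \<open>The ladder relations make the derivative of the left-hand side telescope to zero.\<close>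
lemma addition_theorem:
  "harm_norm n 0 * (assoc_leg n 0 \<theta>)\<^sup>2 + (\<Sum>j<n. 2 * harm_norm n (Suc j) * (assoc_leg n (Suc j)
      \<theta>)\<^sup>2) = harm_norm n 0"
proof -
  define D where "D = (\<lambda>t. harm_norm n 0 * (assoc_leg n 0 t)\<^sup>2 + (\<Sum>j<n. 2 * harm_norm n (Suc j) *
      (assoc_leg n (Suc j) t)\<^sup>2))"
  have "(D has_real_derivative 0) (at t)" for t
  proof -
    let ?f = "\<lambda>j. 2 * harm_norm n j * assoc_leg n j t * assoc_leg n (Suc j) t"
    have "(D has_real_derivative
        harm_norm n 0 * (2 * assoc_leg n 0 t * dassoc_leg n 0 t) + (\<Sum>j<n. 2 * harm_norm n (Suc j) *
            (2 * assoc_leg n (Suc j) t * dassoc_leg n (Suc j) t))) (at t)"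
      unfolding D_def by (auto intro!: derivative_eq_intros assoc_leg_deriv sum.cong)
    also have "(\<Sum>j<n. 2 * harm_norm n (Suc j) * (2 * assoc_leg n (Suc j) t * dassoc_leg n (Suc j)
        t)) = (\<Sum>j<n. ?f j - ?f (Suc j))"
    proof (rule sum.cong)
      fix j assume "j \<in> {..<n}"
      then have "harm_norm n j = harm_norm n (Suc j) * ladder_coeff n j" by (simp add:
          harm_norm_ladder_coeff)
      then show "2 * harm_norm n (Suc j) * (2 * assoc_leg n (Suc j) t * dassoc_leg n (Suc j) t) =
          ?f j - ?f (Suc j)"
        unfolding dassoc_leg_Suc by (simp add: field_simps)
    qed simp
    also have "\<dots> = ?f 0 - ?f n"
      by (rule sum_lessThan_telescope')
    finally show ?thesis
      by (simp add: assoc_leg_eq_0 dassoc_leg_0)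
  qed
  then have "D \<theta> = D 0"
    using DERIV_isconst_all by blast
  \<comment> \<open>At the north pole \<open>sin \<theta> = 0\<close> removes every positive order,
    and P_n(1) = 1.\<close>
  also have "D 0 = harm_norm n 0"
    by (simp add: D_def assoc_leg_def dlegendre_at_1)
  finally show ?thesis by (simp add: D_def)
qed

text \<open>All terms of the addition theorem are nonnegative, so each is at most the total.\<close>

lemma harm_norm_assoc_leg_le: "harm_norm n k * (assoc_leg n k \<theta>)\<^sup>2 \<le> harm_norm n 0"
proof (cases k)
  case 0
  have "0 \<le> (\<Sum>j<n. 2 * harm_norm n (Suc j) * (assoc_leg n (Suc j) \<theta>)\<^sup>2)"
    by (intro sum_nonneg) (simp add: less_imp_le harm_norm_pos)
  then show ?thesis using addition_theorem[of n \<theta>] 0 by simp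
next
  case (Suc j)
  show ?thesis
  proof (cases "j < n")
    case True
    have "2 * harm_norm n (Suc j) * (assoc_leg n (Suc j) \<theta>)\<^sup>2 \<le> (\<Sum>j<n. 2 * harm_norm n (Suc j) *
        (assoc_leg n (Suc j) \<theta>)\<^sup>2)"
      using True by (intro member_le_sum) (auto simp: less_imp_le harm_norm_pos)
    moreover have "0 \<le> harm_norm n 0 * (assoc_leg n 0 \<theta>)\<^sup>2" "0 \<le> harm_norm n (Suc j) * (assoc_leg n
        (Suc j) \<theta>)\<^sup>2"
      by (simp_all add: less_imp_le harm_norm_pos)
    ultimately show ?thesis using addition_theorem[of n \<theta>] unfolding Suc mult.assoc by linarith
  qed (use Suc in \<open>simp add: assoc_leg_eq_0 less_imp_le harm_norm_pos\<close>)
qed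

lemma ladder_coeff_bounds: "j \<le> n \<Longrightarrow> 0 \<le> ladder_coeff n j" "ladder_coeff n j \<le> real n * (real n + 1)"
  by (simp_all add: ladder_coeff_factor) (simp add: ladder_coeff_def)

text \<open>Here the constant belongs to order k and the function to order k + 1, as in the ladder
  formula for the derivative. The mismatch costs one ladder coefficient, at most n(n+1).\<close>

lemma harm_norm_assoc_leg_Suc_le: "harm_norm n k * (assoc_leg n (Suc k) \<theta>)\<^sup>2 \<le> real n * (real n +
    1) * harm_norm n 0"
proof (cases "k < n")
  case True
  then have "harm_norm n k * (assoc_leg n (Suc k) \<theta>)\<^sup>2 = ladder_coeff n k * (harm_norm n (Suc k) *
      (assoc_leg n (Suc k) \<theta>)\<^sup>2)"
    by (simp add: harm_norm_ladder_coeff[symmetric])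
  also have "\<dots> \<le> (real n * (real n + 1)) * harm_norm n 0"
    using True ladder_coeff_bounds[of k n] ladder_coeff_bounds(2)[of n k]
    by (intro mult_mono harm_norm_assoc_leg_le) (simp_all add: less_imp_le harm_norm_pos)
  finally show ?thesis .
qed (simp add: assoc_leg_eq_0 less_imp_le harm_norm_pos)

text \<open>By the formula for the squared gradient there are three contributions from the orders k
  - 1, k + 1 and k, the last one counted twice, and each is at most n(n+1) times the zonal constant.
  The factor 6 leaves slack over 4.\<close>

lemma harm_norm_gradient_le:
  assumes "k \<le> n"
  shows "2 * harm_norm n k * ((dassoc_leg n k \<theta>)\<^sup>2 + (real k * assoc_leg_quot n k \<theta>)\<^sup>2) \<le> 6 * (real
      n * (real n + 1) * harm_norm n 0)"
proof (cases k)
  case 0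
  have "0 \<le> real n * ((real n + 1) * harm_norm n 0)" by (simp add: less_imp_le harm_norm_pos)
  moreover have "2 * harm_norm n 0 * ((dassoc_leg n 0 \<theta>)\<^sup>2 + (real 0 * assoc_leg_quot n 0 \<theta>)\<^sup>2) = 2
      * (harm_norm n 0 * (assoc_leg n (Suc 0) \<theta>)\<^sup>2)"
    by (simp add: dassoc_leg_0)
  ultimately show ?thesis
    using harm_norm_assoc_leg_Suc_le[of n 0 \<theta>] unfolding 0 mult.assoc by linarith
next
  case (Suc j)
  let ?M = "real n * (real n + 1) * harm_norm n 0"
  have "harm_norm n (Suc j) * (ladder_coeff n j * assoc_leg n j \<theta>)\<^sup>2 = ladder_coeff n j *
      ((harm_norm n (Suc j) * ladder_coeff n j) * (assoc_leg n j \<theta>)\<^sup>2)"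
    by (simp add: power2_eq_square)
  also have "\<dots> = ladder_coeff n j * (harm_norm n j * (assoc_leg n j \<theta>)\<^sup>2)"
    using assms Suc by (subst harm_norm_ladder_coeff) simp_all
  also have "\<dots> \<le> ?M"
    using assms Suc ladder_coeff_bounds[of j n] ladder_coeff_bounds(2)[of n j] by (intro mult_mono
        harm_norm_assoc_leg_le) (simp_all add: less_imp_le harm_norm_pos)
  finally have 1: "harm_norm n (Suc j) * (ladder_coeff n j * assoc_leg n j \<theta>)\<^sup>2 \<le> ?M" .
  have "harm_norm n k * (real k * assoc_leg n k \<theta>)\<^sup>2 = (real k)\<^sup>2 * (harm_norm n k * (assoc_leg n k
      \<theta>)\<^sup>2)"
    by (simp add: power_mult_distrib)
  also have "\<dots> \<le> (real n * (real n + 1)) * harm_norm n 0"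
  proof (intro mult_mono harm_norm_assoc_leg_le)
    show "(real k)\<^sup>2 \<le> real n * (real n + 1)"
      unfolding power2_eq_square using assms by (intro mult_mono) simp_all
  qed (simp_all add: less_imp_le harm_norm_pos)
  finally have 2: "harm_norm n k * (real k * assoc_leg n k \<theta>)\<^sup>2 \<le> ?M" .
  have 3: "harm_norm n k * (assoc_leg n (Suc k) \<theta>)\<^sup>2 \<le> ?M" by (rule harm_norm_assoc_leg_Suc_le)
  have 4: "0 \<le> ?M" by (simp add: less_imp_le harm_norm_pos)
  have "2 * harm_norm n k * ((dassoc_leg n k \<theta>)\<^sup>2 + (real k * assoc_leg_quot n k \<theta>)\<^sup>2)
      = harm_norm n (Suc j) * (ladder_coeff n j * assoc_leg n j \<theta>)\<^sup>2 + harm_norm n k * (assoc_leg n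
          (Suc k) \<theta>)\<^sup>2
        + 2 * (harm_norm n k * (real k * assoc_leg n k \<theta>)\<^sup>2)"
    unfolding Suc dassoc_leg_assoc_leg_quot_squares by (simp add: distrib_left)
  then show ?thesis using 1 2 3 4 by linarith
qed

section \<open>Uniform bounds for Legendre polynomials and their derivatives\<close>

lemma abs_dlegendre_le:
  assumes "\<bar>x\<bar> \<le> 1"
  shows "\<bar>dlegendre n 0 x\<bar> \<le> 1"
proof -
  have "harm_norm n 0 * (dlegendre n 0 x)\<^sup>2 \<le> harm_norm n 0 * 1"
    using harm_norm_assoc_leg_le[of n 0 "arccos x"] assms by (simp add: assoc_leg_def
        cos_arccos_abs)
  then have "(dlegendre n 0 x)\<^sup>2 \<le> 1"
    using harm_norm_pos[of n 0] by simp
  then show ?thesis by (simp add: abs_square_le_1)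
qed

text \<open>The recurrence has positive coefficients and all its terms are largest at x = 1, so the
  value at 1 is a bound on the whole interval.\<close>

lemma abs_dlegendre_deriv_le:
  assumes "\<bar>x\<bar> \<le> 1"
  shows "\<bar>dlegendre n 1 x\<bar> \<le> real n * (real n + 1) / 2"
proof (induction n rule: less_induct)
  case (less n)
  consider "n = 0" | "n = Suc 0" | m where "n = Suc (Suc m)"
    by (metis not0_implies_Suc)
  then show ?case
  proof cases
    case 3
    have "\<bar>(2 * real m + 3) * dlegendre (Suc m) 0 x\<bar> \<le> (2 * real m + 3) * 1"
      unfolding abs_mult using abs_dlegendre_le[OF assms, of "Suc m"] by (intro mult_mono) simp_all
    moreover have "\<bar>dlegendre m 1 x\<bar> \<le> real m * (real m + 1) / 2" using less[of m] 3 by simp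
    ultimately have "\<bar>dlegendre n 1 x\<bar> \<le> real m * (real m + 1) / 2 + (2 * real m + 3) * 1"
      unfolding 3 dlegendre_rec by (intro order_trans[OF abs_triangle_ineq] add_mono)
    also have "\<dots> = real n * (real n + 1) / 2"
      unfolding 3 by (simp add: field_simps)
    finally show ?thesis .
  qed (simp_all add: dlegendre_0 dlegendre_1)
qed

text \<open>\<open>sph_harm\<close> in the coordinates \<open>(\<theta>, \<phi>)\<close>, together with its \<open>\<theta>\<close>-derivative and with its
  \<open>\<phi>\<close>-derivative divided by \<open>sin \<theta>\<close>. The latter two are free of singularities at the poles.\<close>

definition azimuthal :: "int \<Rightarrow> real \<Rightarrow> real" where
  "azimuthal m \<phi> = (if 0 \<le> m then cos (\<bar>m\<bar> * \<phi>) else sin (\<bar>m\<bar> * \<phi>))"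

definition harm_factor :: "nat \<Rightarrow> int \<Rightarrow> real" where
  "harm_factor n m = sqrt (harm_norm n (nat \<bar>m\<bar>)) * (if m = 0 then 1 else sqrt 2)"

definition harm :: "nat \<Rightarrow> int \<Rightarrow> real \<Rightarrow> real \<Rightarrow> real" where
  "harm n m \<theta> \<phi> = harm_factor n m * assoc_leg n (nat \<bar>m\<bar>) \<theta> * azimuthal m \<phi>"

definition harm_theta :: "nat \<Rightarrow> int \<Rightarrow> real \<Rightarrow> real \<Rightarrow> real" where
  "harm_theta n m \<theta> \<phi> = harm_factor n m * dassoc_leg n (nat \<bar>m\<bar>) \<theta> * azimuthal m \<phi>"

definition harm_phi :: "nat \<Rightarrow> int \<Rightarrow> real \<Rightarrow> real \<Rightarrow> real" where
  "harm_phi n m \<theta> \<phi> = harm_factor n m * assoc_leg_quot n (nat \<bar>m\<bar>) \<theta> * (- real_of_int m * azimuthal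
      (- m) \<phi>)"

lemma sph_harm_harm: "sph_harm n m (sph \<theta> \<phi>) = harm n m \<theta> \<phi>"
  unfolding sph_harm_sph harm_def harm_factor_def harm_norm_def azimuthal_def assoc_leg_def
      dlegendre_def by simp

text \<open>Changing the sign of the order exchanges cosine and sine, so one formula with the signed
  factor covers all orders.\<close>

lemma azimuthal_deriv: "(azimuthal m has_real_derivative - real_of_int m * azimuthal (- m) \<phi>) (at
    \<phi>)"
proof -
  consider "m = 0" | "m > 0" | "m < 0" by linarith
  then show ?thesis
  proof cases
    case 1
    then show ?thesis by (simp add: azimuthal_def[abs_def])
  next
    case 2
    then have t: "azimuthal m = (\<lambda>p. cos (m * p))" by (simp add: azimuthal_def[abs_def])
    show ?thesis using 2 unfolding t azimuthal_def by (auto intro!: derivative_eq_intros)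
  next
    case 3
    then have t: "azimuthal m = (\<lambda>p. sin (- m * p))" by (simp add: azimuthal_def[abs_def])
    show ?thesis using 3 unfolding t azimuthal_def by (auto intro!: derivative_eq_intros)
  qed
qed

lemma abs_azimuthal_le: "\<bar>azimuthal m \<phi>\<bar> \<le> 1"
  by (simp add: azimuthal_def)

lemma harm_deriv_theta: "((\<lambda>t. harm n m t \<phi>) has_real_derivative harm_theta n m \<theta> \<phi>) (at \<theta>)"
  unfolding harm_def harm_theta_def by (auto intro!: derivative_eq_intros assoc_leg_deriv)

lemma harm_deriv_phi: "((\<lambda>p. harm n m \<theta> p) has_real_derivative sin \<theta> * harm_phi n m \<theta> \<phi>) (at \<phi>)"
proof -
  have "((\<lambda>p. harm n m \<theta> p) has_real_derivative
      harm_factor n m * assoc_leg n (nat \<bar>m\<bar>) \<theta> * (- real_of_int m * azimuthal (- m) \<phi>)) (at \<phi>)"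
    unfolding harm_def by (rule DERIV_cmult[OF azimuthal_deriv])
  also have "harm_factor n m * assoc_leg n (nat \<bar>m\<bar>) \<theta> * (- real_of_int m * azimuthal (- m) \<phi>) =
      sin \<theta> * harm_phi n m \<theta> \<phi>"
    by (cases "m = 0") (simp_all add: harm_phi_def assoc_leg_sin_assoc_leg_quot)
  finally show ?thesis .
qed

lemma harm_factor_sq_le: "(harm_factor n m)\<^sup>2 \<le> 2 * harm_norm n (nat \<bar>m\<bar>)"
  using harm_norm_pos[of n "nat \<bar>m\<bar>"] by (simp add: harm_factor_def power_mult_distrib)

lemma harm_norm_0_le: "1 \<le> n \<Longrightarrow> 4 * harm_norm n 0 \<le> real n"
proof -
  assume n: "1 \<le> n"
  have "2 * real n + 1 \<le> pi * real n"
    using pi_gt3 n mult_right_mono[of 3 pi "real n"] by linarith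
  then show ?thesis by (simp add: harm_norm_0 field_simps)
qed

lemma power32: "(real n powr (3 / 2))\<^sup>2 = real n ^ 3"
  by (cases "n = 0") (simp_all add: powr_power)

lemma mult_azimuthal_sq_le: "(a * azimuthal m \<phi>)\<^sup>2 \<le> a\<^sup>2"
proof -
  have "(azimuthal m \<phi>)\<^sup>2 \<le> 1" using abs_azimuthal_le[of m \<phi>] by (simp add: abs_square_le_1)
  then show ?thesis
    using mult_left_mono[of "(azimuthal m \<phi>)\<^sup>2" 1 "a\<^sup>2"] by (simp add: power_mult_distrib)
qed

text \<open>The addition theorem gives the order n^(1/2); the bound is relaxed to n^(3/2) so that
  harmonics and their derivatives share one estimate.\<close>

lemma abs_harm_le:
  assumes "1 \<le> n"
  shows "\<bar>harm n m \<theta> \<phi>\<bar> \<le> real n powr (3 / 2)"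
proof (rule power2_le_imp_le)
  let ?k = "nat \<bar>m\<bar>"
  have "(harm n m \<theta> \<phi>)\<^sup>2 \<le> (harm_factor n m * assoc_leg n ?k \<theta>)\<^sup>2"
    unfolding harm_def by (rule mult_azimuthal_sq_le)
  also have "\<dots> \<le> 2 * harm_norm n ?k * (assoc_leg n ?k \<theta>)\<^sup>2"
    unfolding power_mult_distrib by (intro mult_right_mono harm_factor_sq_le) simp
  also have "\<dots> \<le> 2 * harm_norm n 0" using harm_norm_assoc_leg_le[of n ?k \<theta>] by simp
  also have "\<dots> \<le> real n ^ 1" using harm_norm_0_le[OF assms] harm_norm_pos[of n 0] by simp
  also have "\<dots> \<le> real n ^ 3" using assms by (intro power_increasing) simp_all
  finally show "\<bar>harm n m \<theta> \<phi>\<bar>\<^sup>2 \<le> (real n powr (3 / 2))\<^sup>2"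
    by (simp only: power32 power2_abs)
qed simp

lemma gradient_bound_aux:
  assumes "\<bar>m\<bar> \<le> int n"
  shows "(harm_factor n m * dassoc_leg n (nat \<bar>m\<bar>) \<theta>)\<^sup>2 \<le> (2 * real n powr (3 / 2))\<^sup>2"
    and "(harm_factor n m * (real (nat \<bar>m\<bar>) * assoc_leg_quot n (nat \<bar>m\<bar>) \<theta>))\<^sup>2 \<le> (2 * real n powr
        (3 / 2))\<^sup>2"
proof -
  let ?k = "nat \<bar>m\<bar>"
  let ?S = "(dassoc_leg n ?k \<theta>)\<^sup>2 + (real ?k * assoc_leg_quot n ?k \<theta>)\<^sup>2"
  have k: "?k \<le> n" using assms by simp
  \<comment> \<open>The argument gives 3 n^3; the constant 4 is taken to make the right-hand side
    the square of 2 n^(3/2).\<close>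
  have M: "6 * (real n * (real n + 1) * harm_norm n 0) \<le> 4 * real n ^ 3"
  proof (cases "n = 0")
    case False
    then have "(real n * (real n + 1)) * (4 * harm_norm n 0) \<le> (real n * (2 * real n)) * real n"
      using harm_norm_0_le[of n] harm_norm_pos[of n 0]
      by (intro mult_mono) (simp_all add: less_imp_le)
    then have "4 * (real n * (real n + 1) * harm_norm n 0) \<le> 2 * real n ^ 3"
      by (simp add: power3_eq_cube mult_ac)
    moreover have "0 \<le> real n ^ 3" by simp
    ultimately show ?thesis by linarith
  qed simp
  have "(harm_factor n m)\<^sup>2 * ?S \<le> 2 * harm_norm n ?k * ?S"
    by (intro mult_right_mono harm_factor_sq_le) simp
  also have "\<dots> \<le> 4 * real n ^ 3" using harm_norm_gradient_le[OF k, of \<theta>] M by linarith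
  also have "\<dots> = (2 * real n powr (3 / 2))\<^sup>2" by (simp add: power_mult_distrib power32)
  finally have "(harm_factor n m)\<^sup>2 * ?S \<le> (2 * real n powr (3 / 2))\<^sup>2" .
  moreover have "0 \<le> (harm_factor n m)\<^sup>2 * (dassoc_leg n ?k \<theta>)\<^sup>2" "0 \<le> (harm_factor n m)\<^sup>2 * (real
      ?k * assoc_leg_quot n ?k \<theta>)\<^sup>2"
    by simp_all
  ultimately show "(harm_factor n m * dassoc_leg n ?k \<theta>)\<^sup>2 \<le> (2 * real n powr (3 / 2))\<^sup>2"
    "(harm_factor n m * (real ?k * assoc_leg_quot n ?k \<theta>))\<^sup>2 \<le> (2 * real n powr (3 / 2))\<^sup>2"
    unfolding power_mult_distrib[of "harm_factor n m"] distrib_left by linarith+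
qed

lemma abs_harm_theta_le:
  assumes "\<bar>m\<bar> \<le> int n"
  shows "\<bar>harm_theta n m \<theta> \<phi>\<bar> \<le> 2 * real n powr (3 / 2)"
proof (rule power2_le_imp_le)
  show "\<bar>harm_theta n m \<theta> \<phi>\<bar>\<^sup>2 \<le> (2 * real n powr (3 / 2))\<^sup>2"
    unfolding harm_theta_def power2_abs
    by (rule order_trans[OF mult_azimuthal_sq_le gradient_bound_aux(1)[OF assms]])
qed simp

lemma abs_harm_phi_le:
  assumes "\<bar>m\<bar> \<le> int n"
  shows "\<bar>harm_phi n m \<theta> \<phi>\<bar> \<le> 2 * real n powr (3 / 2)"
proof (rule power2_le_imp_le)
  have "\<bar>harm_phi n m \<theta> \<phi>\<bar>\<^sup>2 = ((harm_factor n m * (real (nat \<bar>m\<bar>) * assoc_leg_quot n (nat \<bar>m\<bar>) \<theta>))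
      * azimuthal (- m) \<phi>)\<^sup>2"
    by (simp add: harm_phi_def power_mult_distrib)
  also have "\<dots> \<le> (2 * real n powr (3 / 2))\<^sup>2"
    by (rule order_trans[OF mult_azimuthal_sq_le gradient_bound_aux(2)[OF assms]])
  finally show "\<bar>harm_phi n m \<theta> \<phi>\<bar>\<^sup>2 \<le> (2 * real n powr (3 / 2))\<^sup>2" .
qed simp

text \<open>The colatitude derivative of the zonal harmonic divided by \<open>sin \<theta>\<close>:
  a polynomial in \<open>cos \<theta>\<close>, hence regular at the poles.\<close>

definition harm_zonal :: "nat \<Rightarrow> real \<Rightarrow> real" where
  "harm_zonal n \<theta> = - (harm_factor n 0 * dlegendre n 1 (cos \<theta>))"

lemma harm_theta_zonal: "harm_theta n 0 \<theta> \<phi> = sin \<theta> * harm_zonal n \<theta>"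
  by (simp add: harm_theta_def harm_zonal_def dassoc_leg_0 assoc_leg_def azimuthal_def)

text \<open>The normalising constant contributes n^(1/2) and the derivative of P_n contributes n^2.
  This is one power of n more than for the undivided derivative.\<close>

lemma abs_harm_zonal_le: "\<bar>harm_zonal n \<theta>\<bar> \<le> 2 * real n powr (5 / 2)"
proof (cases "n = 0")
  case True
  then show ?thesis by (simp add: harm_zonal_def dlegendre_0)
next
  case False
  have "harm_factor n 0 = sqrt (harm_norm n 0)" by (simp add: harm_factor_def)
  also have "\<dots> \<le> sqrt (real n)"
    using harm_norm_0_le[of n] harm_norm_pos[of n 0] False by simp
  finally have N: "\<bar>harm_factor n 0\<bar> \<le> real n powr (1 / 2)"
    using harm_norm_pos[of n 0] by (simp add: harm_factor_def powr_half_sqrt)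
  have "\<bar>dlegendre n 1 (cos \<theta>)\<bar> \<le> real n * (real n + 1) / 2" by (rule abs_dlegendre_deriv_le) simp
  also have "\<dots> \<le> real n * (2 * real n) / 2"
    using False by (intro divide_right_mono mult_left_mono) simp_all
  also have "\<dots> = real n powr 2" using False by (simp add: power2_eq_square)
  finally have L: "\<bar>dlegendre n 1 (cos \<theta>)\<bar> \<le> real n powr 2" .
  have "\<bar>harm_zonal n \<theta>\<bar> \<le> real n powr (1 / 2) * real n powr 2"
    unfolding harm_zonal_def abs_minus_cancel abs_mult by (intro mult_mono N L) simp_all
  also have "\<dots> = real n powr (5 / 2)" by (simp only: powr_add[symmetric]) simp
  also have "\<dots> \<le> 2 * real n powr (5 / 2)" by simp
  finally show ?thesis .
qed

section \<open>Orthogonality\<close>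

lemma continuous_on_assoc_leg [continuous_intros]:
  fixes f :: "'a :: t2_space \<Rightarrow> real"
  assumes "continuous_on S f"
  shows "continuous_on S (\<lambda>x. assoc_leg n k (f x))" "continuous_on S (\<lambda>x. assoc_leg_quot n k (f x))"
    "continuous_on S (\<lambda>x. dassoc_leg n k (f x))"
  unfolding dassoc_leg_def assoc_leg_def assoc_leg_quot_def by (intro continuous_intros assms)+

lemma continuous_on_azimuthal [continuous_intros]:
  fixes f :: "'a :: t2_space \<Rightarrow> real"
  assumes "continuous_on S f"
  shows "continuous_on S (\<lambda>x. azimuthal m (f x))"
  unfolding azimuthal_def by (cases "0 \<le> m") (auto intro!: continuous_intros assms)

lemma continuous_on_harm [continuous_intros]:
  fixes f g :: "'a :: t2_space \<Rightarrow> real"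
  assumes "continuous_on S f" "continuous_on S g"
  shows "continuous_on S (\<lambda>x. harm n m (f x) (g x))" "continuous_on S (\<lambda>x. harm_theta n m (f x) (g
      x))"
    "continuous_on S (\<lambda>x. harm_phi n m (f x) (g x))"
  unfolding harm_def harm_theta_def harm_phi_def by (intro continuous_intros assms)+

lemma has_integral_cos_substitution:
  assumes "\<And>x. (H has_real_derivative H' x) (at x)"
  shows "((\<lambda>\<theta>. H' (cos \<theta>) * sin \<theta>) has_integral H 1 - H (- 1)) {0..pi}"
proof -
  have d: "((\<lambda>t. - H (cos t)) has_real_derivative H' (cos t) * sin t) (at t within {0..pi})" for t
    using DERIV_minus[OF DERIV_chain2[OF assms DERIV_cos[of t]]]
    by (simp add: has_field_derivative_at_within)
  have "((\<lambda>\<theta>. H' (cos \<theta>) * sin \<theta>) has_integral (- H (cos pi)) - (- H (cos 0))) {0..pi}"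
    by (rule fundamental_theorem_of_calculus)
       (use d in \<open>simp_all add: has_real_derivative_iff_has_vector_derivative\<close>)
  then show ?thesis by simp
qed

definition radial_int :: "nat \<Rightarrow> nat \<Rightarrow> nat \<Rightarrow> real" where
  "radial_int k n l = integral {0..pi} (\<lambda>\<theta>. assoc_leg n k \<theta> * assoc_leg l k \<theta> * sin \<theta>)"

lemma assoc_leg_has_integral: "((\<lambda>\<theta>. assoc_leg n k \<theta> * assoc_leg l k \<theta> * sin \<theta>) has_integral
    radial_int k n l) {0..pi}"
  unfolding radial_int_def by (intro integrable_integral integrable_continuous_real
      continuous_intros)

lemma radial_int_commute: "radial_int k n l = radial_int k l n"
  by (simp add: radial_int_def mult.commute)

text \<open>Integration by parts in x = \<open>cos \<theta>\<close>: the weight (1 - x^2)^(k+1)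
  kills the boundary terms, and the differential equation collapses the derivative of the weighted
  factor to a multiple of order k.\<close>

lemma radial_int_Suc: "radial_int (Suc k) n l = ladder_coeff n k * radial_int k n l"
proof -
  define H where "H = (\<lambda>x. (1 - x\<^sup>2) ^ Suc k * dlegendre n (Suc k) x * dlegendre l k x)"
  define H' where "H' = (\<lambda>x. (1 - x\<^sup>2) ^ Suc k * dlegendre n (Suc k) x * dlegendre l (Suc k) x
    - ladder_coeff n k * ((1 - x\<^sup>2) ^ k * dlegendre n k x * dlegendre l k x))"
  have "(H has_real_derivative H' x) (at x)" for x
  proof -
    have "(H has_real_derivative
      (real (Suc k) * (1 - x\<^sup>2) ^ k * (- 2 * x) * dlegendre n (Suc k) x + (1 - x\<^sup>2) ^ Suc k *
          dlegendre n (Suc (Suc k)) x) * dlegendre l k x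
      + (1 - x\<^sup>2) ^ Suc k * dlegendre n (Suc k) x * dlegendre l (Suc k) x) (at x)"
      unfolding H_def by (rule derivative_eq_intros dlegendre_deriv refl)+ (simp add: algebra_simps)
    also have "(real (Suc k) * (1 - x\<^sup>2) ^ k * (- 2 * x) * dlegendre n (Suc k) x + (1 - x\<^sup>2) ^ Suc
        k * dlegendre n (Suc (Suc k)) x)
      = (1 - x\<^sup>2) ^ k * ((1 - x\<^sup>2) * dlegendre n (Suc (Suc k)) x - 2 * (real k + 1) * x * dlegendre
          n (Suc k) x)"
      by (simp add: algebra_simps)
    also have "(1 - x\<^sup>2) * dlegendre n (Suc (Suc k)) x - 2 * (real k + 1) * x * dlegendre n (Suc k)
        x = - ladder_coeff n k * dlegendre n k x"
      using dlegendre_ode[of x n k] unfolding ladder_coeff_def by linarith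
    finally show ?thesis by (simp add: H'_def algebra_simps)
  qed
  from has_integral_cos_substitution[OF this]
  have "((\<lambda>\<theta>. H' (cos \<theta>) * sin \<theta>) has_integral 0) {0..pi}"
    by (simp add: H_def)
  moreover have "H' (cos \<theta>) * sin \<theta>
      = assoc_leg n (Suc k) \<theta> * assoc_leg l (Suc k) \<theta> * sin \<theta> - ladder_coeff n k * (assoc_leg n k \<theta>
          * assoc_leg l k \<theta> * sin \<theta>)" for \<theta>
  proof -
    have "1 - (cos \<theta>)\<^sup>2 = sin \<theta> * sin \<theta>" using sin_squared_eq[of \<theta>] by (simp add: power2_eq_square)
    then show ?thesis unfolding H'_def assoc_leg_def by (simp only:) (simp add: power_mult_distrib
        algebra_simps)
  qed
  moreover have "((\<lambda>\<theta>. assoc_leg n (Suc k) \<theta> * assoc_leg l (Suc k) \<theta> * sin \<theta> - ladder_coeff n k *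
      (assoc_leg n k \<theta> * assoc_leg l k \<theta> * sin \<theta>))
      has_integral radial_int (Suc k) n l - ladder_coeff n k * radial_int k n l) {0..pi}"
    by (intro has_integral_diff has_integral_mult_right assoc_leg_has_integral)
  ultimately show ?thesis
    using has_integral_unique by (metis (no_types, lifting) ext eq_iff_diff_eq_0)
qed

text \<open>The integral of order 1 is symmetric in the two degrees, while
  \<open>radial_int_Suc\<close> expresses it with the eigenvalue of either one. Distinct eigenvalues
  force the integral of order 0 to vanish.\<close>

lemma radial_int_0_orthogonal: "n \<noteq> l \<Longrightarrow> radial_int 0 n l = 0"
proof -
  assume "n \<noteq> l"
  have "ladder_coeff n 0 * radial_int 0 n l = ladder_coeff l 0 * radial_int 0 n l"
    using radial_int_Suc[of 0 n l] radial_int_Suc[of 0 l n] radial_int_commute[of 0 l n]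
        radial_int_commute[of "Suc 0" l n] by simp
  moreover have "ladder_coeff n 0 \<noteq> ladder_coeff l 0"
  proof
    assume "ladder_coeff n 0 = ladder_coeff l 0"
    then have "(real n - real l) * (real n + real l + 1) = 0"
      by (simp add: ladder_coeff_def algebra_simps)
    then show False using \<open>n \<noteq> l\<close> by simp
  qed
  ultimately show ?thesis by simp
qed

text \<open>The recurrence expands the derivative of P_j into Legendre polynomials of degree below
  j, all orthogonal to P_n.\<close>

lemma radial_int_0_deriv_orthogonal:
  "j \<le> n \<Longrightarrow> ((\<lambda>\<theta>. dlegendre n 0 (cos \<theta>) * dlegendre j 1 (cos \<theta>) * sin \<theta>) has_integral 0) {0..pi}"
proof (induction j rule: less_induct)
  case (less j)
  have R0: "((\<lambda>\<theta>. dlegendre n 0 (cos \<theta>) * dlegendre l 0 (cos \<theta>) * sin \<theta>) has_integral 0) {0..pi}"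
      if "l < n" for l
    using assoc_leg_has_integral[of n 0 l] radial_int_0_orthogonal[of n l] that by (simp add:
        assoc_leg_def)
  consider "j = 0" | "j = Suc 0" | i where "j = Suc (Suc i)"
    by (metis not0_implies_Suc)
  then show ?case
  proof cases
    case 2
    then show ?thesis using R0[of 0] less by (simp add: dlegendre_0 dlegendre_1)
  next
    case 3
    have "((\<lambda>\<theta>. dlegendre n 0 (cos \<theta>) * dlegendre i 1 (cos \<theta>) * sin \<theta>
        + (2 * real i + 3) * (dlegendre n 0 (cos \<theta>) * dlegendre (Suc i) 0 (cos \<theta>) * sin \<theta>))
            has_integral
        0 + (2 * real i + 3) * 0) {0..pi}"
      using less 3 by (intro has_integral_add has_integral_mult_right R0 less.IH) simp_all
    then show ?thesis
      unfolding 3 dlegendre_rec by (simp add: algebra_simps)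
  qed (simp add: dlegendre_0)
qed

text \<open>Integrate the derivative of P_n P_(n+1), whose boundary values contribute 2. One product
  integrates to zero, and the recurrence turns the other into (2n+1) P_n^2 plus a product that also
  integrates to zero.\<close>

lemma radial_int_0_norm: "radial_int 0 n n = 2 / (2 * real n + 1)"
proof (cases n)
  case 0
  have "((\<lambda>\<theta>. 1 * sin \<theta>) has_integral 1 - (-1)) {0..pi}"
    by (rule has_integral_cos_substitution) (auto intro!: derivative_eq_intros)
  moreover have "((\<lambda>\<theta>. 1 * sin \<theta>) has_integral radial_int 0 0 0) {0..pi}"
    using assoc_leg_has_integral[of 0 0 0] by (simp add: assoc_leg_def dlegendre_0)
  ultimately have "radial_int 0 0 0 = 1 - (-1)" using has_integral_unique by blast
  then show ?thesis using 0 by simp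
next
  case (Suc m)
  let ?P = "\<lambda>l k \<theta>. dlegendre l k (cos \<theta>)"
  have "((\<lambda>\<theta>. (dlegendre n 1 (cos \<theta>) * dlegendre (Suc n) 0 (cos \<theta>) + dlegendre (Suc n) 1 (cos \<theta>) *
      dlegendre n 0 (cos \<theta>)) * sin \<theta>)
      has_integral dlegendre n 0 1 * dlegendre (Suc n) 0 1 - dlegendre n 0 (-1) * dlegendre (Suc n)
          0 (-1)) {0..pi}"
    by (rule has_integral_cos_substitution) (auto intro!: derivative_eq_intros dlegendre_deriv[THEN
        DERIV_cong])
  then have 1: "((\<lambda>\<theta>. (?P n 1 \<theta> * ?P (Suc n) 0 \<theta> + ?P (Suc n) 1 \<theta> * ?P n 0 \<theta>) * sin \<theta>) has_integral
      2) {0..pi}"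
    by (cases "even n") (simp_all add: dlegendre_at_1 dlegendre_at_m1)
  have 2: "((\<lambda>\<theta>. ?P (Suc n) 0 \<theta> * ?P n 1 \<theta> * sin \<theta>) has_integral 0) {0..pi}"
    by (rule radial_int_0_deriv_orthogonal) simp
  have 3: "((\<lambda>\<theta>. ?P n 0 \<theta> * ?P m 1 \<theta> * sin \<theta>) has_integral 0) {0..pi}"
    by (rule radial_int_0_deriv_orthogonal) (simp add: Suc)
  have 4: "((\<lambda>\<theta>. (2 * real m + 3) * (?P n 0 \<theta> * ?P n 0 \<theta> * sin \<theta>)) has_integral (2 * real m + 3) *
      radial_int 0 n n) {0..pi}"
    using has_integral_mult_right[OF assoc_leg_has_integral[of n 0 n]] by (simp add: assoc_leg_def)
  have "((\<lambda>\<theta>. (?P n 1 \<theta> * ?P (Suc n) 0 \<theta> + ?P (Suc n) 1 \<theta> * ?P n 0 \<theta>) * sin \<theta>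
      - ?P (Suc n) 0 \<theta> * ?P n 1 \<theta> * sin \<theta> - ?P n 0 \<theta> * ?P m 1 \<theta> * sin \<theta>) has_integral 2 - 0 - 0)
          {0..pi}"
    by (intro has_integral_diff 1 2 3)
  moreover have "(?P n 1 \<theta> * ?P (Suc n) 0 \<theta> + ?P (Suc n) 1 \<theta> * ?P n 0 \<theta>) * sin \<theta>
      - ?P (Suc n) 0 \<theta> * ?P n 1 \<theta> * sin \<theta> - ?P n 0 \<theta> * ?P m 1 \<theta> * sin \<theta>
      = (2 * real m + 3) * (?P n 0 \<theta> * ?P n 0 \<theta> * sin \<theta>)" for \<theta>
    unfolding Suc dlegendre_rec by (simp add: algebra_simps)
  ultimately have "((\<lambda>\<theta>. (2 * real m + 3) * (?P n 0 \<theta> * ?P n 0 \<theta> * sin \<theta>)) has_integral 2 - 0 - 0)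
      {0..pi}"
    by (simp only:)
  from has_integral_unique[OF 4 this] have "(2 * real m + 3) * radial_int 0 n n = 2"
    by simp
  then show ?thesis by (simp add: Suc field_simps)
qed

lemma radial_int_orthogonal: "n \<noteq> l \<Longrightarrow> radial_int k n l = 0"
  by (induction k) (simp_all add: radial_int_0_orthogonal radial_int_Suc)

text \<open>Raising the order multiplies the integral by a ladder coefficient and divides the
  squared constant by it, so the product is that of order 0.\<close>

lemma harm_norm_radial_int: "k \<le> n \<Longrightarrow> harm_norm n k * radial_int k n n = 1 / (2 * pi)"
proof (induction k)
  case 0
  have "a / (4 * pi) * (2 / a) = 1 / (2 * pi)" if "a > 0" for a
    using that by (simp add: field_simps)
  then show ?case by (simp only: harm_norm_0 radial_int_0_norm)
next
  case (Suc k)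
  then show ?case by (simp add: radial_int_Suc mult.assoc[symmetric] harm_norm_ladder_coeff)
qed

text \<open>The colatitude part of the eigenvalue equation for the Laplacian, multiplied by
  \<open>sin \<theta>\<close>. The singular term k^2 / \<open>sin \<theta>\<close> is expressed by
  \<open>assoc_leg_quot\<close>, so the equation holds at the poles too.\<close>

lemma sin_dassoc_leg_deriv:
  "((\<lambda>t. sin t * dassoc_leg n k t) has_real_derivative
     (real k)\<^sup>2 * assoc_leg_quot n k \<theta> - real n * (real n + 1) * sin \<theta> * assoc_leg n k \<theta>) (at \<theta>)"
proof -
  have eq: "(\<lambda>t. sin t * dassoc_leg n k t) = (\<lambda>t. real k * cos t * assoc_leg n k t - sin t *
      assoc_leg n (Suc k) t)"
    by (cases k) (auto simp: fun_eq_iff dassoc_leg_def assoc_leg_sin_assoc_leg_quot algebra_simps)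
  have kA: "real k * assoc_leg n k \<theta> = real k * sin \<theta> * assoc_leg_quot n k \<theta>"
    by (cases k) (simp_all add: assoc_leg_sin_assoc_leg_quot)
  have "((\<lambda>t. real k * cos t * assoc_leg n k t - sin t * assoc_leg n (Suc k) t) has_real_derivative
      (- (real k * sin \<theta> * assoc_leg n k \<theta>) + real k * cos \<theta> * dassoc_leg n k \<theta>
       - (cos \<theta> * assoc_leg n (Suc k) \<theta> + sin \<theta> * dassoc_leg n (Suc k) \<theta>))) (at \<theta>)"
    by (rule derivative_eq_intros assoc_leg_deriv refl)+ (simp add: algebra_simps)
  also have "sin \<theta> * dassoc_leg n (Suc k) \<theta> = ladder_coeff n k * sin \<theta> * assoc_leg n k \<theta> - (real k
      + 1) * cos \<theta> * assoc_leg n (Suc k) \<theta>"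
  proof -
    have "dassoc_leg n (Suc k) \<theta> = ladder_coeff n k * assoc_leg n k \<theta> - (real k + 1) * cos \<theta> *
        assoc_leg_quot n (Suc k) \<theta>"
      using cos_assoc_leg_quot_ladder[of k \<theta> n] by (simp add: dassoc_leg_def algebra_simps)
    then show ?thesis by (simp only: assoc_leg_sin_assoc_leg_quot[of "Suc k"] zero_less_Suc) (simp
        add: algebra_simps)
  qed
  also have "- (real k * sin \<theta> * assoc_leg n k \<theta>) + real k * cos \<theta> * dassoc_leg n k \<theta>
       - (cos \<theta> * assoc_leg n (Suc k) \<theta> + (ladder_coeff n k * sin \<theta> * assoc_leg n k \<theta> - (real k +
           1) * cos \<theta> * assoc_leg n (Suc k) \<theta>))
     = (real k)\<^sup>2 * assoc_leg_quot n k \<theta> * (cos \<theta>)\<^sup>2 - (real k + ladder_coeff n k) * sin \<theta> *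
         assoc_leg n k \<theta>"
    by (simp add: dassoc_leg_def power2_eq_square algebra_simps)
  also have "(cos \<theta>)\<^sup>2 = 1 - sin \<theta> * sin \<theta>" using sin_cos_squared_add[of \<theta>] by (simp only:
      power2_eq_square)
  also have "(real k)\<^sup>2 * assoc_leg_quot n k \<theta> * (1 - sin \<theta> * sin \<theta>)
     = (real k)\<^sup>2 * assoc_leg_quot n k \<theta> - real k * sin \<theta> * (real k * sin \<theta> * assoc_leg_quot n k \<theta>)"
    by (simp add: power2_eq_square algebra_simps)
  also have "\<dots> = (real k)\<^sup>2 * assoc_leg_quot n k \<theta> - real k * sin \<theta> * (real k * assoc_leg n k \<theta>)"
    by (simp only: kA)
  also have "\<dots> - (real k + ladder_coeff n k) * sin \<theta> * assoc_leg n k \<theta>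
      = (real k)\<^sup>2 * assoc_leg_quot n k \<theta> - real n * (real n + 1) * sin \<theta> * assoc_leg n k \<theta>"
    by (simp add: ladder_coeff_def algebra_simps)
  finally show ?thesis unfolding eq .
qed

text \<open>Integrate the eigenvalue equation against \<open>assoc_leg l k\<close>; the boundary
  terms contain \<open>sin \<theta>\<close>. Only the sum of the two gradient components has such a
  formula, not each one separately.\<close>

lemma radial_gradient_integral:
  "((\<lambda>\<theta>. (dassoc_leg n k \<theta> * dassoc_leg l k \<theta> + (real k)\<^sup>2 * (assoc_leg_quot n k \<theta> * assoc_leg_quot
      l k \<theta>)) * sin \<theta>)
     has_integral real n * (real n + 1) * radial_int k n l) {0..pi}"
proof -
  have kA: "(real k)\<^sup>2 * assoc_leg l k \<theta> = (real k)\<^sup>2 * (sin \<theta> * assoc_leg_quot l k \<theta>)" for \<theta>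
    by (cases k) (simp_all add: assoc_leg_sin_assoc_leg_quot)
  have "((\<lambda>t. sin t * dassoc_leg n k t * assoc_leg l k t) has_real_derivative
      ((real k)\<^sup>2 * assoc_leg_quot n k \<theta> - real n * (real n + 1) * sin \<theta> * assoc_leg n k \<theta>) *
          assoc_leg l k \<theta>
      + sin \<theta> * dassoc_leg n k \<theta> * dassoc_leg l k \<theta>) (at \<theta>)" for \<theta>
    by (rule derivative_eq_intros sin_dassoc_leg_deriv assoc_leg_deriv refl)+ (simp add:
        algebra_simps)
  also have "((real k)\<^sup>2 * assoc_leg_quot n k \<theta> - real n * (real n + 1) * sin \<theta> * assoc_leg n k \<theta>)
      * assoc_leg l k \<theta>
      + sin \<theta> * dassoc_leg n k \<theta> * dassoc_leg l k \<theta>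
     = assoc_leg_quot n k \<theta> * ((real k)\<^sup>2 * assoc_leg l k \<theta>) + sin \<theta> * dassoc_leg n k \<theta> *
         dassoc_leg l k \<theta>
        - real n * (real n + 1) * (assoc_leg n k \<theta> * assoc_leg l k \<theta> * sin \<theta>)" for \<theta>
    by (simp add: algebra_simps)
  also have "assoc_leg_quot n k \<theta> * ((real k)\<^sup>2 * assoc_leg l k \<theta>) + sin \<theta> * dassoc_leg n k \<theta> *
      dassoc_leg l k \<theta>
     = (dassoc_leg n k \<theta> * dassoc_leg l k \<theta> + (real k)\<^sup>2 * (assoc_leg_quot n k \<theta> * assoc_leg_quot l
         k \<theta>)) * sin \<theta>" for \<theta>
    unfolding kA by (simp add: algebra_simps)
  finally have d: "((\<lambda>t. sin t * dassoc_leg n k t * assoc_leg l k t) has_real_derivative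
      (dassoc_leg n k \<theta> * dassoc_leg l k \<theta> + (real k)\<^sup>2 * (assoc_leg_quot n k \<theta> * assoc_leg_quot l
          k \<theta>)) * sin \<theta>
        - real n * (real n + 1) * (assoc_leg n k \<theta> * assoc_leg l k \<theta> * sin \<theta>)) (at \<theta>)" for \<theta> .
  have "((\<lambda>\<theta>. (dassoc_leg n k \<theta> * dassoc_leg l k \<theta> + (real k)\<^sup>2 * (assoc_leg_quot n k \<theta> *
      assoc_leg_quot l k \<theta>)) * sin \<theta>
        - real n * (real n + 1) * (assoc_leg n k \<theta> * assoc_leg l k \<theta> * sin \<theta>)) has_integral
      sin pi * dassoc_leg n k pi * assoc_leg l k pi - sin 0 * dassoc_leg n k 0 * assoc_leg l k 0)
          {0..pi}"
    by (rule fundamental_theorem_of_calculus)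
       (use d in \<open>auto simp: has_real_derivative_iff_has_vector_derivative[symmetric] intro:
           has_field_derivative_at_within\<close>)
  from has_integral_add[OF this has_integral_mult_right[OF assoc_leg_has_integral[of n k l], of
      "real n * (real n + 1)"]]
  show ?thesis by simp
qed

section \<open>Fourier orthogonality in the longitude\<close>

lemma azimuthal_periodic: "azimuthal m (\<phi> + 2 * pi * of_int j) = azimuthal m \<phi>"
proof -
  have "\<bar>real_of_int m\<bar> * (\<phi> + 2 * pi * of_int j) = \<bar>real_of_int m\<bar> * \<phi> + of_int (\<bar>m\<bar> * j) * (2 *
      pi)"
    by (simp add: algebra_simps)
  moreover have "sin (x + of_int i * (2 * pi)) = sin x" "cos (x + of_int i * (2 * pi)) = cos x" for
      x i
    using sin.plus_of_int[of x i] cos.plus_of_int[of x i] by simp_all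
  ultimately show ?thesis
    unfolding azimuthal_def of_int_abs by (simp only:)
qed

text \<open>Each case integrates the derivative of a periodic function: a Wronskian for different
  frequencies, the square of one mode for opposite orders, and the product of the modes m and -m for
  equal orders. The last gives a difference of squares, combined with cos^2 + sin^2 = 1.\<close>

lemma azimuthal_has_integral:
  "((\<lambda>\<phi>. azimuthal m \<phi> * azimuthal j \<phi>) has_integral (if m \<noteq> j then 0 else if m = 0 then 2 * pi
      else pi)) {0..2 * pi}"
proof -
  have per: "azimuthal i (2 * pi) = azimuthal i 0" for i using azimuthal_periodic[of i 0 1] by simp
  have ftc: "(g has_integral G (2 * pi) - G 0) {0..2 * pi}"
    if "\<And>x. (G has_real_derivative g x) (at x)" for G g :: "real \<Rightarrow> real"
    by (rule fundamental_theorem_of_calculus)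
       (use that in \<open>auto simp: has_real_derivative_iff_has_vector_derivative[symmetric] intro:
           has_field_derivative_at_within\<close>)
  have scale: "(g has_integral 0) {0..2 * pi}"
    if "((\<lambda>x. c * g x) has_integral 0) {0..2 * pi}" "c \<noteq> 0" for c and g :: "real \<Rightarrow> real"
    using has_integral_mult_right[OF that(1), of "inverse c"] that(2) by (simp add:
        mult.assoc[symmetric])
  consider "m = 0" "j = 0" | "\<bar>m\<bar> \<noteq> \<bar>j\<bar>" | "j = - m" "m \<noteq> 0" | "j = m" "m \<noteq> 0" by linarith
  then show ?thesis
  proof cases
    case 1
    then show ?thesis using has_integral_const_real[of "1::real" 0 "2 * pi"] by (simp add:
        azimuthal_def)
  next
    case 2
    then have ne: "m \<noteq> j" "(real_of_int m)\<^sup>2 \<noteq> (real_of_int j)\<^sup>2"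
      by (auto simp: power2_eq_iff abs_if split: if_splits)
    have "((\<lambda>\<phi>. ((real_of_int j)\<^sup>2 - (real_of_int m)\<^sup>2) * (azimuthal m \<phi> * azimuthal j \<phi>))
        has_integral
       (real_of_int j * azimuthal m (2*pi) * azimuthal (- j) (2*pi) - real_of_int m * azimuthal (-
           m) (2*pi) * azimuthal j (2*pi))
        - (real_of_int j * azimuthal m 0 * azimuthal (- j) 0 - real_of_int m * azimuthal (- m) 0 *
            azimuthal j 0)) {0..2*pi}"
      by (rule ftc) ((rule derivative_eq_intros azimuthal_deriv refl)+, simp add: power2_eq_square
          algebra_simps)
    then have "((\<lambda>\<phi>. ((real_of_int j)\<^sup>2 - (real_of_int m)\<^sup>2) * (azimuthal m \<phi> * azimuthal j \<phi>))
        has_integral 0) {0..2*pi}"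
      by (simp add: per)
    from scale[OF this] show ?thesis using ne by simp
  next
    case 3
    have "((\<lambda>\<phi>. -2 * real_of_int m * (azimuthal m \<phi> * azimuthal (- m) \<phi>)) has_integral
        azimuthal m (2*pi) * azimuthal m (2*pi) - azimuthal m 0 * azimuthal m 0) {0..2*pi}"
      by (rule ftc) ((rule derivative_eq_intros azimuthal_deriv refl)+, simp add: algebra_simps)
    then have "((\<lambda>\<phi>. -2 * real_of_int m * (azimuthal m \<phi> * azimuthal (- m) \<phi>)) has_integral 0)
        {0..2*pi}"
      by (simp add: per)
    from scale[OF this] show ?thesis using 3 by simp
  next
    case 4
    have sq: "azimuthal m \<phi> * azimuthal m \<phi> + azimuthal (- m) \<phi> * azimuthal (- m) \<phi> = 1" for \<phi>
      using 4 by (auto simp: azimuthal_def power2_eq_square[symmetric])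
    have "((\<lambda>\<phi>. real_of_int m * (azimuthal m \<phi> * azimuthal m \<phi> - azimuthal (- m) \<phi> * azimuthal (-
        m) \<phi>)) has_integral
        azimuthal m (2*pi) * azimuthal (- m) (2*pi) - azimuthal m 0 * azimuthal (- m) 0) {0..2*pi}"
      by (rule ftc) ((rule derivative_eq_intros azimuthal_deriv refl)+, simp add: algebra_simps)
    then have "((\<lambda>\<phi>. real_of_int m * (azimuthal m \<phi> * azimuthal m \<phi> - azimuthal (- m) \<phi> * azimuthal
        (- m) \<phi>)) has_integral 0) {0..2*pi}"
      by (simp add: per)
    moreover have "azimuthal m \<phi> * azimuthal m \<phi> - azimuthal (- m) \<phi> * azimuthal (- m) \<phi> = 2 *
        (azimuthal m \<phi> * azimuthal m \<phi>) - 1" for \<phi>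
      using sq[of \<phi>] by linarith
    ultimately have "((\<lambda>\<phi>. real_of_int m * (2 * (azimuthal m \<phi> * azimuthal m \<phi>) - 1)) has_integral
        0) {0..2*pi}"
      by simp
    from scale[OF this] have "((\<lambda>\<phi>. 2 * (azimuthal m \<phi> * azimuthal m \<phi>) - 1) has_integral 0)
        {0..2*pi}"
      using 4 by simp
    from has_integral_add[OF this has_integral_const_real[of "1::real" 0 "2 * pi"]]
    have "((\<lambda>\<phi>. 2 * (azimuthal m \<phi> * azimuthal m \<phi>)) has_integral 2 * pi) {0..2*pi}" by simp
    from has_integral_mult_right[OF this, of "1/2"] show ?thesis using 4 by simp
  qed
qed

section \<open>Orthogonality of harmonics and of their gradients on the sphere\<close>

definition sph_box :: "(real \<times> real) set" where
  "sph_box = cbox (0, 0) (pi, 2 * pi)"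

lemma mem_sph_box: "p \<in> sph_box \<longleftrightarrow> 0 \<le> fst p \<and> fst p \<le> pi \<and> 0 \<le> snd p \<and> snd p \<le> 2 * pi"
  by (cases p) (auto simp: sph_box_def)

lemma sph_box_integral_prod:
  assumes "continuous_on {0..pi} f" "continuous_on {0..2 * pi} g"
  shows "integral sph_box (\<lambda>p. f (fst p) * g (snd p)) = integral {0..pi} f * integral {0..2 * pi}
      (g :: real \<Rightarrow> real)"
proof -
  have "continuous_on (cbox (0, 0) (pi, 2 * pi)) (\<lambda>p. f (fst p) * g (snd p))"
    by (intro continuous_intros continuous_on_compose2[OF assms(1)] continuous_on_compose2[OF
        assms(2)]) auto
  from integral_prod_continuous[OF this]
  show ?thesis by (simp add: sph_box_def)
qed

text \<open>The inner product of \<open>L\<^sup>2\<close> of the sphere for (vector-valued) functions of \<open>(\<theta>, \<phi>)\<close>.\<close>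
definition sph_ip :: "(real \<times> real \<Rightarrow> 'b::real_inner) \<Rightarrow> (real \<times> real \<Rightarrow> 'b) \<Rightarrow> real" where
  "sph_ip f g = integral sph_box (\<lambda>p. (f p \<bullet> g p) * sin (fst p))"

lemma harm_factor_sq: "harm_factor n m * harm_factor n m = harm_norm n (nat \<bar>m\<bar>) * (if m = 0 then 1
    else 2)"
  using harm_norm_pos[of n "nat \<bar>m\<bar>"]
  by (simp add: harm_factor_def power2_eq_square[symmetric] power_mult_distrib)

lemma harm_orthonormal:
  assumes "\<bar>m\<bar> \<le> int n"
  shows "sph_ip (\<lambda>p. harm n m (fst p) (snd p)) (\<lambda>p. harm l j (fst p) (snd p)) = (if n = l \<and> m = j
      then 1 else 0)"
proof -
  let ?k = "nat \<bar>m\<bar>" and ?i = "nat \<bar>j\<bar>"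
  have "sph_ip (\<lambda>p. harm n m (fst p) (snd p)) (\<lambda>p. harm l j (fst p) (snd p))
     = integral sph_box (\<lambda>p. harm_factor n m * harm_factor l j * ((assoc_leg n ?k (fst p) *
         assoc_leg l ?i (fst p) * sin (fst p)) * (azimuthal m (snd p) * azimuthal j (snd p))))"
    unfolding sph_ip_def harm_def by (simp add: mult_ac)
  also have "\<dots> = harm_factor n m * harm_factor l j * integral sph_box (\<lambda>p. (assoc_leg n ?k (fst p)
      * assoc_leg l ?i (fst p) * sin (fst p)) * (azimuthal m (snd p) * azimuthal j (snd p)))"
    by simp
  also have "integral sph_box (\<lambda>p. (assoc_leg n ?k (fst p) * assoc_leg l ?i (fst p) * sin (fst p))
      * (azimuthal m (snd p) * azimuthal j (snd p)))
      = integral {0..pi} (\<lambda>\<theta>. assoc_leg n ?k \<theta> * assoc_leg l ?i \<theta> * sin \<theta>) * integral {0..2 * pi}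
          (\<lambda>\<phi>. azimuthal m \<phi> * azimuthal j \<phi>)"
    by (intro sph_box_integral_prod continuous_intros)
  also have "integral {0..2 * pi} (\<lambda>\<phi>. azimuthal m \<phi> * azimuthal j \<phi>) = (if m \<noteq> j then 0 else if m
      = 0 then 2 * pi else pi)"
    using azimuthal_has_integral by (rule integral_unique)
  finally have E: "sph_ip (\<lambda>p. harm n m (fst p) (snd p)) (\<lambda>p. harm l j (fst p) (snd p))
    = harm_factor n m * harm_factor l j * (integral {0..pi} (\<lambda>\<theta>. assoc_leg n ?k \<theta> * assoc_leg l ?i
        \<theta> * sin \<theta>) *
        (if m \<noteq> j then 0 else if m = 0 then 2 * pi else pi))" .
  show ?thesis
  proof (cases "n = l \<and> m = j")
    case True
    have "harm_factor n m * harm_factor n m * (if m = 0 then 2 * pi else pi) = harm_norm n ?k * (2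
        * pi)"
      by (simp add: harm_factor_sq)
    moreover have "harm_norm n ?k * radial_int ?k n n = 1 / (2 * pi)"
      using assms by (intro harm_norm_radial_int) simp
    ultimately have "harm_factor n m * harm_factor n m * (radial_int ?k n n * (if m = 0 then 2 * pi
        else pi)) = 1"
      by (simp add: mult_ac split: if_splits)
    then show ?thesis
      unfolding E using True by (simp add: radial_int_def mult.assoc split: if_splits)
  next
    case False
    then consider "m \<noteq> j" | "m = j" "n \<noteq> l" by blast
    then show ?thesis
    proof cases
      case 2
      then show ?thesis unfolding E using radial_int_orthogonal[of n l ?k] by (simp add:
          radial_int_def)
    qed (use E False in auto)
  qed
qed

text \<open>The colatitude and longitude components involve the azimuthal modes of orders m and -m,
  whose integrals agree. Factoring this integral out leaves exactly the combination evaluated in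
  \<open>radial_gradient_integral\<close>.\<close>

lemma harm_gradient_orthonormal:
  assumes "\<bar>m\<bar> \<le> int n"
  shows "sph_ip (\<lambda>p. (harm_theta n m (fst p) (snd p), harm_phi n m (fst p) (snd p)))
      (\<lambda>p. (harm_theta l j (fst p) (snd p), harm_phi l j (fst p) (snd p)))
    = (if n = l \<and> m = j then real n * (real n + 1) else 0)"
proof -
  let ?k = "nat \<bar>m\<bar>" and ?i = "nat \<bar>j\<bar>"
  let ?T = "\<lambda>m j. integral {0..2 * pi} (\<lambda>\<phi>. azimuthal m \<phi> * azimuthal j \<phi>)"
  have T: "?T m j = (if m \<noteq> j then 0 else if m = 0 then 2 * pi else pi)" for m j
    using azimuthal_has_integral by (rule integral_unique)
  let ?a = "\<lambda>p. (dassoc_leg n ?k (fst p) * dassoc_leg l ?i (fst p) * sin (fst p)) * (azimuthal m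
      (snd p) * azimuthal j (snd p))"
  let ?b = "\<lambda>p. (assoc_leg_quot n ?k (fst p) * assoc_leg_quot l ?i (fst p) * sin (fst p)) *
      (azimuthal (- m) (snd p) * azimuthal (- j) (snd p))"
  have ci: "?a integrable_on sph_box" "?b integrable_on sph_box"
    unfolding sph_box_def by (intro integrable_continuous continuous_intros)+
  have "sph_ip (\<lambda>p. (harm_theta n m (fst p) (snd p), harm_phi n m (fst p) (snd p)))
      (\<lambda>p. (harm_theta l j (fst p) (snd p), harm_phi l j (fst p) (snd p)))
     = integral sph_box (\<lambda>p. harm_factor n m * harm_factor l j * ?a p + harm_factor n m *
         harm_factor l j * (real_of_int m * real_of_int j) * ?b p)"
    unfolding sph_ip_def harm_theta_def harm_phi_def by (simp add: algebra_simps)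
  also have "\<dots> = integral sph_box (\<lambda>p. harm_factor n m * harm_factor l j * ?a p) + integral sph_box
      (\<lambda>p. harm_factor n m * harm_factor l j * (real_of_int m * real_of_int j) * ?b p)"
    by (intro integral_add integrable_on_mult_right ci)
  also have "\<dots> = harm_factor n m * harm_factor l j * integral sph_box ?a + harm_factor n m *
      harm_factor l j * (real_of_int m * real_of_int j) * integral sph_box ?b"
    by simp
  also have "integral sph_box ?a = integral {0..pi} (\<lambda>\<theta>. dassoc_leg n ?k \<theta> * dassoc_leg l ?i \<theta> *
      sin \<theta>) * ?T m j"
    by (intro sph_box_integral_prod continuous_intros)
  also have "integral sph_box ?b = integral {0..pi} (\<lambda>\<theta>. assoc_leg_quot n ?k \<theta> * assoc_leg_quot l
      ?i \<theta> * sin \<theta>) * ?T (- m) (- j)"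
    by (intro sph_box_integral_prod continuous_intros)
  finally have E: "sph_ip (\<lambda>p. (harm_theta n m (fst p) (snd p), harm_phi n m (fst p) (snd p)))
      (\<lambda>p. (harm_theta l j (fst p) (snd p), harm_phi l j (fst p) (snd p)))
    = harm_factor n m * harm_factor l j * (integral {0..pi} (\<lambda>\<theta>. dassoc_leg n ?k \<theta> * dassoc_leg l
        ?i \<theta> * sin \<theta>) * ?T m j)
      + harm_factor n m * harm_factor l j * (real_of_int m * real_of_int j) *
        (integral {0..pi} (\<lambda>\<theta>. assoc_leg_quot n ?k \<theta> * assoc_leg_quot l ?i \<theta> * sin \<theta>) * ?T (- m) (-
            j))" .
  show ?thesis
  proof (cases "m = j")
    case True
    let ?A = "integral {0..pi} (\<lambda>\<theta>. dassoc_leg n ?k \<theta> * dassoc_leg l ?k \<theta> * sin \<theta>)"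
    let ?B = "integral {0..pi} (\<lambda>\<theta>. assoc_leg_quot n ?k \<theta> * assoc_leg_quot l ?k \<theta> * sin \<theta>)"
    let ?tm = "if m = 0 then 2 * pi else pi"
    have AB: "?A + (real_of_int m)\<^sup>2 * ?B = real n * (real n + 1) * radial_int ?k n l"
    proof -
      have "((\<lambda>\<theta>. dassoc_leg n ?k \<theta> * dassoc_leg l ?k \<theta> * sin \<theta> + (real_of_int m)\<^sup>2 *
          (assoc_leg_quot n ?k \<theta> * assoc_leg_quot l ?k \<theta> * sin \<theta>))
        has_integral ?A + (real_of_int m)\<^sup>2 * ?B) {0..pi}"
        by (intro has_integral_add has_integral_mult_right integrable_integral
            integrable_continuous_real continuous_intros)
      moreover have "(real ?k)\<^sup>2 = (real_of_int m)\<^sup>2" by simp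
      ultimately have "((\<lambda>\<theta>. (dassoc_leg n ?k \<theta> * dassoc_leg l ?k \<theta> + (real ?k)\<^sup>2 * (assoc_leg_quot
          n ?k \<theta> * assoc_leg_quot l ?k \<theta>)) * sin \<theta>)
        has_integral ?A + (real_of_int m)\<^sup>2 * ?B) {0..pi}"
        by (simp only: distrib_right mult.assoc)
      then show ?thesis using radial_gradient_integral has_integral_unique by blast
    qed
    have "sph_ip (\<lambda>p. (harm_theta n m (fst p) (snd p), harm_phi n m (fst p) (snd p)))
      (\<lambda>p. (harm_theta l j (fst p) (snd p), harm_phi l j (fst p) (snd p)))
      = harm_factor n m * harm_factor l m * ?tm * (?A + (real_of_int m)\<^sup>2 * ?B)"
      unfolding E T using True by (simp add: power2_eq_square algebra_simps)
    also have "\<dots> = (real n * (real n + 1)) * (harm_factor n m * harm_factor l m * (?tm * radial_int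
        ?k n l))"
      unfolding AB by (simp only: mult_ac)
    also have "harm_factor n m * harm_factor l m * (?tm * radial_int ?k n l) = (if n = l then 1
        else 0)"
    proof (cases "n = l")
      case True
      have "harm_factor n m * harm_factor n m * ?tm = harm_norm n ?k * (2 * pi)"
        by (simp add: harm_factor_sq)
      moreover have "harm_norm n ?k * radial_int ?k n n = 1 / (2 * pi)"
        using assms by (intro harm_norm_radial_int) simp
      ultimately show ?thesis
        using True by (simp add: mult_ac split: if_splits)
    qed (simp add: radial_int_orthogonal)
    finally show ?thesis using True by simp
  qed (simp add: E T)
qed

section \<open>Series of spherical harmonics\<close>

lemma compact_sph_box: "compact sph_box"
  by (simp add: sph_box_def)

lemma sph_ip_integrable:
  assumes "continuous_on sph_box f" "continuous_on sph_box g"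
  shows "(\<lambda>p. (f p \<bullet> g p) * sin (fst p)) integrable_on sph_box"
  using assms unfolding sph_box_def by (intro integrable_continuous continuous_intros) auto

lemma sph_ip_commute: "sph_ip f g = sph_ip g f"
  by (simp add: sph_ip_def inner_commute)

lemma sph_ip_add_left:
  assumes "continuous_on sph_box f" "continuous_on sph_box f'" "continuous_on sph_box g"
  shows "sph_ip (\<lambda>p. f p + f' p) g = sph_ip f g + sph_ip f' g"
  unfolding sph_ip_def inner_add_left distrib_right
  by (intro integral_add sph_ip_integrable assms)

lemma sph_ip_scaleR_left: "sph_ip (\<lambda>p. c *\<^sub>R f p) g = c * sph_ip f g"
  unfolding sph_ip_def inner_scaleR_left mult.assoc by simp

lemma sph_ip_diff_left:
  assumes "continuous_on sph_box f" "continuous_on sph_box f'" "continuous_on sph_box g"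
  shows "sph_ip (\<lambda>p. f p - f' p) g = sph_ip f g - sph_ip f' g"
  unfolding sph_ip_def inner_diff_left left_diff_distrib
  by (intro integral_diff sph_ip_integrable assms)

lemma sph_ip_sum_left:
  assumes "finite A" "\<And>i. i \<in> A \<Longrightarrow> continuous_on sph_box (f i)" "continuous_on sph_box g"
  shows "sph_ip (\<lambda>p. \<Sum>i\<in>A. f i p) g = (\<Sum>i\<in>A. sph_ip (f i) g)"
  unfolding sph_ip_def inner_sum_left sum_distrib_right
  by (intro integral_sum sph_ip_integrable assms)

lemma sph_ip_sum_right:
  assumes "finite A" "\<And>i. i \<in> A \<Longrightarrow> continuous_on sph_box (f i)" "continuous_on sph_box g"
  shows "sph_ip g (\<lambda>p. \<Sum>i\<in>A. f i p) = (\<Sum>i\<in>A. sph_ip g (f i))"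
  using sph_ip_sum_left[OF assms] by (simp add: sph_ip_commute)

lemma sph_ip_tendsto:
  fixes f g :: "nat \<Rightarrow> real \<times> real \<Rightarrow> 'b::real_inner"
  assumes "uniform_limit sph_box f l sequentially" "uniform_limit sph_box g m sequentially"
    and "\<And>n. continuous_on sph_box (f n)" "\<And>n. continuous_on sph_box (g n)"
  shows "(\<lambda>n. sph_ip (f n) (g n)) \<longlonglongrightarrow> sph_ip l m"
proof -
  have "continuous_on sph_box l" "continuous_on sph_box m"
    by (rule uniform_limit_theorem[OF always_eventually assms(1)] uniform_limit_theorem[OF
        always_eventually assms(2)];
        simp add: assms(3,4))+
  then have b: "bounded (l ` sph_box)" "bounded (m ` sph_box)"
    using compact_sph_box by (auto intro!: compact_imp_bounded compact_continuous_image)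
  have s: "continuous_on sph_box (\<lambda>p. sin (fst p))" "continuous_on sph_box (\<lambda>p. l p \<bullet> m p)"
    by (intro continuous_intros \<open>continuous_on sph_box l\<close> \<open>continuous_on sph_box m\<close>)+
  have "uniform_limit sph_box (\<lambda>n p. (f n p \<bullet> g n p) * sin (fst p)) (\<lambda>p. (l p \<bullet> m p) * sin (fst p))
      sequentially"
    using s compact_sph_box
    by (intro uniform_limit_intros assms b) (auto intro!: compact_imp_bounded
        compact_continuous_image)
  then obtain I J where "\<And>n. ((\<lambda>p. (f n p \<bullet> g n p) * sin (fst p)) has_integral I n) sph_box"
    "((\<lambda>p. (l p \<bullet> m p) * sin (fst p)) has_integral J) sph_box" "(I \<longlongrightarrow> J) sequentially"
    unfolding sph_box_def
    by (rule uniform_limit_integral_cbox)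
       (use assms(3,4) in \<open>auto intro!: continuous_intros simp: sph_box_def\<close>)
  then have "(\<lambda>n. integral sph_box (\<lambda>p. (f n p \<bullet> g n p) * sin (fst p))) = I"
    "integral sph_box (\<lambda>p. (l p \<bullet> m p) * sin (fst p)) = J"
    by (auto intro!: integral_unique)
  then show ?thesis unfolding sph_ip_def using \<open>I \<longlonglongrightarrow> J\<close> by simp
qed

text \<open>A continuous nonnegative integrand with zero integral vanishes. The weight
  \<open>sin \<theta>\<close> can be divided out only off the poles.\<close>

lemma sph_ip_self_eq_0:
  fixes f :: "real \<times> real \<Rightarrow> real"
  assumes "continuous_on sph_box f" "sph_ip f f = 0" "0 < \<theta>" "\<theta> < pi" "0 \<le> \<phi>" "\<phi> \<le> 2 * pi"
  shows "f (\<theta>, \<phi>) = 0"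
proof -
  let ?h = "\<lambda>p. (f p \<bullet> f p) * sin (fst p)"
  have "(?h has_integral 0) (cbox (0, 0) (pi, 2 * pi))"
    using sph_ip_integrable[OF assms(1,1)] assms(2) unfolding sph_ip_def sph_box_def
    by (simp add: has_integral_integral[symmetric] integrable_integral flip: sph_box_def) (metis
        integrable_integral)
  moreover have "continuous_on (cbox (0, 0) (pi, 2 * pi)) ?h"
    using assms(1) unfolding sph_box_def by (intro continuous_intros) auto
  moreover have "(pi / 2, pi) \<in> box (0, 0) (pi, 2 * pi)"
    by (auto simp: box_def Basis_prod_def)
  moreover have "0 \<le> ?h p" if "p \<in> box (0, 0) (pi, 2 * pi)" for p
    by (rule mult_nonneg_nonneg[OF inner_ge_zero sin_ge_zero])
       (use that in \<open>cases p; auto simp: box_def Basis_prod_def\<close>)+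
  ultimately have "?h (\<theta>, \<phi>) = 0"
    using assms(3-6) by (intro has_integral_0_cbox_imp_0[of "(0, 0)" "(pi, 2 * pi)"]) auto
  then show ?thesis using sin_gt_zero[OF assms(3,4)] by simp
qed

section \<open>Series over degrees with decaying coefficients\<close>

definition harm_block :: "(nat \<Rightarrow> int \<Rightarrow> real \<times> real \<Rightarrow> 'b::real_vector) \<Rightarrow> (nat \<Rightarrow> int \<Rightarrow> real) \<Rightarrow> nat \<Rightarrow>
    real \<times> real \<Rightarrow> 'b" where
  "harm_block F c n p = (\<Sum>m\<in>{- int n..int n}. c n m *\<^sub>R F n m p)"

definition harm_series :: "(nat \<Rightarrow> int \<Rightarrow> real \<times> real \<Rightarrow> 'b::real_normed_vector) \<Rightarrow> (nat \<Rightarrow> int \<Rightarrow> real)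
    \<Rightarrow> real \<times> real \<Rightarrow> 'b" where
  "harm_series F c p = (\<Sum>n. harm_block F c n p)"

text \<open>Degree 0 is left free because the vorticity determines the stream function only up to an
  additive constant.\<close>

definition coeff_decay :: "(nat \<Rightarrow> int \<Rightarrow> real) \<Rightarrow> real \<Rightarrow> bool" where
  "coeff_decay c K \<longleftrightarrow> 0 \<le> K \<and> (\<forall>n\<ge>1. \<forall>m. \<bar>m\<bar> \<le> int n \<longrightarrow> \<bar>c n m\<bar> \<le> K / real n ^ 4)"

lemma summable_32: "summable (\<lambda>n. real n powr (- (3 / 2)))"
  by (simp add: summable_real_powr_iff)

lemma powr_quotient_4: "1 \<le> n \<Longrightarrow> real n powr a / real n ^ 4 = real n powr (a - 4)"
proof -
  assume "1 \<le> n"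
  then have "real n ^ 4 = real n powr 4" by simp
  then show ?thesis by (simp only: powr_diff)
qed

text \<open>A common frame for harmonics, their derivatives and their gradients. The factor 4
  accommodates a gradient, a pair of components each bounded by 2 n^(3/2). Degree 0 has its own
  bound, since the power of n is zero there.\<close>

locale sph_family =
  fixes F :: "nat \<Rightarrow> int \<Rightarrow> real \<times> real \<Rightarrow> 'b::euclidean_space"
  assumes bound: "1 \<le> n \<Longrightarrow> \<bar>m\<bar> \<le> int n \<Longrightarrow> norm (F n m p) \<le> 4 * real n powr (3 / 2)"
    and bound_0: "norm (F 0 0 p) \<le> 1"
    and cont: "continuous_on A (F n m)"
begin

lemma harm_block_cont: "continuous_on A (harm_block F c n)"
  unfolding harm_block_def by (intro continuous_intros cont)

text \<open>At most 3n orders contribute, each at most K n^-4 times 4 n^(3/2). This is the source of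
  the constant 12 and of the summable exponent -3/2.\<close>

lemma harm_block_bound:
  assumes "coeff_decay c K" "1 \<le> n"
  shows "norm (harm_block F c n p) \<le> 12 * K * real n powr (- (3 / 2))"
proof -
  have K: "0 \<le> K" using assms by (simp add: coeff_decay_def)
  have "norm (harm_block F c n p) \<le> (\<Sum>m\<in>{- int n..int n}. K / real n ^ 4 * (4 * real n powr (3 /
      2)))"
    unfolding harm_block_def
  proof (rule sum_norm_le)
    fix m assume "m \<in> {- int n..int n}"
    then have m: "\<bar>m\<bar> \<le> int n" by auto
    show "norm (c n m *\<^sub>R F n m p) \<le> K / real n ^ 4 * (4 * real n powr (3 / 2))"
      unfolding norm_scaleR using assms m by (intro mult_mono bound) (auto simp: coeff_decay_def)
  qed
  also have "\<dots> = (2 * real n + 1) * (K / real n ^ 4 * (4 * real n powr (3 / 2)))"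
    by simp
  also have "\<dots> \<le> (3 * real n) * (K / real n ^ 4 * (4 * real n powr (3 / 2)))"
    using assms K by (intro mult_right_mono) auto
  also have "\<dots> = 12 * K * ((real n powr 1 * real n powr (3 / 2)) / real n ^ 4)"
    using assms by simp
  also have "(real n powr 1 * real n powr (3 / 2)) / real n ^ 4 = real n powr (- (3 / 2))"
    using assms by (simp only: powr_add[symmetric] powr_quotient_4) simp
  finally show ?thesis .
qed

definition majorant :: "(nat \<Rightarrow> int \<Rightarrow> real) \<Rightarrow> real \<Rightarrow> nat \<Rightarrow> real" where
  "majorant c K n = (if n = 0 then \<bar>c 0 0\<bar> else 12 * K * real n powr (- (3 / 2)))"

lemma harm_block_majorant: "coeff_decay c K \<Longrightarrow> norm (harm_block F c n p) \<le> majorant c K n"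
proof (cases "n = 0")
  case True
  have "norm (c 0 0 *\<^sub>R F 0 0 p) \<le> \<bar>c 0 0\<bar> * 1"
    unfolding norm_scaleR by (intro mult_left_mono bound_0) simp
  then show ?thesis using True by (simp add: harm_block_def majorant_def)
qed (use harm_block_bound[of c K n p] in \<open>simp add: majorant_def\<close>)

lemma summable_majorant: "summable (majorant c K)"
proof (rule summable_cong[THEN iffD2])
  show "\<forall>\<^sub>F n in sequentially. majorant c K n = 12 * K * real n powr (- (3 / 2))"
    by (auto simp: majorant_def eventually_sequentially intro!: exI[of _ 1])
  show "summable (\<lambda>n. 12 * K * real n powr (- (3 / 2)))"
    by (intro summable_mult summable_32)
qed

lemma harm_series_uniform_limit:
  assumes "coeff_decay c K"
  shows "uniform_limit A (\<lambda>n p. \<Sum>i<n. harm_block F c i p) (harm_series F c) sequentially"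
  unfolding harm_series_def[abs_def] by (rule Weierstrass_m_test[OF harm_block_majorant[OF assms]
      summable_majorant])

lemma harm_series_sums:
  assumes "coeff_decay c K"
  shows "(\<lambda>n. harm_block F c n p) sums harm_series F c p"
  unfolding harm_series_def by (intro summable_sums summable_comparison_test'[OF summable_majorant
      harm_block_majorant[OF assms]])

lemma harm_series_cont: "coeff_decay c K \<Longrightarrow> continuous_on A (harm_series F c)"
  by (rule uniform_limit_theorem[OF always_eventually harm_series_uniform_limit])
     (auto intro!: continuous_intros harm_block_cont)

lemma harm_series_add:
  assumes "coeff_decay c K" "coeff_decay c' K'"
  shows "harm_series F (\<lambda>n m. c n m + c' n m) p = harm_series F c p + harm_series F c' p"
proof -
  have "(\<lambda>n. harm_block F c n p + harm_block F c' n p) sums (harm_series F c p + harm_series F c'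
      p)"
    by (intro sums_add harm_series_sums[OF assms(1)] harm_series_sums[OF assms(2)])
  then show ?thesis
    by (simp add: harm_series_def harm_block_def scaleR_add_left sum.distrib sums_iff)
qed

text \<open>The bound must not involve the free coefficient of degree 0, so the family has to vanish
  there, as derivatives of a constant do.\<close>

lemma harm_series_bound:
  assumes "coeff_decay c K" "\<And>p. F 0 0 p = 0"
  shows "norm (harm_series F c p) \<le> 12 * K * (\<Sum>n. real n powr (- (3 / 2)))"
proof -
  have le: "norm (harm_block F c n p) \<le> 12 * K * real n powr (- (3 / 2))" for n
    using harm_block_bound[OF assms(1), of n p] assms(2) by (cases "n = 0") (simp_all add:
        harm_block_def)
  have "norm (harm_series F c p) \<le> (\<Sum>n. 12 * K * real n powr (- (3 / 2)))"
    unfolding harm_series_def by (rule norm_suminf_le[OF le]) (intro summable_mult summable_32)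
  then show ?thesis by (simp add: suminf_mult summable_32)
qed

end

text \<open>The squared norms \<open>s\<close> are kept as a parameter so that harmonics, gradients
  and longitude derivatives, with squared norms 1, n(n+1) and m^2, share the same Parseval
  identity.\<close>

locale sph_orth_family = sph_family F for F :: "nat \<Rightarrow> int \<Rightarrow> real \<times> real \<Rightarrow> 'b::euclidean_space" +
  fixes s :: "nat \<Rightarrow> int \<Rightarrow> real"
  assumes orth: "\<bar>m\<bar> \<le> int n \<Longrightarrow> sph_ip (F n m) (F l j) = (if n = l \<and> m = j then s n m else 0)"
begin

lemma harm_block_coeff:
  assumes "\<bar>j\<bar> \<le> int l"
  shows "sph_ip (harm_block F c n) (F l j) = (if n = l then c l j * s l j else 0)"
proof -
  have "sph_ip (harm_block F c n) (F l j) = (\<Sum>m\<in>{- int n..int n}. sph_ip (\<lambda>p. c n m *\<^sub>R F n m p) (F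
      l j))"
    unfolding harm_block_def[abs_def] by (intro sph_ip_sum_left continuous_intros cont) simp
  also have "\<dots> = (\<Sum>m\<in>{- int n..int n}. if m = j then (if n = l then c l j * s l j else 0) else 0)"
  proof (rule sum.cong[OF refl])
    fix m assume "m \<in> {- int n..int n}"
    then have "\<bar>m\<bar> \<le> int n" by auto
    then show "sph_ip (\<lambda>p. c n m *\<^sub>R F n m p) (F l j) = (if m = j then (if n = l then c l j * s l j
        else 0) else 0)"
      by (auto simp: sph_ip_scaleR_left orth)
  qed
  also have "\<dots> = (if n = l then c l j * s l j else 0)"
    using assms by (auto simp: sum.delta)
  finally show ?thesis .
qed

lemma harm_block_harm_block: "sph_ip (harm_block F c n) (harm_block F c l) = (if n = l then \<Sum>m\<in>{-
    int n..int n}. (c n m)\<^sup>2 * s n m else 0)"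
proof -
  have "sph_ip (harm_block F c n) (harm_block F c l) = (\<Sum>j\<in>{- int l..int l}. sph_ip (harm_block F c
      n) (\<lambda>p. c l j *\<^sub>R F l j p))"
    unfolding harm_block_def[of F c l, abs_def] by (intro sph_ip_sum_right continuous_intros cont
        harm_block_cont) simp
  also have "\<dots> = (\<Sum>j\<in>{- int l..int l}. if n = l then (c l j)\<^sup>2 * s l j else 0)"
  proof (rule sum.cong[OF refl])
    fix j assume "j \<in> {- int l..int l}"
    then have "\<bar>j\<bar> \<le> int l" by auto
    then show "sph_ip (harm_block F c n) (\<lambda>p. c l j *\<^sub>R F l j p) = (if n = l then (c l j)\<^sup>2 * s l j
        else 0)"
      using harm_block_coeff[of j l c n] sph_ip_scaleR_left[of "c l j" "F l j" "harm_block F c n"]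
      by (simp add: sph_ip_commute power2_eq_square)
  qed
  finally show ?thesis by simp
qed

lemma harm_series_coeff:
  assumes "coeff_decay c K" "\<bar>j\<bar> \<le> int l"
  shows "sph_ip (harm_series F c) (F l j) = c l j * s l j"
proof -
  have lim: "(\<lambda>n. sph_ip (\<lambda>p. \<Sum>i<n. harm_block F c i p) (F l j)) \<longlonglongrightarrow> sph_ip (harm_series F c) (F l j)"
    by (rule sph_ip_tendsto[OF harm_series_uniform_limit[OF assms(1)] uniform_limit_const])
       (intro continuous_on_sum harm_block_cont cont)+
  have "sph_ip (\<lambda>p. \<Sum>i<n. harm_block F c i p) (F l j) = c l j * s l j" if "n > l" for n
    using that assms(2) by (subst sph_ip_sum_left) (auto simp: harm_block_cont cont
        harm_block_coeff sum.delta)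
  then have "\<forall>\<^sub>F n in sequentially. sph_ip (\<lambda>p. \<Sum>i<n. harm_block F c i p) (F l j) = c l j * s l j"
    by (auto simp: eventually_sequentially intro!: exI[of _ "Suc l"])
  from LIMSEQ_unique[OF lim tendsto_eventually[OF this]] show ?thesis .
qed

text \<open>Orthogonality evaluates the inner products of partial sums, and uniform convergence
  allows the limit to be taken under the integral.\<close>

lemma harm_series_parseval:
  assumes "coeff_decay c K"
  shows "(\<lambda>n. \<Sum>m\<in>{- int n..int n}. (c n m)\<^sup>2 * s n m) sums sph_ip (harm_series F c) (harm_series F
      c)"
proof -
  have "sph_ip (\<lambda>p. \<Sum>i<n. harm_block F c i p) (\<lambda>p. \<Sum>i<n. harm_block F c i p) = (\<Sum>i<n. \<Sum>m\<in>{- int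
      i..int i}. (c i m)\<^sup>2 * s i m)" for n
  proof -
    have "sph_ip (\<lambda>p. \<Sum>i<n. harm_block F c i p) (\<lambda>p. \<Sum>i<n. harm_block F c i p) = (\<Sum>i<n. sph_ip
        (harm_block F c i) (\<lambda>p. \<Sum>i<n. harm_block F c i p))"
      by (intro sph_ip_sum_left continuous_intros harm_block_cont) simp
    also have "\<dots> = (\<Sum>i<n. \<Sum>j<n. sph_ip (harm_block F c i) (harm_block F c j))"
      by (intro sum.cong refl sph_ip_sum_right continuous_intros harm_block_cont) simp
    also have "\<dots> = (\<Sum>i<n. \<Sum>m\<in>{- int i..int i}. (c i m)\<^sup>2 * s i m)"
      by (intro sum.cong refl) (simp add: harm_block_harm_block sum.delta)
    finally show ?thesis .
  qed
  moreover have "(\<lambda>n. sph_ip (\<lambda>p. \<Sum>i<n. harm_block F c i p) (\<lambda>p. \<Sum>i<n. harm_block F c i p)) \<longlonglongrightarrow>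
      sph_ip (harm_series F c) (harm_series F c)"
    by (rule sph_ip_tendsto[OF harm_series_uniform_limit[OF assms] harm_series_uniform_limit[OF
        assms]])
       (intro continuous_on_sum harm_block_cont)+
  ultimately show ?thesis by (simp add: sums_def)
qed

end

section \<open>The concrete families: harmonics, partial derivatives and gradients\<close>

definition harm_fun :: "nat \<Rightarrow> int \<Rightarrow> real \<times> real \<Rightarrow> real" where "harm_fun n m p = harm n m (fst p)
    (snd p)"
definition harm_theta_fun :: "nat \<Rightarrow> int \<Rightarrow> real \<times> real \<Rightarrow> real" where "harm_theta_fun n m p =
    harm_theta n m (fst p) (snd p)"
definition harm_phi_fun :: "nat \<Rightarrow> int \<Rightarrow> real \<times> real \<Rightarrow> real" where "harm_phi_fun n m p = harm_phi n
    m (fst p) (snd p)"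
text \<open>Components in the orthonormal frame, so the inner product of pairs is that of tangent
  vectors.\<close>

definition harm_grad_fun :: "nat \<Rightarrow> int \<Rightarrow> real \<times> real \<Rightarrow> real \<times> real" where "harm_grad_fun n m p =
    (harm_theta_fun n m p, harm_phi_fun n m p)"
definition harm_dphi_fun :: "nat \<Rightarrow> int \<Rightarrow> real \<times> real \<Rightarrow> real" where "harm_dphi_fun n m p = sin (fst
    p) * harm_phi_fun n m p"

lemma harm_theta_fun_0: "harm_theta_fun 0 0 p = 0" and harm_phi_fun_0: "harm_phi_fun 0 0 p = 0"
  using abs_harm_theta_le[of 0 0 "fst p" "snd p"] by (simp_all add: harm_theta_fun_def
      harm_phi_fun_def harm_phi_def)

lemma harm_fun_0: "\<bar>harm_fun 0 0 p\<bar> \<le> 1"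
proof -
  have "harm_fun 0 0 p = sqrt (1 / (4 * pi))"
    by (simp add: harm_fun_def harm_def harm_factor_def assoc_leg_def dlegendre_0 azimuthal_def
        harm_norm_0)
  moreover have "1 / (4 * pi) \<le> 1" using pi_gt3 by simp
  ultimately show ?thesis by simp
qed

text \<open>Longitude differentiation exchanges the orders m and -m within a degree. Orthogonality
  of these derivatives thus reduces to that of the harmonics.\<close>

lemma harm_dphi_fun_eq: "harm_dphi_fun n m p = - real_of_int m * harm_fun n (- m) p"
proof (cases "m = 0")
  case False
  then have "assoc_leg n (nat \<bar>m\<bar>) (fst p) = sin (fst p) * assoc_leg_quot n (nat \<bar>m\<bar>) (fst p)"
    by (intro assoc_leg_sin_assoc_leg_quot) simp
  then show ?thesis by (simp add: harm_dphi_fun_def harm_phi_fun_def harm_fun_def harm_def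
      harm_phi_def harm_factor_def)
qed (simp add: harm_dphi_fun_def harm_phi_fun_def harm_phi_def)

interpretation H: sph_orth_family harm_fun "\<lambda>n m. 1"
proof
  show "norm (harm_fun n m p) \<le> 4 * real n powr (3 / 2)" if "1 \<le> n" for n m p
    using abs_harm_le[OF that, of m "fst p" "snd p"] by (simp add: harm_fun_def)
  show "sph_ip (harm_fun n m) (harm_fun l j) = (if n = l \<and> m = j then 1 else 0)" if "\<bar>m\<bar> \<le> int n"
      for n m l j
    using harm_orthonormal[OF that] by (simp add: harm_fun_def[abs_def])
qed (use harm_fun_0 in \<open>auto simp: harm_fun_def[abs_def] intro!: continuous_intros\<close>)

interpretation T: sph_family harm_theta_fun
proof
  show "norm (harm_theta_fun n m p) \<le> 4 * real n powr (3 / 2)" if "\<bar>m\<bar> \<le> int n" for n m p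
    using abs_harm_theta_le[OF that, of "fst p" "snd p"] powr_ge_zero[of "real n" "3/2"] unfolding
        harm_theta_fun_def real_norm_def by linarith
  show "continuous_on A (harm_theta_fun n m)" for A n m
    unfolding harm_theta_fun_def[abs_def] by (intro continuous_intros)
qed (simp add: harm_theta_fun_0)

interpretation Q: sph_family harm_phi_fun
proof
  show "norm (harm_phi_fun n m p) \<le> 4 * real n powr (3 / 2)" if "\<bar>m\<bar> \<le> int n" for n m p
    using abs_harm_phi_le[OF that, of "fst p" "snd p"] powr_ge_zero[of "real n" "3/2"] unfolding
        harm_phi_fun_def real_norm_def by linarith
  show "continuous_on A (harm_phi_fun n m)" for A n m
    unfolding harm_phi_fun_def[abs_def] by (intro continuous_intros)
qed (simp add: harm_phi_fun_0)

interpretation G: sph_orth_family harm_grad_fun "\<lambda>n m. real n * (real n + 1)"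
proof
  show "norm (harm_grad_fun n m p) \<le> 4 * real n powr (3 / 2)" if "\<bar>m\<bar> \<le> int n" for n m p
  proof -
    have "norm (harm_grad_fun n m p) \<le> norm (harm_theta_fun n m p) + norm (harm_phi_fun n m p)"
      unfolding harm_grad_fun_def by (rule norm_Pair_le)
    then show ?thesis
      using abs_harm_theta_le[OF that, of "fst p" "snd p"] abs_harm_phi_le[OF that, of "fst p" "snd
          p"]
      unfolding harm_phi_fun_def harm_theta_fun_def real_norm_def by linarith
  qed
  show "sph_ip (harm_grad_fun n m) (harm_grad_fun l j) = (if n = l \<and> m = j then real n * (real n +
      1) else 0)" if "\<bar>m\<bar> \<le> int n" for n m l j
    using harm_gradient_orthonormal[OF that] by (simp add: harm_grad_fun_def[abs_def]
        harm_theta_fun_def harm_phi_fun_def)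
  show "continuous_on A (harm_grad_fun n m)" for A n m
    unfolding harm_grad_fun_def[abs_def] by (intro continuous_intros T.cont Q.cont)
qed (simp add: harm_grad_fun_def harm_theta_fun_0 harm_phi_fun_0)

interpretation P: sph_orth_family harm_dphi_fun "\<lambda>n m. (real_of_int m)\<^sup>2"
proof
  show "norm (harm_dphi_fun n m p) \<le> 4 * real n powr (3 / 2)" if "1 \<le> n" "\<bar>m\<bar> \<le> int n" for n m p
  proof -
    have "\<bar>sin (fst p)\<bar> * norm (harm_phi_fun n m p) \<le> 1 * (4 * real n powr (3 / 2))"
      using that by (intro mult_mono Q.bound) auto
    then show ?thesis by (simp add: harm_dphi_fun_def abs_mult)
  qed
  show "sph_ip (harm_dphi_fun n m) (harm_dphi_fun l j) = (if n = l \<and> m = j then (real_of_int m)\<^sup>2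
      else 0)" if "\<bar>m\<bar> \<le> int n" for n m l j
  proof -
    have "sph_ip (harm_dphi_fun n m) (harm_dphi_fun l j) = (- real_of_int m) * ((- real_of_int j) *
        sph_ip (harm_fun n (- m)) (harm_fun l (- j)))"
      using sph_ip_scaleR_left[of "- real_of_int m" "harm_fun n (- m)" "harm_dphi_fun l j"]
        sph_ip_scaleR_left[of "- real_of_int j" "harm_fun l (- j)" "harm_fun n (- m)"]
      unfolding harm_dphi_fun_eq[abs_def] real_scaleR_def by (simp add: sph_ip_commute)
    also have "\<dots> = (if n = l \<and> m = j then (real_of_int m)\<^sup>2 else 0)"
      using that by (simp add: H.orth power2_eq_square)
    finally show ?thesis .
  qed
  show "continuous_on A (harm_dphi_fun n m)" for A n m
    unfolding harm_dphi_fun_def[abs_def] by (intro continuous_intros Q.cont)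
qed (simp add: harm_dphi_fun_def harm_phi_fun_0)

lemma harm_series_harm_grad_fun:
  assumes "coeff_decay c K"
  shows "harm_series harm_grad_fun c p = (harm_series harm_theta_fun c p, harm_series harm_phi_fun
      c p)"
proof -
  have "(\<lambda>n. harm_block harm_theta_fun c n p) sums fst (harm_series harm_grad_fun c p)" "(\<lambda>n.
      harm_block harm_phi_fun c n p) sums snd (harm_series harm_grad_fun c p)"
    using bounded_linear.sums[OF bounded_linear_fst G.harm_series_sums[OF assms, of p]]
      bounded_linear.sums[OF bounded_linear_snd G.harm_series_sums[OF assms, of p]]
    by (simp_all add: harm_block_def harm_grad_fun_def fst_sum snd_sum)
  then show ?thesis
    using T.harm_series_sums[OF assms, of p] Q.harm_series_sums[OF assms, of p] by (simp add:
        sums_iff prod_eq_iff)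
qed

lemma harm_series_harm_dphi_fun:
  assumes "coeff_decay c K"
  shows "harm_series harm_dphi_fun c p = sin (fst p) * harm_series harm_phi_fun c p"
proof -
  have "(\<lambda>n. sin (fst p) * harm_block harm_phi_fun c n p) sums (sin (fst p) * harm_series
      harm_phi_fun c p)"
    by (intro sums_mult Q.harm_series_sums[OF assms])
  then show ?thesis
    by (simp add: harm_series_def[of harm_dphi_fun] harm_block_def harm_dphi_fun_def
        sum_distrib_left mult_ac sums_iff)
qed

lemma harm_series_harm_fun_deriv_theta:
  assumes "coeff_decay c K"
  shows "((\<lambda>t. harm_series harm_fun c (t, \<phi>)) has_real_derivative harm_series harm_theta_fun c (\<theta>,
      \<phi>)) (at \<theta>)"
  unfolding harm_series_def
proof (rule has_field_derivative_series'(2)[of UNIV])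
  show "((\<lambda>t. harm_block harm_fun c n (t, \<phi>)) has_real_derivative harm_block harm_theta_fun c n (x,
      \<phi>)) (at x within UNIV)" for n x
    unfolding harm_block_def harm_fun_def harm_theta_fun_def by (auto intro!: derivative_eq_intros
        harm_deriv_theta simp: mult.commute)
  have "uniformly_convergent_on UNIV (\<lambda>n p. \<Sum>i<n. harm_block harm_theta_fun c i p)"
    using T.harm_series_uniform_limit[OF assms] by (rule uniformly_convergentI)
  then show "uniformly_convergent_on UNIV (\<lambda>n x. \<Sum>i<n. harm_block harm_theta_fun c i (x, \<phi>))"
    unfolding uniformly_convergent_on_def uniform_limit_iff by (elim exE) (rule exI, force elim:
        eventually_mono)
  show "summable (\<lambda>n. harm_block harm_fun c n (\<theta>, \<phi>))"
    using H.harm_series_sums[OF assms] by (rule sums_summable)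
qed auto

lemma harm_series_harm_fun_deriv_phi:
  assumes "coeff_decay c K"
  shows "((\<lambda>t. harm_series harm_fun c (\<theta>, t)) has_real_derivative harm_series harm_dphi_fun c (\<theta>,
      \<phi>)) (at \<phi>)"
  unfolding harm_series_def
proof (rule has_field_derivative_series'(2)[of UNIV])
  show "((\<lambda>t. harm_block harm_fun c n (\<theta>, t)) has_real_derivative harm_block harm_dphi_fun c n (\<theta>,
      x)) (at x within UNIV)" for n x
    unfolding harm_block_def harm_fun_def harm_dphi_fun_def harm_phi_fun_def by (auto intro!:
        derivative_eq_intros harm_deriv_phi simp: mult_ac)
  have "uniformly_convergent_on UNIV (\<lambda>n p. \<Sum>i<n. harm_block harm_dphi_fun c i p)"
    using P.harm_series_uniform_limit[OF assms] by (rule uniformly_convergentI)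
  then show "uniformly_convergent_on UNIV (\<lambda>n x. \<Sum>i<n. harm_block harm_dphi_fun c i (\<theta>, x))"
    unfolding uniformly_convergent_on_def uniform_limit_iff by (elim exE) (rule exI, force elim:
        eventually_mono)
  show "summable (\<lambda>n. harm_block harm_fun c n (\<theta>, \<phi>))"
    using H.harm_series_sums[OF assms] by (rule sums_summable)
qed auto

text \<open>With a single order per degree, the block is at most K n^-4 times 2 n^(5/2), which again
  has the exponent -3/2. The extracted factor \<open>sin \<theta>\<close> is what permits absorption
  in \<open>steady_poisson_estimate\<close>.\<close>

lemma harm_series_zonal_bound:
  assumes "coeff_decay c K" "\<And>n m. m \<noteq> 0 \<Longrightarrow> c n m = 0"
  shows "\<bar>harm_series harm_theta_fun c p\<bar> \<le> \<bar>sin (fst p)\<bar> * (2 * K * (\<Sum>n. real n powr (- (3 / 2))))"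
proof -
  have b: "harm_block harm_theta_fun c n p = c n 0 * (sin (fst p) * harm_zonal n (fst p))" for n
  proof -
    have "harm_block harm_theta_fun c n p = (\<Sum>m\<in>{- int n..int n}. if m = 0 then c n 0 *
        harm_theta_fun n 0 p else 0)"
      unfolding harm_block_def by (intro sum.cong) (auto simp: assms(2))
    then show ?thesis by (simp add: sum.delta harm_theta_fun_def harm_theta_zonal)
  qed
  have le: "norm (harm_block harm_theta_fun c n p) \<le> \<bar>sin (fst p)\<bar> * (2 * K) * real n powr (- (3 /
      2))" for n
  proof (cases "n = 0")
    case False
    have "\<bar>c n 0\<bar> * \<bar>harm_zonal n (fst p)\<bar> \<le> K / real n ^ 4 * (2 * real n powr (5 / 2))"
      using assms(1) False by (intro mult_mono abs_harm_zonal_le) (auto simp: coeff_decay_def)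
    also have "\<dots> = 2 * K * (real n powr (5 / 2) / real n ^ 4)" by simp
    also have "real n powr (5 / 2) / real n ^ 4 = real n powr (- (3 / 2))"
      using False by (subst powr_quotient_4) auto
    finally have "\<bar>sin (fst p)\<bar> * (\<bar>c n 0\<bar> * \<bar>harm_zonal n (fst p)\<bar>) \<le> \<bar>sin (fst p)\<bar> * (2 * K *
        real n powr (- (3 / 2)))"
      by (rule mult_left_mono) simp
    then show ?thesis unfolding b by (simp add: abs_mult mult_ac)
  qed (simp add: harm_block_def harm_theta_fun_0)
  have "norm (harm_series harm_theta_fun c p) \<le> (\<Sum>n. \<bar>sin (fst p)\<bar> * (2 * K) * real n powr (- (3 /
      2)))"
    unfolding harm_series_def by (rule norm_suminf_le[OF le]) (intro summable_mult summable_32)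
  then show ?thesis by (simp add: suminf_mult summable_32 mult_ac)
qed

section \<open>Completeness\<close>

lemma continuous_on_sph [continuous_intros]:
  fixes f g :: "'a :: t2_space \<Rightarrow> real"
  assumes "continuous_on S f" "continuous_on S g"
  shows "continuous_on S (\<lambda>x. sph (f x) (g x))"
  unfolding continuous_on_componentwise[of S "\<lambda>x. sph (f x) (g x)"]
  by (auto simp: Basis_vec_def inner_axis sph_def UNIV_3 intro!: continuous_intros assms)

lemma continuous_on_sph_compose:
  assumes "continuous_on (sphere 0 1) f"
  shows "continuous_on A (\<lambda>p. f (sph (fst p) (snd p)))"
  by (rule continuous_on_compose2[OF assms]) (use sph_in_sphere in \<open>auto intro!: continuous_intros\<close>)

lemma continuous_on_sph_harm: "continuous_on A (sph_harm n m)"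
proof -
  have "continuous_on A (\<lambda>x :: real^3. Complex (x $ 1) (x $ 2))"
    unfolding Complex_eq by (intro continuous_intros)
  then have "continuous_on A (\<lambda>x :: real^3. Complex (x $ 1) (x $ 2) ^ k)" for k
    by (intro continuous_intros)
  then have "continuous_on A (\<lambda>x :: real^3. Re (Complex (x $ 1) (x $ 2) ^ k))"
    "continuous_on A (\<lambda>x :: real^3. Im (Complex (x $ 1) (x $ 2) ^ k))" for k
    by (intro continuous_intros; assumption)+
  then show ?thesis
    unfolding sph_harm_def[abs_def] Let_def
    by (cases "0 \<le> m") (auto intro!: continuous_intros)
qed

lemma sph_inner_eq_sph_ip:
  assumes "continuous_on (sphere 0 1) f" "continuous_on (sphere 0 1) g"
  shows "sph_inner f g = sph_ip (\<lambda>p. f (sph (fst p) (snd p))) (\<lambda>p. g (sph (fst p) (snd p)))"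
proof -
  let ?h = "\<lambda>p. f (sph (fst p) (snd p)) * g (sph (fst p) (snd p)) * sin (fst p)"
  have "continuous_on (sphere 0 1) (\<lambda>x. f x * g x)"
    by (intro continuous_intros assms)
  then have "sph_inner f g = (LINT p:{0..pi} \<times> {0..2 * pi}|lborel. ?h p)"
    unfolding sph_inner_def
    by (subst integral_sphere_measure) (simp_all add: borel_measurable_continuous_on_restrict
        case_prod_unfold)
  also have "{0..pi} \<times> {0..2 * pi} = sph_box"
    by (auto simp: sph_box_def cbox_Pair_eq)
  also have "(LINT p:sph_box|lborel. ?h p) = integral sph_box ?h"
  proof (rule set_borel_integral_eq_integral(2))
    show "set_integrable lborel sph_box ?h"
      unfolding set_integrable_def
      by (intro borel_integrable_compact compact_sph_box continuous_intros
          continuous_on_sph_compose assms)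
  qed
  finally show ?thesis by (simp add: sph_ip_def)
qed

lemma sph_coeff_eq_sph_ip:
  assumes "continuous_on (sphere 0 1) f"
  shows "sph_coeff f n m = sph_ip (\<lambda>p. f (sph (fst p) (snd p))) (harm_fun n m)"
  unfolding sph_coeff_def sph_inner_eq_sph_ip[OF assms continuous_on_sph_harm]
  by (simp add: sph_harm_harm harm_fun_def[abs_def])

text \<open>The restrictions of polynomials to the sphere, written in the coordinates \<open>(\<theta>, \<phi>)\<close>.\<close>
inductive sph_poly :: "(real \<times> real \<Rightarrow> real) \<Rightarrow> bool" where
  cos: "sph_poly (\<lambda>p. sin (fst p) ^ k * poly q (cos (fst p)) * cos (real k * snd p))"
| sin: "sph_poly (\<lambda>p. sin (fst p) ^ k * poly q (cos (fst p)) * sin (real k * snd p))"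
| add: "sph_poly f \<Longrightarrow> sph_poly g \<Longrightarrow> sph_poly (\<lambda>p. f p + g p)"
| scale: "sph_poly f \<Longrightarrow> sph_poly (\<lambda>p. c * f p)"

lemma sph_poly_continuous: "sph_poly f \<Longrightarrow> continuous_on A f"
  by (induction rule: sph_poly.induct) (intro continuous_intros continuous_on_poly; assumption)+

lemma sph_poly_diff: "sph_poly f \<Longrightarrow> sph_poly g \<Longrightarrow> sph_poly (\<lambda>p. f p - g p)"
  using sph_poly.add[OF _ sph_poly.scale[of g "-1"], of f] by simp

lemma sph_poly_sum: "finite A \<Longrightarrow> (\<And>i. i \<in> A \<Longrightarrow> sph_poly (f i)) \<Longrightarrow> sph_poly (\<lambda>p. \<Sum>i\<in>A. f i p)"
proof (induction A rule: finite_induct)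
  case empty
  then show ?case using sph_poly.scale[OF sph_poly.cos, of 0] by simp
qed (simp add: sph_poly.add)

lemma sph_poly_harm_fun: "sph_poly (harm_fun n m)"
proof (cases "0 \<le> m")
  case True
  have "sph_poly (\<lambda>p. harm_factor n m * (sin (fst p) ^ nat \<bar>m\<bar> * poly ((pderiv ^^ nat \<bar>m\<bar>)
      (legendre n)) (cos (fst p)) * cos (real (nat \<bar>m\<bar>) * snd p)))"
    by (intro sph_poly.scale sph_poly.cos)
  then show ?thesis using True
    by (simp add: harm_fun_def[abs_def] harm_def assoc_leg_def dlegendre_def azimuthal_def
        mult.assoc)
next
  case False
  have "sph_poly (\<lambda>p. harm_factor n m * (sin (fst p) ^ nat \<bar>m\<bar> * poly ((pderiv ^^ nat \<bar>m\<bar>)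
      (legendre n)) (cos (fst p)) * sin (real (nat \<bar>m\<bar>) * snd p)))"
    by (intro sph_poly.scale sph_poly.sin)
  then show ?thesis using False
    by (simp add: harm_fun_def[abs_def] harm_def assoc_leg_def dlegendre_def azimuthal_def
        mult.assoc)
qed

lemma sph_poly_harm_block: "sph_poly (harm_block harm_fun c n)"
  unfolding harm_block_def[abs_def] real_scaleR_def by (intro sph_poly_sum sph_poly.scale
      sph_poly_harm_fun) simp

lemma sph_poly_mult_z: "sph_poly f \<Longrightarrow> sph_poly (\<lambda>p. f p * cos (fst p))"
proof (induction rule: sph_poly.induct)
  case (cos k q)
  show ?case using sph_poly.cos[of k "[:0, 1:] * q"] by (simp add: mult_ac)
next
  case (sin k q)
  show ?case using sph_poly.sin[of k "[:0, 1:] * q"] by (simp add: mult_ac)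
next
  case (add f g)
  then show ?case using sph_poly.add by (simp add: distrib_right)
next
  case (scale f c)
  then show ?case using sph_poly.scale by (simp add: mult.assoc)
qed

lemma sin_pow_reduce:
  fixes x :: real
  shows "sin x ^ Suc (Suc k) = sin x ^ k * poly [:1, 0, -1:] (cos x)"
  using sin_squared_eq[of x] by (simp add: power2_eq_square mult_ac)

text \<open>The product formula splits frequency k into k + 1 and k - 1. At the lower frequency the
  power of the sine is too large by two, and sin^2 = 1 - cos^2 moves the excess into the polynomial
  factor.\<close>

lemma sph_poly_mult_x: "sph_poly f \<Longrightarrow> sph_poly (\<lambda>p. f p * (sin (fst p) * cos (snd p)))"
proof (induction rule: sph_poly.induct)
  case (cos k q)
  show ?case
  proof (cases k)
    case 0
    then show ?thesis using sph_poly.cos[of 1 q] by (simp add: mult_ac)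
  next
    case (Suc j)
    have "sin (fst p) ^ k * poly q (cos (fst p)) * cos (real k * snd p) * (sin (fst p) * cos (snd
        p))
      = 1 / 2 * (sin (fst p) ^ Suc k * poly q (cos (fst p)) * cos (real (Suc k) * snd p)
        + sin (fst p) ^ j * poly ([:1, 0, -1:] * q) (cos (fst p)) * cos (real j * snd p))" for p
    proof -
      have "cos (real k * snd p) * cos (snd p) = 1 / 2 * (cos (real (Suc k) * snd p) + cos (real j
          * snd p))"
        unfolding Suc using cos_times_cos[of "real (Suc j) * snd p" "snd p"] by (simp add:
            algebra_simps)
      then have "sin (fst p) ^ k * poly q (cos (fst p)) * cos (real k * snd p) * (sin (fst p) * cos
          (snd p))
        = sin (fst p) ^ Suc k * poly q (cos (fst p)) * (1 / 2 * (cos (real (Suc k) * snd p) + cos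
            (real j * snd p)))"
        by simp
      also have "\<dots> = 1 / 2 * (sin (fst p) ^ Suc k * poly q (cos (fst p)) * cos (real (Suc k) * snd
          p)
         + sin (fst p) ^ Suc (Suc j) * poly q (cos (fst p)) * cos (real j * snd p))"
        by (simp add: Suc algebra_simps)
      finally show ?thesis by (simp only: sin_pow_reduce poly_mult mult.assoc)
    qed
    then show ?thesis by (simp only: sph_poly.intros)
  qed
next
  case (sin k q)
  show ?case
  proof (cases k)
    case 0
    then show ?thesis using sph_poly.sin[of 0 q] by simp
  next
    case (Suc j)
    have "sin (fst p) ^ k * poly q (cos (fst p)) * sin (real k * snd p) * (sin (fst p) * cos (snd
        p))
      = 1 / 2 * (sin (fst p) ^ Suc k * poly q (cos (fst p)) * sin (real (Suc k) * snd p)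
        + sin (fst p) ^ j * poly ([:1, 0, -1:] * q) (cos (fst p)) * sin (real j * snd p))" for p
    proof -
      have "sin (real k * snd p) * cos (snd p) = 1 / 2 * (sin (real (Suc k) * snd p) + sin (real j
          * snd p))"
        unfolding Suc using sin_times_cos[of "real (Suc j) * snd p" "snd p"] by (simp add:
            algebra_simps)
      then have "sin (fst p) ^ k * poly q (cos (fst p)) * sin (real k * snd p) * (sin (fst p) * cos
          (snd p))
        = sin (fst p) ^ Suc k * poly q (cos (fst p)) * (1 / 2 * (sin (real (Suc k) * snd p) + sin
            (real j * snd p)))"
        by simp
      also have "\<dots> = 1 / 2 * (sin (fst p) ^ Suc k * poly q (cos (fst p)) * sin (real (Suc k) * snd
          p)
         + sin (fst p) ^ Suc (Suc j) * poly q (cos (fst p)) * sin (real j * snd p))"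
        by (simp add: Suc algebra_simps)
      finally show ?thesis by (simp only: sin_pow_reduce poly_mult mult.assoc)
    qed
    then show ?thesis by (simp only: sph_poly.intros)
  qed
next
  case (add f g)
  then show ?case using sph_poly.add by (simp add: distrib_right)
next
  case (scale f c)
  then show ?case using sph_poly.scale by (simp add: mult.assoc)
qed

lemma sph_poly_mult_y: "sph_poly f \<Longrightarrow> sph_poly (\<lambda>p. f p * (sin (fst p) * sin (snd p)))"
proof (induction rule: sph_poly.induct)
  case (cos k q)
  show ?case
  proof (cases k)
    case 0
    then show ?thesis using sph_poly.sin[of 1 q] by (simp add: mult_ac)
  next
    case (Suc j)
    have "sin (fst p) ^ k * poly q (cos (fst p)) * cos (real k * snd p) * (sin (fst p) * sin (snd
        p))
      = 1 / 2 * (sin (fst p) ^ Suc k * poly q (cos (fst p)) * sin (real (Suc k) * snd p)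
        - sin (fst p) ^ j * poly ([:1, 0, -1:] * q) (cos (fst p)) * sin (real j * snd p))" for p
    proof -
      have "cos (real k * snd p) * sin (snd p) = 1 / 2 * (sin (real (Suc k) * snd p) - sin (real j
          * snd p))"
        unfolding Suc using cos_times_sin[of "real (Suc j) * snd p" "snd p"] by (simp add:
            algebra_simps)
      then have "sin (fst p) ^ k * poly q (cos (fst p)) * cos (real k * snd p) * (sin (fst p) * sin
          (snd p))
        = sin (fst p) ^ Suc k * poly q (cos (fst p)) * (1 / 2 * (sin (real (Suc k) * snd p) - sin
            (real j * snd p)))"
        by simp
      also have "\<dots> = 1 / 2 * (sin (fst p) ^ Suc k * poly q (cos (fst p)) * sin (real (Suc k) * snd
          p)
         - sin (fst p) ^ Suc (Suc j) * poly q (cos (fst p)) * sin (real j * snd p))"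
        by (simp add: Suc algebra_simps)
      finally show ?thesis by (simp only: sin_pow_reduce poly_mult mult.assoc)
    qed
    then show ?thesis by (simp only: sph_poly.intros sph_poly_diff)
  qed
next
  case (sin k q)
  show ?case
  proof (cases k)
    case 0
    then show ?thesis using sph_poly.sin[of 0 q] by simp
  next
    case (Suc j)
    have "sin (fst p) ^ k * poly q (cos (fst p)) * sin (real k * snd p) * (sin (fst p) * sin (snd
        p))
      = 1 / 2 * (sin (fst p) ^ j * poly ([:1, 0, -1:] * q) (cos (fst p)) * cos (real j * snd p)
        - sin (fst p) ^ Suc k * poly q (cos (fst p)) * cos (real (Suc k) * snd p))" for p
    proof -
      have "sin (real k * snd p) * sin (snd p) = 1 / 2 * (cos (real j * snd p) - cos (real (Suc k)
          * snd p))"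
        unfolding Suc using sin_times_sin[of "real (Suc j) * snd p" "snd p"] by (simp add:
            algebra_simps)
      then have "sin (fst p) ^ k * poly q (cos (fst p)) * sin (real k * snd p) * (sin (fst p) * sin
          (snd p))
        = sin (fst p) ^ Suc k * poly q (cos (fst p)) * (1 / 2 * (cos (real j * snd p) - cos (real
            (Suc k) * snd p)))"
        by simp
      also have "\<dots> = 1 / 2 * (sin (fst p) ^ Suc (Suc j) * poly q (cos (fst p)) * cos (real j * snd
          p)
         - sin (fst p) ^ Suc k * poly q (cos (fst p)) * cos (real (Suc k) * snd p))"
        by (simp add: Suc algebra_simps)
      finally show ?thesis by (simp only: sin_pow_reduce poly_mult mult.assoc)
    qed
    then show ?thesis by (simp only: sph_poly.intros sph_poly_diff)
  qed
next
  case (add f g)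
  then show ?case using sph_poly.add by (simp add: distrib_right)
next
  case (scale f c)
  then show ?case using sph_poly.scale by (simp add: mult.assoc)
qed

text \<open>The induction runs over the multiplier with \<open>f\<close> arbitrary, so that a
  product of multipliers is applied one factor after the other and only multiplication by the three
  coordinates has to be computed.\<close>

lemma sph_poly_mult_polynomial:
  fixes g :: "real^3 \<Rightarrow> real"
  assumes "real_polynomial_function g" "sph_poly f"
  shows "sph_poly (\<lambda>p. f p * g (sph (fst p) (snd p)))"
  using assms
proof (induction g arbitrary: f rule: real_polynomial_function.induct)
  case (linear h)
  have h: "h x = x $ 1 * h (axis 1 1) + x $ 2 * h (axis 2 1) + x $ 3 * h (axis 3 1)" for x
  proof -
    interpret bounded_linear h by fact
    have "h x = h (\<Sum>i\<in>UNIV. x $ i *\<^sub>R axis i 1)"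
      using basis_expansion[of x] by (simp add: scalar_mult_eq_scaleR)
    also have "\<dots> = (\<Sum>i\<in>UNIV. x $ i * h (axis i 1))"
      by (simp add: sum scaleR)
    finally show ?thesis by (simp add: sum_3)
  qed
  have "sph_poly (\<lambda>p. (h (axis 1 1) * (f p * (sin (fst p) * cos (snd p))) + h (axis 2 1) * (f p *
      (sin (fst p) * sin (snd p))))
      + h (axis 3 1) * (f p * cos (fst p)))"
    by (intro sph_poly.add sph_poly.scale sph_poly_mult_x sph_poly_mult_y sph_poly_mult_z
        linear.prems)
  then show ?case
    by (subst h) (simp add: sph_def algebra_simps)
next
  case (const c)
  then show ?case using sph_poly.scale[of f c] by (simp add: mult.commute)
next
  case (add g g')
  then show ?case using sph_poly.add by (simp add: distrib_left)
next
  case (mult g g')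
  then show ?case by (simp add: mult.assoc[symmetric])
qed

lemma sph_poly_polynomial:
  assumes "real_polynomial_function g"
  shows "sph_poly (\<lambda>p. g (sph (fst p) (snd p)))"
  using sph_poly_mult_polynomial[OF assms sph_poly.cos[of 0 1]] by simp

text \<open>A sequence with one polynomial of every degree spans all polynomials: a multiple of the
  member of matching degree cancels the leading coefficient.\<close>

lemma poly_degree_induct:
  fixes b :: "nat \<Rightarrow> real poly"
  assumes b: "\<And>j. degree (b j) = j" "\<And>j. b j \<noteq> 0" "\<And>j. P (b j)"
    and P: "\<And>p q. P p \<Longrightarrow> P q \<Longrightarrow> P (p + q)" "\<And>c p. P p \<Longrightarrow> P (smult c p)"
  shows "P q"
proof (induction "degree q" arbitrary: q rule: less_induct)
  case less
  have P0: "P 0" using P(2)[OF b(3)[of 0], of 0] by simp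
  define d where "d = degree q"
  define c where "c = lead_coeff q / lead_coeff (b d)"
  define r where "r = q - smult c (b d)"
  have q: "q = r + smult c (b d)" by (simp add: r_def)
  have "coeff r d = 0"
    using b(1)[of d] b(2)[of d] leading_coeff_0_iff[of "b d"] by (simp add: r_def c_def d_def)
  moreover have "degree r \<le> d"
    unfolding r_def by (rule degree_diff_le) (simp_all add: d_def b(1) degree_smult_eq)
  ultimately have "r = 0 \<or> degree r < d"
    by (metis le_neq_implies_less leading_coeff_0_iff)
  then have "P r" using less P0 by (auto simp: d_def)
  then show ?case by (subst q) (intro P b)
qed

text \<open>For a fixed order, the derivatives of Legendre polynomials that occur in the harmonics
  have every degree exactly once, so the harmonics span all functions of \<open>sph_poly\<close>
  with that order.\<close>

lemma orthogonal_sph_poly: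
  assumes "sph_poly f" and d: "continuous_on sph_box d"
    and orth: "\<And>n m. \<bar>m\<bar> \<le> int n \<Longrightarrow> sph_ip d (harm_fun n m) = 0"
  shows "sph_ip d f = 0"
proof -
  have gen: "sph_ip d (\<lambda>p. sin (fst p) ^ nat \<bar>m\<bar> * poly q (cos (fst p)) * azimuthal m (snd p)) = 0"
      for m q
  proof (rule poly_degree_induct[where b = "\<lambda>j. (pderiv ^^ nat \<bar>m\<bar>) (legendre (j + nat \<bar>m\<bar>))" and q
      = q])
    let ?e = "\<lambda>q p. sin (fst p) ^ nat \<bar>m\<bar> * poly q (cos (fst p)) * azimuthal m (snd p)"
    have e: "continuous_on sph_box (?e q)" for q by (intro continuous_intros continuous_on_poly)
    show deg: "degree ((pderiv ^^ nat \<bar>m\<bar>) (legendre (j + nat \<bar>m\<bar>))) = j" for j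
      by (simp add: degree_legendre)
    \<comment> \<open>The zero polynomial also has degree 0, so nonvanishing is a separate matter;
      it follows from the nonzero norm.\<close>
    show "(pderiv ^^ nat \<bar>m\<bar>) (legendre (j + nat \<bar>m\<bar>)) \<noteq> 0" for j
    proof
      assume z: "(pderiv ^^ nat \<bar>m\<bar>) (legendre (j + nat \<bar>m\<bar>)) = 0"
      then have "assoc_leg (j + nat \<bar>m\<bar>) (nat \<bar>m\<bar>) = (\<lambda>_. 0)" by (simp add: assoc_leg_def[abs_def]
          dlegendre_def)
      then have "radial_int (nat \<bar>m\<bar>) (j + nat \<bar>m\<bar>) (j + nat \<bar>m\<bar>) = 0" by (simp add: radial_int_def)
      then show False using harm_norm_radial_int[of "nat \<bar>m\<bar>" "j + nat \<bar>m\<bar>"] by simp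
    qed
    show "sph_ip d (?e ((pderiv ^^ nat \<bar>m\<bar>) (legendre (j + nat \<bar>m\<bar>)))) = 0" for j
    proof -
      let ?N = "harm_factor (j + nat \<bar>m\<bar>) m"
      have "?N * sph_ip d (?e ((pderiv ^^ nat \<bar>m\<bar>) (legendre (j + nat \<bar>m\<bar>)))) = sph_ip d (harm_fun
          (j + nat \<bar>m\<bar>) m)"
        using sph_ip_scaleR_left[of ?N "?e ((pderiv ^^ nat \<bar>m\<bar>) (legendre (j + nat \<bar>m\<bar>)))" d]
        by (simp add: sph_ip_commute harm_fun_def[abs_def] harm_def assoc_leg_def dlegendre_def
            mult.assoc)
      also have "\<dots> = 0" by (rule orth) simp
      finally show ?thesis using harm_norm_pos[of "j + nat \<bar>m\<bar>" "nat \<bar>m\<bar>"] by (simp add: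
          harm_factor_def split: if_splits)
    qed
    show "sph_ip d (?e (q + q')) = 0" if "sph_ip d (?e q) = 0" "sph_ip d (?e q') = 0" for q q'
      using sph_ip_add_left[OF e[of q] e[of q'] d] that by (simp add: sph_ip_commute algebra_simps)
    show "sph_ip d (?e (smult c q)) = 0" if "sph_ip d (?e q) = 0" for c q
      using sph_ip_scaleR_left[of c "?e q" d] that by (simp add: sph_ip_commute mult_ac)
  qed
  show ?thesis
    using assms(1)
  proof (induction rule: sph_poly.induct)
    case (cos k q)
    show ?case using gen[of "int k" q] by (simp add: azimuthal_def)
  next
    case (sin k q)
    show ?case
    \<comment> \<open>The sine of frequency 0 vanishes identically, and the order 0 encodes the
      cosine.\<close>
    proof (cases "k = 0")
      case True
      then show ?thesis by (simp add: sph_ip_def)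
    next
      case False
      then show ?thesis using gen[of "- int k" q] by (simp add: azimuthal_def)
    qed
  next
    case (add f g)
    then show ?case
      using sph_ip_add_left[OF sph_poly_continuous[OF add.hyps(1)] sph_poly_continuous[OF
          add.hyps(2)] d]
      by (simp add: sph_ip_commute)
  next
    case (scale f c)
    then show ?case using sph_ip_scaleR_left[of c f d] by (simp add: sph_ip_commute)
  qed
qed

text \<open>The difference d of the function and its series is continuous and orthogonal to every
  harmonic. By Stone-Weierstrass it is a uniform limit of functions of \<open>sph_poly\<close>, all
  orthogonal to d, so the inner product of d with itself is zero.\<close>

lemma harm_series_harm_fun_eq:
  assumes f: "continuous_on (sphere 0 1) f"
    and c: "\<And>n m. \<bar>m\<bar> \<le> int n \<Longrightarrow> c n m = sph_coeff f n m" and "coeff_decay c K"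
    and "0 < \<theta>" "\<theta> < pi"
  shows "f (sph \<theta> \<phi>) = harm_series harm_fun c (\<theta>, \<phi>)"
proof -
  let ?f = "\<lambda>p. f (sph (fst p) (snd p))"
  define d where "d = (\<lambda>p. ?f p - harm_series harm_fun c p)"
  have fc: "continuous_on A ?f" for A by (rule continuous_on_sph_compose[OF f])
  have sc: "continuous_on A (harm_series harm_fun c)" for A by (rule H.harm_series_cont[OF
      \<open>coeff_decay c K\<close>])
  have d: "continuous_on sph_box d" unfolding d_def by (intro continuous_intros fc sc)
  have orth: "sph_ip d (harm_fun n m) = 0" if "\<bar>m\<bar> \<le> int n" for n m
    unfolding d_def
    using sph_ip_diff_left[OF fc sc H.cont] H.harm_series_coeff[OF \<open>coeff_decay c K\<close> that]
        sph_coeff_eq_sph_ip[OF f] c[OF that]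
    by simp
  have "\<exists>g. real_polynomial_function g \<and> (\<forall>x\<in>sphere 0 1. \<bar>f x - g x\<bar> < inverse (real (Suc n)))" for
      n
    by (rule Stone_Weierstrass_real_polynomial_function[OF compact_sphere f, of "inverse (real (Suc
        n))"]) auto
  then obtain g where g: "\<And>n. real_polynomial_function (g n)"
    "\<And>n x. x \<in> sphere 0 1 \<Longrightarrow> \<bar>f x - g n x\<bar> < inverse (real (Suc n))"
    by metis
  have ug: "uniform_limit sph_box (\<lambda>n p. g n (sph (fst p) (snd p))) ?f sequentially"
  proof (rule uniform_limitI)
    fix e :: real assume "0 < e"
    have "\<forall>\<^sub>F n in sequentially. inverse (real (Suc n)) < e"
      using LIMSEQ_inverse_real_of_nat \<open>0 < e\<close> by (rule order_tendstoD)
    then show "\<forall>\<^sub>F n in sequentially. \<forall>p\<in>sph_box. dist (g n (sph (fst p) (snd p))) (?f p) < e"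
    proof (rule eventually_mono, intro ballI)
      fix n p assume "inverse (real (Suc n)) < e"
      then show "dist (g n (sph (fst p) (snd p))) (?f p) < e"
        using g(2)[OF sph_in_sphere, of "fst p" "snd p" n] by (simp add: dist_real_def
            abs_minus_commute)
    qed
  qed
  define h where "h = (\<lambda>n p. g n (sph (fst p) (snd p)) - (\<Sum>i<n. harm_block harm_fun c i p))"
  have hV: "sph_poly (h n)" for n
    unfolding h_def by (intro sph_poly_diff sph_poly_polynomial g sph_poly_sum sph_poly_harm_block)
        simp
  have "uniform_limit sph_box h d sequentially"
    unfolding h_def d_def by (intro uniform_limit_intros ug H.harm_series_uniform_limit[OF
        \<open>coeff_decay c K\<close>])
  then have "(\<lambda>n. sph_ip d (h n)) \<longlonglongrightarrow> sph_ip d d"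
    by (rule sph_ip_tendsto[OF uniform_limit_const]) (simp_all add: d sph_poly_continuous[OF hV])
  then have "sph_ip d d = 0"
    using orthogonal_sph_poly[OF hV d orth] by (simp add: LIMSEQ_const_iff)
  then have z: "d (\<theta>, y) = 0" if "0 \<le> y" "y \<le> 2 * pi" for y
    using that assms by (intro sph_ip_self_eq_0[OF d]) auto
  \<comment> \<open>The vanishing is known for longitudes in one period; both sides are periodic, so
    \<phi> is shifted there.\<close>
  define j where "j = \<lfloor>\<phi> / (2 * pi)\<rfloor>"
  define y where "y = \<phi> + 2 * pi * of_int (- j)"
  have "of_int j * (2 * pi) \<le> \<phi>"
    unfolding j_def by (subst pos_le_divide_eq[symmetric]) simp_all
  moreover have "\<phi> < (of_int j + 1) * (2 * pi)"
    unfolding j_def by (subst pos_divide_less_eq[symmetric]) simp_all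
  ultimately have "0 \<le> y" "y \<le> 2 * pi"
    by (simp_all add: y_def algebra_simps)
  then have "d (\<theta>, y) = 0" by (rule z)
  moreover have "sph \<theta> y = sph \<theta> \<phi>"
    using sin.plus_of_int[of \<phi> "- j"] cos.plus_of_int[of \<phi> "- j"] by (simp add: sph_def y_def
        mult_ac)
  moreover have "harm_fun n m (\<theta>, y) = harm_fun n m (\<theta>, \<phi>)" for n m
    unfolding y_def harm_fun_def harm_def by (simp only: azimuthal_periodic fst_conv snd_conv)
  then have "harm_series harm_fun c (\<theta>, y) = harm_series harm_fun c (\<theta>, \<phi>)" by (simp add:
      harm_series_def harm_block_def)
  ultimately show ?thesis by (simp add: d_def)
qed

section \<open>The Laplacian and spherical harmonic coefficients\<close>

lemma Ck_sphere_Suc_continuous: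
  assumes "Ck_sphere (Suc k) f"
  shows "continuous_on (sphere 0 1) f"
proof -
  let ?g = "\<lambda>x. f (x /\<^sub>R norm x)"
  have "?g differentiable (at x)" if "x \<noteq> 0" for x
    using assms that by (simp add: Ck_sphere_def)
  moreover have "x \<noteq> 0" if "x \<in> sphere 0 1" for x :: "real^3"
    using that by auto
  ultimately have "continuous_on (sphere 0 1) ?g"
    by (intro continuous_at_imp_continuous_on ballI differentiable_imp_continuous_within) blast
  then show ?thesis
    by (rule continuous_on_cong[THEN iffD1, rotated 2]) auto
qed

lemma has_real_derivative_along_curve:
  fixes f :: "'a::euclidean_space \<Rightarrow> real"
  assumes "f differentiable (at (\<gamma> t))" "(\<gamma> has_vector_derivative v) (at t)"
  shows "((\<lambda>t. f (\<gamma> t)) has_real_derivative (\<Sum>b\<in>Basis. (v \<bullet> b) * frechet_derivative f (at (\<gamma> t))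
      b)) (at t)"
proof -
  let ?D = "frechet_derivative f (at (\<gamma> t))"
  have D: "(f has_derivative ?D) (at (\<gamma> t))"
    using assms(1) by (simp add: frechet_derivative_works)
  then interpret D: bounded_linear ?D by (rule has_derivative_bounded_linear)
  have "((f \<circ> \<gamma>) has_vector_derivative ?D v) (at t)"
    by (rule vector_derivative_diff_chain_within[OF assms(2)]) (use D in \<open>auto intro:
        has_derivative_at_withinI\<close>)
  moreover have "?D v = (\<Sum>b\<in>Basis. (v \<bullet> b) * ?D b)"
    by (subst euclidean_representation[of v, symmetric]) (simp add: D.sum D.scaleR)
  ultimately show ?thesis
    by (simp add: has_real_derivative_iff_has_vector_derivative o_def)
qed

text \<open>The parameter \<open>s\<close> selects a curve, a meridian or a circle of latitude in
  the applications. Joint continuity in both variables is asked for with differentiation under the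
  integral sign in view.\<close>

lemma Ck_on_2_along_curves:
  fixes f :: "'a::euclidean_space \<Rightarrow> real" and \<gamma> :: "real \<Rightarrow> real \<Rightarrow> 'a"
  assumes f: "Ck_on 2 f (- {0})" and nz: "\<And>s t. \<gamma> s t \<noteq> 0"
    and d1: "\<And>s t. (\<gamma> s has_vector_derivative \<gamma>' s t) (at t)"
    and d2: "\<And>s t. (\<gamma>' s has_vector_derivative \<gamma>'' s t) (at t)"
    and c: "continuous_on UNIV (\<lambda>p. \<gamma> (fst p) (snd p))" "continuous_on UNIV (\<lambda>p. \<gamma>' (fst p) (snd
        p))"
      "continuous_on UNIV (\<lambda>p. \<gamma>'' (fst p) (snd p))"
  obtains F F' where "continuous_on UNIV (\<lambda>p. F (fst p) (snd p))" "continuous_on UNIV (\<lambda>p. F' (fst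
      p) (snd p))"
    "\<And>s t. ((\<lambda>t. f (\<gamma> s t)) has_real_derivative F s t) (at t)"
    "\<And>s t. (F s has_real_derivative F' s t) (at t)"
proof -
  define g where "g = (\<lambda>b x. frechet_derivative f (at x) b)"
  define h where "h = (\<lambda>b c x. frechet_derivative (g b) (at x) c)"
  have fd: "f differentiable (at x)" if "x \<noteq> 0" for x
    using f that by (simp add: eval_nat_numeral)
  have gd: "g b differentiable (at x)" if "x \<noteq> 0" "b \<in> Basis" for x b
    using f that by (simp add: eval_nat_numeral g_def)
  have hc: "continuous_on (- {0}) (h b c)" if "b \<in> Basis" "c \<in> Basis" for b c
    using f that by (simp add: eval_nat_numeral h_def g_def)
  have gc: "continuous_on (- {0}) (g b)" if "b \<in> Basis" for b
    using gd that by (intro continuous_at_imp_continuous_on ballI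
        differentiable_imp_continuous_within) auto
  define F where "F = (\<lambda>s t. \<Sum>b\<in>Basis. (\<gamma>' s t \<bullet> b) * g b (\<gamma> s t))"
  define F' where "F' = (\<lambda>s t. \<Sum>b\<in>Basis. (\<gamma>'' s t \<bullet> b) * g b (\<gamma> s t)
      + (\<gamma>' s t \<bullet> b) * (\<Sum>c\<in>Basis. (\<gamma>' s t \<bullet> c) * h b c (\<gamma> s t)))"
  show ?thesis
  proof
    have gc': "continuous_on UNIV (\<lambda>p. g b (\<gamma> (fst p) (snd p)))" if "b \<in> Basis" for b
      by (rule continuous_on_compose2[OF gc[OF that] c(1)]) (use nz in auto)
    have hc': "continuous_on UNIV (\<lambda>p. h b d (\<gamma> (fst p) (snd p)))" if "b \<in> Basis" "d \<in> Basis" for b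
        d
      by (rule continuous_on_compose2[OF hc[OF that] c(1)]) (use nz in auto)
    show "continuous_on UNIV (\<lambda>p. F (fst p) (snd p))" "continuous_on UNIV (\<lambda>p. F' (fst p) (snd p))"
      unfolding F_def F'_def by (intro continuous_intros gc' hc' c; assumption)+
    show "((\<lambda>t. f (\<gamma> s t)) has_real_derivative F s t) (at t)" for s t
      using has_real_derivative_along_curve[OF fd[OF nz] d1] by (simp add: F_def g_def)
    show "(F s has_real_derivative F' s t) (at t)" for s t
      unfolding F_def F'_def
    proof (rule DERIV_sum)
      fix b :: 'a assume b: "b \<in> Basis"
      have "((\<lambda>t. \<gamma>' s t \<bullet> b) has_real_derivative \<gamma>'' s t \<bullet> b) (at t)"
        using bounded_linear.has_vector_derivative[OF bounded_linear_inner_left d2]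
        by (simp add: has_real_derivative_iff_has_vector_derivative)
      moreover have "((\<lambda>t. g b (\<gamma> s t)) has_real_derivative (\<Sum>c\<in>Basis. (\<gamma>' s t \<bullet> c) * h b c (\<gamma> s
          t))) (at t)"
        using has_real_derivative_along_curve[OF gd[OF nz b] d1] by (simp add: h_def)
      ultimately show "((\<lambda>t. (\<gamma>' s t \<bullet> b) * g b (\<gamma> s t)) has_real_derivative
          (\<gamma>'' s t \<bullet> b) * g b (\<gamma> s t) + (\<gamma>' s t \<bullet> b) * (\<Sum>c\<in>Basis. (\<gamma>' s t \<bullet> c) * h b c (\<gamma> s t)))
              (at t)"
        by (auto intro!: derivative_eq_intros)
    qed
  qed
qed

lemma has_vector_derivative_e_theta:
  "((\<lambda>t. e_theta t \<phi>) has_vector_derivative - sph \<theta> \<phi>) (at \<theta>)"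
  unfolding has_vector_derivative_def has_derivative_componentwise_within[of "\<lambda>t. e_theta t \<phi>"]
  by (auto simp: Basis_vec_def inner_axis sph_def e_theta_def forall_3 UNIV_3
      intro!: derivative_eq_intros)

lemma has_vector_derivative_e_phi:
  "((\<lambda>p. sin \<theta> *\<^sub>R e_phi \<theta> p) has_vector_derivative
     sin \<theta> *\<^sub>R vector [- cos \<phi>, - sin \<phi>, 0]) (at \<phi>)"
  unfolding has_vector_derivative_def has_derivative_componentwise_within[of "\<lambda>p. sin \<theta> *\<^sub>R e_phi \<theta>
      p"]
  by (auto simp: Basis_vec_def inner_axis e_phi_def forall_3 UNIV_3
      intro!: derivative_eq_intros)

lemma Ck_sphere_2_partials:
  assumes "Ck_sphere 2 \<Psi>"
  obtains Ft Ftt Fp Fpp where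
    "continuous_on UNIV (\<lambda>p. Ft (fst p) (snd p))" "continuous_on UNIV (\<lambda>p. Ftt (fst p) (snd p))"
    "continuous_on UNIV (\<lambda>p. Fpp (fst p) (snd p))"
    "\<And>\<theta> \<phi>. ((\<lambda>t. \<Psi> (sph t \<phi>)) has_real_derivative Ft \<theta> \<phi>) (at \<theta>)"
    "\<And>\<theta> \<phi>. ((\<lambda>t. Ft t \<phi>) has_real_derivative Ftt \<theta> \<phi>) (at \<theta>)"
    "\<And>\<theta> \<phi>. ((\<lambda>p. \<Psi> (sph \<theta> p)) has_real_derivative Fp \<theta> \<phi>) (at \<phi>)"
    "\<And>\<theta> \<phi>. ((\<lambda>p. Fp \<theta> p) has_real_derivative Fpp \<theta> \<phi>) (at \<phi>)"
proof -
  define f where "f = (\<lambda>x. \<Psi> (x /\<^sub>R norm x))"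
  have f: "Ck_on 2 f (- {0})" using assms by (simp add: Ck_sphere_def f_def)
  have norm_sph: "norm (sph \<theta> \<phi>) = 1" for \<theta> \<phi> using sph_in_sphere[of \<theta> \<phi>] by simp
  then have fs: "f (sph \<theta> \<phi>) = \<Psi> (sph \<theta> \<phi>)" and nz: "sph \<theta> \<phi> \<noteq> 0" for \<theta> \<phi>
    by (simp_all add: f_def) (metis norm_zero zero_neq_one)
  have c_et: "continuous_on UNIV (\<lambda>p. e_theta (snd p) (fst p))"
    unfolding continuous_on_componentwise[of UNIV "\<lambda>p. e_theta (snd p) (fst p)"]
    by (auto simp: Basis_vec_def inner_axis e_theta_def UNIV_3 intro!: continuous_intros)
  have c_ep: "continuous_on UNIV (\<lambda>p. sin (fst p) *\<^sub>R e_phi (fst p) (snd p))"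
    unfolding continuous_on_componentwise[of UNIV "\<lambda>p. sin (fst p) *\<^sub>R e_phi (fst p) (snd p)"]
    by (auto simp: Basis_vec_def inner_axis e_phi_def UNIV_3 intro!: continuous_intros)
  have c_ep': "continuous_on UNIV (\<lambda>p. sin (fst p) *\<^sub>R (vector [- cos (snd p), - sin (snd p), 0] ::
      real^3))"
    unfolding continuous_on_componentwise[of UNIV "\<lambda>p. sin (fst p) *\<^sub>R (vector [- cos (snd p), -
        sin (snd p), 0] :: real^3)"]
    by (auto simp: Basis_vec_def inner_axis UNIV_3 intro!: continuous_intros)
  obtain F F' where F: "continuous_on UNIV (\<lambda>p. F (fst p) (snd p))" "continuous_on UNIV (\<lambda>p. F'
      (fst p) (snd p))"
    "\<And>s t. ((\<lambda>t. f (sph t s)) has_real_derivative F s t) (at t)"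
    "\<And>s t. (F s has_real_derivative F' s t) (at t)"
    by (rule Ck_on_2_along_curves[OF f, of "\<lambda>s t. sph t s" "\<lambda>s t. e_theta t s" "\<lambda>s t. - sph t s"])
       (auto intro!: nz has_vector_derivative_sph_theta has_vector_derivative_e_theta c_et
           continuous_intros)
  obtain G G' where G: "continuous_on UNIV (\<lambda>p. G (fst p) (snd p))" "continuous_on UNIV (\<lambda>p. G'
      (fst p) (snd p))"
    "\<And>s t. ((\<lambda>t. f (sph s t)) has_real_derivative G s t) (at t)"
    "\<And>s t. (G s has_real_derivative G' s t) (at t)"
    by (rule Ck_on_2_along_curves[OF f, of sph "\<lambda>s t. sin s *\<^sub>R e_phi s t" "\<lambda>s t. sin s *\<^sub>R vector
        [- cos t, - sin t, 0]"])
       (auto intro!: nz has_vector_derivative_sph_phi has_vector_derivative_e_phi c_ep c_ep'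
           continuous_intros)
  \<comment> \<open>On meridians the curve parameter is the longitude, so the arguments appear in
    reversed order.\<close>
  have swap: "continuous_on UNIV (\<lambda>p. H (snd p) (fst p))" if "continuous_on UNIV (\<lambda>p. H (fst p)
      (snd p))"
    for H :: "real \<Rightarrow> real \<Rightarrow> real"
    using continuous_on_compose2[OF that continuous_on_swap, of UNIV] by simp
  show ?thesis
    by (rule that[of "\<lambda>\<theta> \<phi>. F \<phi> \<theta>" "\<lambda>\<theta> \<phi>. F' \<phi> \<theta>" G' G])
       (use F G fs in \<open>auto intro: swap\<close>)
qed

text \<open>Green's second identity for \<Psi> and a harmonic, carried out one variable at a time
  because the Laplacian is available only off the poles. The longitude terms integrate to zero by
  periodicity, and the colatitude terms are the derivative of a flux that vanishes at both
  poles.\<close>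

lemma laplacian_coeff:
  assumes \<Psi>: "Ck_sphere 2 \<Psi>" and \<Omega>: "continuous_on (sphere 0 1) \<Omega>"
    and L: "\<And>\<theta> \<phi>. 0 < \<theta> \<Longrightarrow> \<theta> < pi \<Longrightarrow> sph_laplacian \<Psi> \<theta> \<phi> = \<Omega> (sph \<theta> \<phi>)"
  shows "sph_coeff \<Omega> n m = - (real n * (real n + 1)) * sph_coeff \<Psi> n m"
proof -
  obtain Ft Ftt Fp Fpp where
    c: "continuous_on UNIV (\<lambda>p. Ft (fst p) (snd p))" "continuous_on UNIV (\<lambda>p. Ftt (fst p) (snd p))"
      "continuous_on UNIV (\<lambda>p. Fpp (fst p) (snd p))"
    and Ft: "\<And>\<theta> \<phi>. ((\<lambda>t. \<Psi> (sph t \<phi>)) has_real_derivative Ft \<theta> \<phi>) (at \<theta>)"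
    and Ftt: "\<And>\<theta> \<phi>. ((\<lambda>t. Ft t \<phi>) has_real_derivative Ftt \<theta> \<phi>) (at \<theta>)"
    and Fp: "\<And>\<theta> \<phi>. ((\<lambda>p. \<Psi> (sph \<theta> p)) has_real_derivative Fp \<theta> \<phi>) (at \<phi>)"
    and Fpp: "\<And>\<theta> \<phi>. ((\<lambda>p. Fp \<theta> p) has_real_derivative Fpp \<theta> \<phi>) (at \<phi>)"
    by (rule Ck_sphere_2_partials[OF \<Psi>]) (rule that; assumption)
  let ?k = "nat \<bar>m\<bar>" and ?N = "real n * (real n + 1)"
  define F where "F = (\<lambda>\<theta> \<phi>. \<Psi> (sph \<theta> \<phi>))"
  define W where "W = (\<lambda>\<theta> \<phi>. \<Omega> (sph \<theta> \<phi>))"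
  define LY where "LY = (\<lambda>\<theta> \<phi>. harm_factor n m * ((real ?k)\<^sup>2 * assoc_leg_quot n ?k \<theta> - ?N * sin \<theta>
      * assoc_leg n ?k \<theta>) * azimuthal m \<phi>)"
  have cont_F: "continuous_on UNIV (\<lambda>p. F (fst p) (snd p))"
    unfolding F_def using \<Psi> by (intro continuous_on_sph_compose Ck_sphere_Suc_continuous[of 1])
        (simp add: eval_nat_numeral)
  have cont_W: "continuous_on UNIV (\<lambda>p. W (fst p) (snd p))"
    unfolding W_def by (intro continuous_on_sph_compose \<Omega>)
  have comp: "continuous_on A (\<lambda>x. H (u x) (v x))"
    if "continuous_on UNIV (\<lambda>p. H (fst p) (snd p))" "continuous_on A u" "continuous_on A v"
    for H :: "real \<Rightarrow> real \<Rightarrow> real" and u v :: "'z::t2_space \<Rightarrow> real" and A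
    using continuous_on_compose2[OF that(1) continuous_on_Pair[OF that(2,3)]] by simp
  have LYd: "((\<lambda>t. sin t * harm_theta n m t \<phi>) has_real_derivative LY \<theta> \<phi>) (at \<theta>)" for \<theta> \<phi>
  proof -
    have "((\<lambda>t. harm_factor n m * (sin t * dassoc_leg n ?k t) * azimuthal m \<phi>) has_real_derivative
        LY \<theta> \<phi>) (at \<theta>)"
      unfolding LY_def by (intro DERIV_cmult DERIV_cmult_right sin_dassoc_leg_deriv)
    then show ?thesis by (simp add: harm_theta_def mult_ac)
  qed
  define A1 where "A1 = (\<lambda>\<theta> \<phi>. (cos \<theta> * Ft \<theta> \<phi> + sin \<theta> * Ftt \<theta> \<phi>) * harm n m \<theta> \<phi> - F \<theta> \<phi> * LY \<theta> \<phi>)"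
  \<comment> \<open>The flux: \<open>sin \<theta>\<close> times the Wronskian of \<Psi> and the
    harmonic in the colatitude. \<open>A1\<close> is its derivative, and \<open>h\<close> is the
    integrand of the identity to be proved.\<close>
  define G where "G = (\<lambda>\<theta> \<phi>. (sin \<theta> * Ft \<theta> \<phi>) * harm n m \<theta> \<phi> - F \<theta> \<phi> * (sin \<theta> * harm_theta n m \<theta>
      \<phi>))"
  define h where "h = (\<lambda>\<theta> \<phi>. ((W \<theta> \<phi> + ?N * F \<theta> \<phi>) * harm n m \<theta> \<phi>) * sin \<theta>)"
  define r where "r = (\<lambda>\<theta>. integral {0..2 * pi} (G \<theta>))"
  have G_deriv: "((\<lambda>t. G t \<phi>) has_real_derivative A1 \<theta> \<phi>) (at \<theta>)" for \<theta> \<phi>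
    unfolding G_def A1_def F_def
    by (rule derivative_eq_intros Ft Ftt harm_deriv_theta LYd refl)+ (simp add: algebra_simps)
  have cont_G: "continuous_on A (G \<theta>)" for A \<theta>
    unfolding G_def by (intro continuous_intros comp[OF c(1)] comp[OF cont_F])
  have cont_h: "continuous_on A (\<lambda>p. h (fst p) (snd p))" for A
    unfolding h_def by (intro continuous_intros comp[OF cont_W] comp[OF cont_F])
  have r_deriv: "(r has_real_derivative integral {0..2 * pi} (A1 \<theta>)) (at \<theta>)" for \<theta>
  proof -
    have "((\<lambda>x. integral (cbox 0 (2 * pi)) (G x)) has_real_derivative integral (cbox 0 (2 * pi))
        (A1 \<theta>)) (at \<theta> within UNIV)"
    proof (rule leibniz_rule_field_derivative)
      show "continuous_on (UNIV \<times> cbox 0 (2 * pi)) (\<lambda>(x, t). A1 x t)"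
        unfolding A1_def LY_def case_prod_unfold
        by (intro continuous_intros comp[OF c(1)] comp[OF c(2)] comp[OF cont_F])
      show "G x integrable_on cbox 0 (2 * pi)" for x
        by (intro integrable_continuous cont_G)
    qed (use G_deriv in auto)
    then show ?thesis by (simp add: r_def[abs_def])
  qed
  have A1_h: "integral {0..2 * pi} (A1 \<theta>) = integral {0..2 * pi} (h \<theta>)" if \<theta>: "0 < \<theta>" "\<theta> < pi" for \<theta>
  proof -
    have s: "sin \<theta> \<noteq> 0" using sin_gt_zero[OF \<theta>] by simp
    have Yd: "((\<lambda>p. harm n m \<theta> p) has_real_derivative harm_dphi_fun n m (\<theta>, \<phi>)) (at \<phi>)" for \<phi>
      using harm_deriv_phi by (simp add: harm_dphi_fun_def harm_phi_fun_def)
    have Ydd: "((\<lambda>p. harm_dphi_fun n m (\<theta>, p)) has_real_derivative - (real_of_int m)\<^sup>2 * harm n m \<theta>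
        \<phi>) (at \<phi>)" for \<phi>
    proof -
      have "((\<lambda>p. - real_of_int m * harm_fun n (- m) (\<theta>, p)) has_real_derivative - real_of_int m *
          harm_dphi_fun n (- m) (\<theta>, \<phi>)) (at \<phi>)"
        unfolding harm_fun_def fst_conv snd_conv harm_dphi_fun_def harm_phi_fun_def by (intro
            DERIV_cmult harm_deriv_phi)
      then show ?thesis by (simp add: harm_dphi_fun_eq harm_fun_def power2_eq_square mult.assoc)
    qed
    have per: "X \<theta> (2 * pi) = X \<theta> 0" if "X = F \<or> X = harm n m" for X
      using that azimuthal_periodic[of m 0 1] by (auto simp: F_def sph_def harm_def)
    have per': "harm_dphi_fun n m (\<theta>, 2 * pi) = harm_dphi_fun n m (\<theta>, 0)"
      using azimuthal_periodic[of "- m" 0 1] by (simp add: harm_dphi_fun_eq harm_fun_def harm_def)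
    \<comment> \<open>\<open>Fp\<close> is known only as a derivative, so its periodicity comes from
      that of \<Psi> and the uniqueness of derivatives.\<close>
    have perFp: "Fp \<theta> (2 * pi) = Fp \<theta> 0"
    proof -
      have "((\<lambda>p. \<Psi> (sph \<theta> (p + 2 * pi))) has_real_derivative Fp \<theta> (0 + 2 * pi)) (at 0)"
        using Fp[of \<theta> "0 + 2 * pi"] DERIV_shift[of "\<lambda>p. \<Psi> (sph \<theta> p)" _ 0 "2 * pi"] by blast
      then have "((\<lambda>p. \<Psi> (sph \<theta> p)) has_real_derivative Fp \<theta> (2 * pi)) (at 0)"
        by (simp add: sph_def)
      then show ?thesis using Fp DERIV_unique by blast
    qed
    have "((\<lambda>\<phi>. Fpp \<theta> \<phi> * harm n m \<theta> \<phi> + (real_of_int m)\<^sup>2 * F \<theta> \<phi> * harm n m \<theta> \<phi>) has_integral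
        (Fp \<theta> (2 * pi) * harm n m \<theta> (2 * pi) - F \<theta> (2 * pi) * harm_dphi_fun n m (\<theta>, 2 * pi))
        - (Fp \<theta> 0 * harm n m \<theta> 0 - F \<theta> 0 * harm_dphi_fun n m (\<theta>, 0))) {0..2 * pi}"
    proof (rule fundamental_theorem_of_calculus)
      fix \<phi> assume "\<phi> \<in> {0..2 * pi}"
      have "((\<lambda>p. Fp \<theta> p * harm n m \<theta> p - F \<theta> p * harm_dphi_fun n m (\<theta>, p)) has_real_derivative
          Fpp \<theta> \<phi> * harm n m \<theta> \<phi> + (real_of_int m)\<^sup>2 * F \<theta> \<phi> * harm n m \<theta> \<phi>) (at \<phi>)"
        unfolding F_def by (rule derivative_eq_intros Fp Fpp Yd Ydd refl)+ (simp add: algebra_simps)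
      then show "((\<lambda>p. Fp \<theta> p * harm n m \<theta> p - F \<theta> p * harm_dphi_fun n m (\<theta>, p))
          has_vector_derivative
          Fpp \<theta> \<phi> * harm n m \<theta> \<phi> + (real_of_int m)\<^sup>2 * F \<theta> \<phi> * harm n m \<theta> \<phi>) (at \<phi> within {0..2 *
              pi})"
        by (simp add: has_real_derivative_iff_has_vector_derivative has_vector_derivative_at_within)
    qed simp
    then have z: "((\<lambda>\<phi>. (Fpp \<theta> \<phi> * harm n m \<theta> \<phi> + (real_of_int m)\<^sup>2 * F \<theta> \<phi> * harm n m \<theta> \<phi>) / sin
        \<theta>) has_integral 0) {0..2 * pi}"
      using has_integral_divide[of _ 0 _ "sin \<theta>"] per[of F] per[of "harm n m"] per' perFp by simp
    have eq: "h \<theta> \<phi> = A1 \<theta> \<phi> + (Fpp \<theta> \<phi> * harm n m \<theta> \<phi> + (real_of_int m)\<^sup>2 * F \<theta> \<phi> * harm n m \<theta> \<phi>)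
        / sin \<theta>" for \<phi>
    proof -
      have dth: "d_theta \<Psi> t \<phi> = Ft t \<phi>" for t unfolding d_theta_def by (rule DERIV_imp_deriv[OF
          Ft])
      have dph: "d_phi \<Psi> \<theta> p = Fp \<theta> p" for p unfolding d_phi_def by (rule DERIV_imp_deriv[OF Fp])
      have "((\<lambda>t. sin t * Ft t \<phi>) has_real_derivative cos \<theta> * Ft \<theta> \<phi> + sin \<theta> * Ftt \<theta> \<phi>) (at \<theta>)"
        by (rule derivative_eq_intros Ftt refl)+ (simp add: algebra_simps)
      then have "W \<theta> \<phi> = 1 / sin \<theta> * (cos \<theta> * Ft \<theta> \<phi> + sin \<theta> * Ftt \<theta> \<phi>) + 1 / (sin \<theta>)\<^sup>2 * Fpp \<theta> \<phi>"
        unfolding W_def L[OF \<theta>, symmetric] sph_laplacian_def dth dph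
        using DERIV_imp_deriv[OF Fpp[of \<theta> \<phi>]] by (simp add: DERIV_imp_deriv)
      then have W: "W \<theta> \<phi> * sin \<theta> = (cos \<theta> * Ft \<theta> \<phi> + sin \<theta> * Ftt \<theta> \<phi>) + Fpp \<theta> \<phi> / sin \<theta>"
        using s by (simp add: field_simps power2_eq_square)
      have LY: "LY \<theta> \<phi> = (real_of_int m)\<^sup>2 * harm n m \<theta> \<phi> / sin \<theta> - ?N * sin \<theta> * harm n m \<theta> \<phi>"
      proof (cases "m = 0")
        case False
        then show ?thesis using s by (simp add: LY_def harm_def assoc_leg_sin_assoc_leg_quot
            algebra_simps)
      qed (simp add: LY_def harm_def)
      have "h \<theta> \<phi> = (W \<theta> \<phi> * sin \<theta>) * harm n m \<theta> \<phi> + ?N * sin \<theta> * F \<theta> \<phi> * harm n m \<theta> \<phi>"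
        by (simp add: h_def algebra_simps)
      then show ?thesis
        unfolding W A1_def LY by (simp add: algebra_simps add_divide_distrib)
    qed
    have "(A1 \<theta>) integrable_on {0..2 * pi}"
      unfolding A1_def LY_def
      by (intro integrable_continuous_real continuous_intros comp[OF c(1)] comp[OF c(2)] comp[OF
          cont_F])
    then have "((\<lambda>\<phi>. h \<theta> \<phi>) has_integral integral {0..2 * pi} (A1 \<theta>) + 0) {0..2 * pi}"
      unfolding eq by (intro has_integral_add z integrable_integral)
    then show ?thesis by (simp add: integral_unique)
  qed
  \<comment> \<open>The derivative of \<open>r\<close> is identified with the integral of
    \<open>h\<close> only in the open interval, so the interior version of the fundamental theorem
    is applied, with continuity of \<open>r\<close> up to the poles.\<close>
  have "((\<lambda>\<theta>. integral {0..2 * pi} (h \<theta>)) has_integral r pi - r 0) {0..pi}"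
  proof (rule fundamental_theorem_of_calculus_interior)
    show "continuous_on {0..pi} r"
      using r_deriv by (intro continuous_at_imp_continuous_on ballI DERIV_isCont)
    show "(r has_vector_derivative integral {0..2 * pi} (h \<theta>)) (at \<theta>)" if "\<theta> \<in> {0<..<pi}" for \<theta>
      using r_deriv[of \<theta>] A1_h[of \<theta>] that by (simp add:
          has_real_derivative_iff_has_vector_derivative)
  qed simp
  moreover have "r pi = 0" "r 0 = 0" by (simp_all add: r_def G_def)
  ultimately have "integral {0..pi} (\<lambda>\<theta>. integral {0..2 * pi} (h \<theta>)) = 0" by (simp add:
      integral_unique)
  then have "integral sph_box (\<lambda>p. h (fst p) (snd p)) = 0"
    using integral_prod_continuous[of 0 0 pi "2 * pi" "\<lambda>p. h (fst p) (snd p)"] cont_h by (simp add: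
        sph_box_def)
  moreover have "integral sph_box (\<lambda>p. h (fst p) (snd p))
      = sph_ip (\<lambda>p. W (fst p) (snd p) + ?N *\<^sub>R F (fst p) (snd p)) (harm_fun n m)"
    by (simp add: sph_ip_def h_def harm_fun_def)
  moreover have "\<dots> = sph_ip (\<lambda>p. W (fst p) (snd p)) (harm_fun n m) + ?N * sph_ip (\<lambda>p. F (fst p)
      (snd p)) (harm_fun n m)"
    by (subst sph_ip_add_left, unfold sph_ip_scaleR_left)
       (auto intro!: continuous_intros H.cont continuous_on_subset[OF cont_F]
           continuous_on_subset[OF cont_W])
  ultimately show ?thesis
    using \<Psi> \<Omega> by (simp add: sph_coeff_eq_sph_ip Ck_sphere_Suc_continuous[of 1] eval_nat_numeral
        W_def F_def)
qed

section \<open>Rigidity\<close>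

lemma frame_orthonormal:
  "e_theta \<theta> \<phi> \<bullet> e_theta \<theta> \<phi> = 1" "e_phi \<theta> \<phi> \<bullet> e_phi \<theta> \<phi> = 1"
  "e_theta \<theta> \<phi> \<bullet> e_phi \<theta> \<phi> = 0" "e_phi \<theta> \<phi> \<bullet> e_theta \<theta> \<phi> = 0"
proof -
  have "cos \<theta> * cos \<phi> * (cos \<theta> * cos \<phi>) + cos \<theta> * sin \<phi> * (cos \<theta> * sin \<phi>) + sin \<theta> * sin \<theta>
      = (cos \<theta>)\<^sup>2 * ((cos \<phi>)\<^sup>2 + (sin \<phi>)\<^sup>2) + (sin \<theta>)\<^sup>2"
    by (simp only: power2_eq_square distrib_left distrib_right mult_ac add_ac)
  also have "\<dots> = 1" by simp
  finally show "e_theta \<theta> \<phi> \<bullet> e_theta \<theta> \<phi> = 1"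
    by (simp add: inner_vec_def sum_3 e_theta_def)
  show "e_phi \<theta> \<phi> \<bullet> e_phi \<theta> \<phi> = 1"
    by (simp add: inner_vec_def sum_3 e_phi_def power2_eq_square[symmetric])
  show "e_theta \<theta> \<phi> \<bullet> e_phi \<theta> \<phi> = 0" "e_phi \<theta> \<phi> \<bullet> e_theta \<theta> \<phi> = 0"
    by (simp_all add: inner_vec_def sum_3 e_theta_def e_phi_def)
qed

lemma sph_perp_grad_eq:
  "sph_perp_grad f \<theta> \<phi> = (1 / sin \<theta> * d_phi f \<theta> \<phi>) *\<^sub>R e_theta \<theta> \<phi> - d_theta f \<theta> \<phi> *\<^sub>R e_phi \<theta> \<phi>"
  by (simp add: sph_perp_grad_def sph_J_def sph_grad_def inner_add_left frame_orthonormal)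

lemma sph_perp_grad_inner_grad:
  "sph_perp_grad f \<theta> \<phi> \<bullet> sph_grad g \<theta> \<phi>
     = 1 / sin \<theta> * d_phi f \<theta> \<phi> * d_theta g \<theta> \<phi> - d_theta f \<theta> \<phi> * (1 / sin \<theta> * d_phi g \<theta> \<phi>)"
  unfolding sph_perp_grad_eq sph_grad_def
  by (simp add: inner_diff_left inner_add_right frame_orthonormal mult_ac)

lemma sph_coeff_add_harm:
  assumes f: "continuous_on (sphere 0 1) f" and m: "\<bar>m\<bar> \<le> int n"
  shows "sph_coeff (\<lambda>x. f x + a * sph_harm 1 0 x) n m = sph_coeff f n m + (if n = 1 \<and> m = 0 then a
      else 0)"
proof -
  have "continuous_on (sphere 0 1) (\<lambda>x. f x + a * sph_harm 1 0 x)"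
    by (intro continuous_intros f continuous_on_sph_harm)
  then have "sph_coeff (\<lambda>x. f x + a * sph_harm 1 0 x) n m
      = sph_ip (\<lambda>p. f (sph (fst p) (snd p)) + a *\<^sub>R harm_fun 1 0 p) (harm_fun n m)"
    by (simp add: sph_coeff_eq_sph_ip sph_harm_harm harm_fun_def)
  also have "\<dots> = sph_coeff f n m + a * sph_ip (harm_fun 1 0) (harm_fun n m)"
    by (subst sph_ip_add_left, unfold sph_ip_scaleR_left)
       (auto intro!: continuous_intros H.cont continuous_on_sph_compose f simp:
           sph_coeff_eq_sph_ip[OF f])
  also have "sph_ip (harm_fun 1 0) (harm_fun n m) = (if n = 1 \<and> m = 0 then 1 else 0)"
    by (subst H.orth) auto
  finally show ?thesis by simp
qed

text \<open>One summand is at most the whole norm. The weight enters the squared norm to the fourth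
  power, hence the coefficient itself to the second, and it exceeds n^2.\<close>

lemma sobolev_coeff_bound:
  assumes "in_sobolev 4 u" "sobolev_norm 4 u \<le> \<epsilon>" "1 \<le> n" "\<bar>m\<bar> \<le> int n"
  shows "\<bar>sph_coeff u n m\<bar> \<le> \<epsilon> / real n ^ 4"
proof -
  let ?\<mu> = "real n * (real n + 1) + 1" and ?c = "sph_coeff u n m"
  have nn: "0 \<le> sobolev_term 4 u i" for i
    by (auto simp: sobolev_term_def intro!: sum_nonneg)
  have "(?\<mu>\<^sup>2 * ?c)\<^sup>2 = ?\<mu> ^ 4 * ?c\<^sup>2"
    by (simp add: power_mult_distrib power_mult[symmetric])
  also have "\<dots> \<le> sobolev_term 4 u n"
    unfolding sobolev_term_def using assms(4) by (intro member_le_sum) auto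
  also have "\<dots> \<le> (\<Sum>i. sobolev_term 4 u i)"
    using sum_le_suminf[of "sobolev_term 4 u" "{n}"] assms(1) nn by (simp add: in_sobolev_def)
  finally have "\<bar>?\<mu>\<^sup>2 * ?c\<bar> \<le> sobolev_norm 4 u"
    unfolding sobolev_norm_def by (rule real_le_rsqrt[OF _, of "\<bar>?\<mu>\<^sup>2 * ?c\<bar>", simplified])
  moreover have "real n ^ 4 * \<bar>?c\<bar> \<le> ?\<mu>\<^sup>2 * \<bar>?c\<bar>"
  proof (rule mult_right_mono)
    have "(real n ^ 2)\<^sup>2 \<le> ?\<mu>\<^sup>2"
      by (rule power_mono) (simp_all add: power2_eq_square algebra_simps)
    then show "real n ^ 4 \<le> ?\<mu>\<^sup>2" by (simp add: power_mult[symmetric])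
  qed simp
  ultimately have "real n ^ 4 * \<bar>?c\<bar> \<le> \<epsilon>"
    using assms(2) by (simp add: abs_mult)
  then show ?thesis using assms(3) by (simp add: pos_le_divide_eq mult.commute)
qed

lemma coeff_decay_add: "coeff_decay c K \<Longrightarrow> coeff_decay c' K' \<Longrightarrow> coeff_decay (\<lambda>n m. c n m + c' n m) (K
    + K')"
  unfolding coeff_decay_def by (auto simp: add_divide_distrib intro!: order_trans[OF
      abs_triangle_ineq] add_mono)

lemma coeff_decay_scale: "coeff_decay c K \<Longrightarrow> coeff_decay (\<lambda>n m. a * c n m) (\<bar>a\<bar> * K)"
  unfolding coeff_decay_def abs_mult times_divide_eq_right[symmetric]
  by (auto simp del: times_divide_eq_right intro!: mult_left_mono)

lemma (in sph_family) harm_series_scale: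
  assumes "coeff_decay c K"
  shows "harm_series F (\<lambda>n m. a * c n m) p = a *\<^sub>R harm_series F c p"
proof -
  have "(\<lambda>n. a *\<^sub>R harm_block F c n p) sums (a *\<^sub>R harm_series F c p)"
    by (intro sums_scaleR_right harm_series_sums[OF assms])
  then show ?thesis
    by (simp add: harm_series_def harm_block_def scaleR_right.sum sums_iff)
qed

section \<open>Splitting into zonal and nonzonal coefficients\<close>

definition zonal_part :: "(nat \<Rightarrow> int \<Rightarrow> real) \<Rightarrow> nat \<Rightarrow> int \<Rightarrow> real" where
  "zonal_part c n m = (if m = 0 then c n m else 0)"

definition nonzonal_part :: "(nat \<Rightarrow> int \<Rightarrow> real) \<Rightarrow> nat \<Rightarrow> int \<Rightarrow> real" where
  "nonzonal_part c n m = (if m = 0 then 0 else c n m)"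

lemma coeff_decay_parts:
  assumes "coeff_decay c K"
  shows "coeff_decay (zonal_part c) K" "coeff_decay (nonzonal_part c) K"
  using assms by (auto simp: coeff_decay_def zonal_part_def nonzonal_part_def)

lemma parts_add: "c = (\<lambda>n m. zonal_part c n m + nonzonal_part c n m)"
  by (intro ext) (simp add: zonal_part_def nonzonal_part_def)

lemma harm_series_harm_phi_fun_nonzonal: "harm_series harm_phi_fun (nonzonal_part c) p =
    harm_series harm_phi_fun c p"
proof -
  have "harm_block harm_phi_fun (nonzonal_part c) n p = harm_block harm_phi_fun c n p" for n
    unfolding harm_block_def by (intro sum.cong) (auto simp: nonzonal_part_def harm_phi_fun_def
        harm_phi_def)
  then show ?thesis by (simp add: harm_series_def)
qed

lemma harm_series_harm_theta_fun_parts: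
  assumes "coeff_decay c K"
  shows "harm_series harm_theta_fun c p = harm_series harm_theta_fun (zonal_part c) p + harm_series
      harm_theta_fun (nonzonal_part c) p"
  using T.harm_series_add[OF coeff_decay_parts[OF assms], of p] unfolding parts_add[of c,
      symmetric] .

lemma harm_series_zonal:
  assumes "\<And>n m. \<bar>m\<bar> \<le> int n \<Longrightarrow> m \<noteq> 0 \<Longrightarrow> c n m = 0"
  shows "harm_series harm_fun c (\<theta>, \<phi>) = harm_series harm_fun c (\<theta>, \<phi>')" "harm_series
      harm_theta_fun c (\<theta>, \<phi>) = harm_series harm_theta_fun c (\<theta>, \<phi>')" "harm_series harm_phi_fun c
      (\<theta>, \<phi>) = 0"
proof -
  have c: "c n m = 0" if "m \<in> {- int n..int n}" "m \<noteq> 0" for n m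
    using that assms[of m n] by auto
  have "c n m *\<^sub>R harm_fun n m (\<theta>, \<phi>) = c n m *\<^sub>R harm_fun n m (\<theta>, \<phi>')"
    "c n m *\<^sub>R harm_theta_fun n m (\<theta>, \<phi>) = c n m *\<^sub>R harm_theta_fun n m (\<theta>, \<phi>')" "c n m *\<^sub>R
        harm_phi_fun n m (\<theta>, \<phi>) = 0"
    if "m \<in> {- int n..int n}" for n m
    using c[OF that] by (cases "m = 0"; simp add: harm_fun_def harm_theta_fun_def harm_phi_fun_def
        harm_def harm_theta_def harm_phi_def azimuthal_def)+
  then have "harm_block harm_fun c n (\<theta>, \<phi>) = harm_block harm_fun c n (\<theta>, \<phi>')" "harm_block
      harm_theta_fun c n (\<theta>, \<phi>) = harm_block harm_theta_fun c n (\<theta>, \<phi>')"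
    "harm_block harm_phi_fun c n (\<theta>, \<phi>) = 0" for n
    unfolding harm_block_def by (auto intro!: sum.cong sum.neutral simp del: real_scaleR_def)
  then show "harm_series harm_fun c (\<theta>, \<phi>) = harm_series harm_fun c (\<theta>, \<phi>')" "harm_series
      harm_theta_fun c (\<theta>, \<phi>) = harm_series harm_theta_fun c (\<theta>, \<phi>')" "harm_series harm_phi_fun c
      (\<theta>, \<phi>) = 0"
    by (simp_all add: harm_series_def)
qed

text \<open>The two sides are compared by Parseval; the modes \<open>n = 1\<close>, \<open>\<bar>m\<bar> = 1\<close> span the kernel of
  \<open>\<Delta> + 2\<close> among the nonzonal functions, and on the others \<open>\<Delta> + 2\<close> dominates the gradient.\<close>
lemma nonzonal_coeffs_vanish:
  assumes p: "coeff_decay p K" and g: "coeff_decay g K'"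
    and gp: "\<And>n m. \<bar>m\<bar> \<le> int n \<Longrightarrow> g n m = (2 - real n * (real n + 1)) * p n m"
    and p1: "p 1 1 = 0" "p 1 (- 1) = 0"
    and le: "\<And>\<theta> \<phi>. 0 < \<theta> \<Longrightarrow> \<theta> < pi \<Longrightarrow>
      (sin \<theta> * harm_series harm_phi_fun g (\<theta>, \<phi>))\<^sup>2 \<le> (harm_series harm_theta_fun (nonzonal_part p)
          (\<theta>, \<phi>))\<^sup>2 + (harm_series harm_phi_fun p (\<theta>, \<phi>))\<^sup>2"
    and nm: "\<bar>m\<bar> \<le> int n" "m \<noteq> 0"
  shows "p n m = 0"
proof -
  let ?p = "nonzonal_part p" and ?g = "nonzonal_part g"
  define X where "X = (\<lambda>n. \<Sum>m\<in>{- int n..int n}. (?g n m)\<^sup>2 * (real_of_int m)\<^sup>2)"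
  define V where "V = (\<lambda>n. \<Sum>m\<in>{- int n..int n}. (?p n m)\<^sup>2 * (real n * (real n + 1)))"
  have dp: "coeff_decay ?p K" and dg: "coeff_decay ?g K'"
    using coeff_decay_parts p g by blast+
  have Xs: "X sums sph_ip (harm_series harm_dphi_fun ?g) (harm_series harm_dphi_fun ?g)"
    unfolding X_def by (rule P.harm_series_parseval[OF dg])
  have Vs: "V sums sph_ip (harm_series harm_grad_fun ?p) (harm_series harm_grad_fun ?p)"
    unfolding V_def by (rule G.harm_series_parseval[OF dp])
  have "sph_ip (harm_series harm_dphi_fun ?g) (harm_series harm_dphi_fun ?g) \<le> sph_ip (harm_series
      harm_grad_fun ?p) (harm_series harm_grad_fun ?p)"
    unfolding sph_ip_def
  proof (rule integral_le)
    show "(\<lambda>p. (harm_series harm_dphi_fun ?g p \<bullet> harm_series harm_dphi_fun ?g p) * sin (fst p))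
        integrable_on sph_box"
      by (intro sph_ip_integrable P.harm_series_cont[OF dg])
    show "(\<lambda>p. (harm_series harm_grad_fun ?p p \<bullet> harm_series harm_grad_fun ?p p) * sin (fst p))
        integrable_on sph_box"
      by (intro sph_ip_integrable G.harm_series_cont[OF dp])
    fix x assume x: "x \<in> sph_box"
    show "(harm_series harm_dphi_fun ?g x \<bullet> harm_series harm_dphi_fun ?g x) * sin (fst x) \<le>
        (harm_series harm_grad_fun ?p x \<bullet> harm_series harm_grad_fun ?p x) * sin (fst x)"
    \<comment> \<open>At the poles, where the pointwise inequality is not assumed, the weight makes
      both sides zero.\<close>
    proof (cases "fst x = 0 \<or> fst x = pi")
      case False
      then have "0 < fst x" "fst x < pi" using x by (auto simp: mem_sph_box)
      from le[OF this, of "snd x"] have "harm_series harm_dphi_fun ?g x \<bullet> harm_series harm_dphi_fun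
          ?g x \<le> harm_series harm_grad_fun ?p x \<bullet> harm_series harm_grad_fun ?p x"
        by (simp add: harm_series_harm_grad_fun[OF dp] harm_series_harm_dphi_fun[OF dg]
            harm_series_harm_phi_fun_nonzonal power2_eq_square)
      then show ?thesis
        using x by (intro mult_right_mono sin_ge_zero) (auto simp: mem_sph_box)
    qed auto
  qed
  then have "suminf X \<le> suminf V" using Xs Vs by (simp add: sums_iff)
  moreover have VX: "V n \<le> X n / 2" for n
    unfolding V_def X_def sum_divide_distrib
  proof (rule sum_mono)
    fix m assume "m \<in> {- int n..int n}"
    then have m: "\<bar>m\<bar> \<le> int n" by auto
    show "(?p n m)\<^sup>2 * (real n * (real n + 1)) \<le> (?g n m)\<^sup>2 * (real_of_int m)\<^sup>2 / 2"
    proof (cases "m = 0 \<or> p n m = 0")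
      case False
      then have "n \<noteq> 0" using m by auto
      moreover have "n \<noteq> 1"
      proof
        assume "n = 1"
        then have "m = 1 \<or> m = - 1" using m False by auto
        then show False using False p1 \<open>n = 1\<close> by auto
      qed
      ultimately have "2 \<le> n" by simp
      define N where "N = real n * (real n + 1)"
      \<comment> \<open>From degree 2 on the eigenvalue N is at least 6, and (2 - N)^2 - 2N = N(N -
        6) + 4 is positive. This gains the factor 2 that makes the comparison of the sums
        strict.\<close>
      have "2 * (2 + 1) \<le> N" unfolding N_def using \<open>2 \<le> n\<close> by (intro mult_mono) simp_all
      then have "0 \<le> N * (N - 6) + 4" by simp
      then have "2 * N \<le> (2 - N)\<^sup>2" by (simp add: power2_eq_square algebra_simps)
      then have "(p n m)\<^sup>2 * (2 * N) \<le> (p n m)\<^sup>2 * (2 - N)\<^sup>2" by (intro mult_left_mono) simp_all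
      also have "\<dots> = (g n m)\<^sup>2 * 1" by (simp add: gp[OF m] N_def power_mult_distrib mult.commute)
      also have "\<dots> \<le> (g n m)\<^sup>2 * (real_of_int m)\<^sup>2"
      proof (rule mult_left_mono)
        have "1 \<le> \<bar>real_of_int m\<bar>" using False by linarith
        then show "1 \<le> (real_of_int m)\<^sup>2" using one_le_power[of "\<bar>real_of_int m\<bar>" 2] by simp
      qed simp
      finally show ?thesis using False by (simp add: nonzonal_part_def N_def)
    qed (auto simp: nonzonal_part_def)
  qed
  then have "suminf V \<le> (\<Sum>n. X n / 2)"
    using Xs Vs by (intro suminf_le summable_divide) (auto simp: sums_iff)
  also have "\<dots> = suminf X / 2" using Xs by (simp add: suminf_divide sums_iff)
  \<comment> \<open>The sum of X is at most that of V, which is at most half the sum of X.\<close>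
  finally have "suminf X \<le> 0" using \<open>suminf X \<le> suminf V\<close> by linarith
  moreover have Xnn: "0 \<le> X n" for n unfolding X_def by (intro sum_nonneg) simp
  ultimately have "X n = 0"
    using Xs suminf_nonneg[of X] suminf_eq_zero_iff[of X] by (auto simp: sums_iff)
  moreover have "(?p n m)\<^sup>2 * (real n * (real n + 1)) \<le> V n"
    unfolding V_def using nm(1) by (intro member_le_sum) auto
  ultimately have "(?p n m)\<^sup>2 * (real n * (real n + 1)) \<le> 0" using VX[of n] by simp
  moreover have "0 < real n * (real n + 1)" using nm by (cases n) auto
  ultimately have "(?p n m)\<^sup>2 \<le> 0" using mult_pos_pos[of "(?p n m)\<^sup>2" "real n * (real n + 1)"] by
      linarith
  then show ?thesis using nm(2) by (simp add: nonzonal_part_def)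
qed

text \<open>Here \<open>s\<close> is \<open>sin \<theta>\<close>; \<open>t0\<close> and
  \<open>t1\<close> are the zonal and nonzonal colatitude derivatives of psi, \<open>h0\<close> and
  \<open>h1\<close> those of g; \<open>q\<close> and \<open>Gq\<close> are the longitude derivatives
  of psi and g over \<open>s\<close>. The product \<open>t0 * Gq\<close> is absorbed into the left
  side, which is possible because \<open>t0\<close> carries a factor \<open>s\<close>.\<close>

lemma steady_poisson_estimate:
  fixes b s :: real
  assumes s: "0 < s" "s \<le> 1" and E: "6 * E \<le> \<bar>b\<bar>" "b \<noteq> 0"
    and eq: "b * s * Gq = (t0 + t1) * Gq - q * (h0 + h1)"
    and t0: "\<bar>t0\<bar> \<le> s * E" and h0: "\<bar>h0\<bar> \<le> s * E" and h1: "\<bar>h1\<bar> \<le> E" and Gq: "\<bar>Gq\<bar> \<le> E"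
  shows "(s * Gq)\<^sup>2 \<le> t1\<^sup>2 + q\<^sup>2"
proof -
  have E0: "0 \<le> E" using h1 by linarith
  have "\<bar>b\<bar> * \<bar>s * Gq\<bar> = \<bar>t0 * Gq + t1 * Gq - q * h0 - q * h1\<bar>"
    using arg_cong[OF eq, of abs] by (simp add: abs_mult algebra_simps)
  also have "\<dots> \<le> \<bar>t0 * Gq\<bar> + \<bar>t1 * Gq\<bar> + \<bar>q * h0\<bar> + \<bar>q * h1\<bar>" by linarith
  also have "\<dots> \<le> E * \<bar>s * Gq\<bar> + \<bar>t1\<bar> * E + \<bar>q\<bar> * E + \<bar>q\<bar> * E"
  proof (intro add_mono)
    have "\<bar>t0\<bar> * \<bar>Gq\<bar> \<le> (s * E) * \<bar>Gq\<bar>" using t0 by (rule mult_right_mono) simp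
    then show "\<bar>t0 * Gq\<bar> \<le> E * \<bar>s * Gq\<bar>" using s by (simp add: abs_mult mult_ac)
    have "\<bar>h0\<bar> \<le> E" using h0 mult_right_mono[OF s(2) E0] by linarith
    then show "\<bar>q * h0\<bar> \<le> \<bar>q\<bar> * E" unfolding abs_mult by (rule mult_left_mono) simp
  qed (unfold abs_mult, auto intro!: mult_left_mono h1 Gq)
  finally have "\<bar>b\<bar> * \<bar>s * Gq\<bar> \<le> E * \<bar>s * Gq\<bar> + \<bar>t1\<bar> * E + \<bar>q\<bar> * E + \<bar>q\<bar> * E" .
  moreover have "0 \<le> \<bar>t1\<bar> * E" using E0 by simp
  \<comment> \<open>Replacing the absolute value of b by 6 E gives every term the factor E.
    Absorbing the zonal term leaves 5 E on the left, against at most 2 E times the absolute values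
    of \<open>t1\<close> and \<open>q\<close>.\<close>
  moreover have "6 * E * \<bar>s * Gq\<bar> \<le> \<bar>b\<bar> * \<bar>s * Gq\<bar>"
    using E by (intro mult_right_mono) auto
  ultimately have "E * (5 * \<bar>s * Gq\<bar>) \<le> E * (2 * (\<bar>t1\<bar> + \<bar>q\<bar>))"
    unfolding distrib_left mult.assoc mult.left_commute[of E] mult.commute[of _ E] by linarith
  note le = this
  have "\<bar>s * Gq\<bar> \<le> 2 / 5 * (\<bar>t1\<bar> + \<bar>q\<bar>)"
  \<comment> \<open>If E = 0, cancellation is impossible, but then the bound on \<open>Gq\<close>
    already makes the left side zero.\<close>
  proof (cases "E = 0")
    case True
    then show ?thesis using Gq by simp
  next
    case False
    then have "0 < E" using E0 by simp
    from le have "5 * \<bar>s * Gq\<bar> \<le> 2 * (\<bar>t1\<bar> + \<bar>q\<bar>)"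
      using \<open>0 < E\<close> by (simp only: mult_le_cancel_left_pos)
    then show ?thesis by simp
  qed
  then have "\<bar>s * Gq\<bar>\<^sup>2 \<le> (2 / 5 * (\<bar>t1\<bar> + \<bar>q\<bar>))\<^sup>2"
    by (rule power_mono) simp
  \<comment> \<open>The square of a sum is twice the sum of squares minus the square of the
    difference; the resulting factor 8/25 is below 1.\<close>
  also have "\<dots> = 4 / 25 * (2 * (t1\<^sup>2 + q\<^sup>2) - (\<bar>t1\<bar> - \<bar>q\<bar>)\<^sup>2)"
    by (simp add: power2_eq_square algebra_simps abs_mult_self_eq)
  also have "\<dots> \<le> t1\<^sup>2 + q\<^sup>2"
  proof -
    have "4 / 25 * (2 * (x + y) - z) \<le> x + y" if "0 \<le> x" "0 \<le> y" "0 \<le> z" for x y z :: real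
      using that by simp
    from this[OF zero_le_power2 zero_le_power2 zero_le_power2] show ?thesis .
  qed
  finally show ?thesis by simp
qed

lemma harm_series_deriv_on_sphere:
  assumes f: "\<And>\<theta> \<phi>. 0 < \<theta> \<Longrightarrow> \<theta> < pi \<Longrightarrow> f (sph \<theta> \<phi>) + a * cos \<theta> = harm_series harm_fun c (\<theta>, \<phi>)"
    and c: "coeff_decay c K" and \<theta>: "0 < \<theta>" "\<theta> < pi"
  shows "d_theta f \<theta> \<phi> = harm_series harm_theta_fun c (\<theta>, \<phi>) + a * sin \<theta>"
    and "d_phi f \<theta> \<phi> = sin \<theta> * harm_series harm_phi_fun c (\<theta>, \<phi>)"
proof -
  have "((\<lambda>t. harm_series harm_fun c (t, \<phi>) - a * cos t) has_real_derivative harm_series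
      harm_theta_fun c (\<theta>, \<phi>) + a * sin \<theta>) (at \<theta>)"
    by (rule derivative_eq_intros harm_series_harm_fun_deriv_theta[OF c] refl)+ simp
  then have "((\<lambda>t. f (sph t \<phi>)) has_real_derivative harm_series harm_theta_fun c (\<theta>, \<phi>) + a * sin
      \<theta>) (at \<theta>)"
    by (rule has_field_derivative_transform_within_open[where S = "{0<..<pi}"])
       (use \<theta> f in \<open>auto simp: algebra_simps\<close>)
  then show "d_theta f \<theta> \<phi> = harm_series harm_theta_fun c (\<theta>, \<phi>) + a * sin \<theta>"
    unfolding d_theta_def by (rule DERIV_imp_deriv)
  have "((\<lambda>p. harm_series harm_fun c (\<theta>, p) - a * cos \<theta>) has_real_derivative harm_series
      harm_dphi_fun c (\<theta>, \<phi>)) (at \<phi>)"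
    using DERIV_diff[OF harm_series_harm_fun_deriv_phi[OF c] DERIV_const] by simp
  moreover have "(\<lambda>p. f (sph \<theta> p)) = (\<lambda>p. harm_series harm_fun c (\<theta>, p) - a * cos \<theta>)"
    using f[OF \<theta>] by (auto simp: fun_eq_iff algebra_simps)
  ultimately show "d_phi f \<theta> \<phi> = sin \<theta> * harm_series harm_phi_fun c (\<theta>, \<phi>)"
    unfolding d_phi_def using harm_series_harm_dphi_fun[OF c] by (simp add: DERIV_imp_deriv)
qed

theorem corollary1p5:
  fixes \<alpha> :: real
  assumes "\<alpha> \<noteq> 0"
  shows "\<exists>\<epsilon>\<^sub>0>0. \<forall>U \<Psi> \<Omega>.
    steady_euler_solution U \<Psi> \<Omega> \<and>
    in_sobolev 4 (\<lambda>x. \<Omega> x + 2 * \<alpha> * sph_harm 1 0 x) \<and>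
    sobolev_norm 4 (\<lambda>x. \<Omega> x + 2 * \<alpha> * sph_harm 1 0 x) \<le> \<epsilon>\<^sub>0 \<and>
    (\<forall>m::int. \<bar>m\<bar> = 1 \<longrightarrow> sph_inner \<Omega> (sph_harm 1 m) = 0)
    \<longrightarrow> zonal_vector_field U \<and> zonal_function \<Omega>"
proof -
  define Z where "Z = (\<Sum>n. real n powr (- (3 / 2)))"
  \<comment> \<open>In coordinates, \<alpha> times the harmonic of degree 1 and order 0 is
    \<open>b * cos \<theta>\<close>.\<close>
  define b where "b = \<alpha> * (1 / 2 * sqrt (3 / pi))"
  \<comment> \<open>216 = 6 * 36: the pointwise estimate asks for 6 E at most the absolute value of
    b, and E = 36 \<epsilon> Z is the series bound 12 K Z for g, whose decay constant is K = 3
    \<epsilon>.\<close>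
  define \<epsilon> where "\<epsilon> = \<bar>b\<bar> / (216 * Z)"
  have "(\<Sum>n\<in>{1::nat}. real n powr (- (3 / 2))) \<le> Z"
    unfolding Z_def by (intro sum_le_suminf summable_32) auto
  then have Z: "1 \<le> Z" by simp
  have b: "b \<noteq> 0" using assms by (simp add: b_def)
  have \<epsilon>: "0 < \<epsilon>" using b Z by (simp add: \<epsilon>_def)
  have E: "6 * (36 * \<epsilon> * Z) \<le> \<bar>b\<bar>" using Z by (simp add: \<epsilon>_def)
  have "zonal_vector_field U \<and> zonal_function \<Omega>"
    if S: "steady_euler_solution U \<Psi> \<Omega>"
      and sob: "in_sobolev 4 (\<lambda>x. \<Omega> x + 2 * \<alpha> * sph_harm 1 0 x)"
        "sobolev_norm 4 (\<lambda>x. \<Omega> x + 2 * \<alpha> * sph_harm 1 0 x) \<le> \<epsilon>"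
      and c1: "\<And>m::int. \<bar>m\<bar> = 1 \<Longrightarrow> sph_inner \<Omega> (sph_harm 1 m) = 0" for U \<Psi> \<Omega>
  proof -
    have \<Psi>2: "Ck_sphere 2 \<Psi>" and \<Omega>1: "Ck_sphere 1 \<Omega>"
      and Ueq: "\<And>\<theta> \<phi>. 0 < \<theta> \<Longrightarrow> \<theta> < pi \<Longrightarrow> U (sph \<theta> \<phi>) = sph_perp_grad \<Psi> \<theta> \<phi>"
      and lap: "\<And>\<theta> \<phi>. 0 < \<theta> \<Longrightarrow> \<theta> < pi \<Longrightarrow> sph_laplacian \<Psi> \<theta> \<phi> = \<Omega> (sph \<theta> \<phi>)"
      and euler: "\<And>\<theta> \<phi>. 0 < \<theta> \<Longrightarrow> \<theta> < pi \<Longrightarrow> U (sph \<theta> \<phi>) \<bullet> sph_grad \<Omega> \<theta> \<phi> = 0"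
      using S unfolding steady_euler_solution_iff by blast+
    have \<Psi>c: "continuous_on (sphere 0 1) \<Psi>" and \<Omega>c: "continuous_on (sphere 0 1) \<Omega>"
      using \<Psi>2 \<Omega>1 by (auto intro: Ck_sphere_Suc_continuous[of 1] Ck_sphere_Suc_continuous[of 0]
          simp: eval_nat_numeral)
    define w where "w = sph_coeff (\<lambda>x. \<Omega> x + 2 * \<alpha> * sph_harm 1 0 x)"
    \<comment> \<open>The opposite sign and the missing factor 2 compared with \<open>w\<close>
      reflect the eigenvalue -2 in degree 1: the reference stream function is +\<alpha> times the
      harmonic. The corrections thus satisfy the same Laplace relation as the full fields.\<close>
    define p where "p = sph_coeff (\<lambda>x. \<Psi> x + - \<alpha> * sph_harm 1 0 x)"
    define g where "g = (\<lambda>n m. w n m + 2 * p n m)"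
    have wp: "w n m = - (real n * (real n + 1)) * p n m" if "\<bar>m\<bar> \<le> int n" for n m
      using laplacian_coeff[OF \<Psi>2 \<Omega>c lap, of n m]
      unfolding w_def p_def sph_coeff_add_harm[OF \<Omega>c that] sph_coeff_add_harm[OF \<Psi>c that]
      by (auto simp: algebra_simps)
    have dw: "coeff_decay w \<epsilon>"
      using sobolev_coeff_bound[OF sob] \<epsilon> by (auto simp: coeff_decay_def w_def)
    \<comment> \<open>Inverting the Laplacian divides by n(n+1), which is at least 1 for positive n;
      the gain of two powers of n is discarded.\<close>
    have dp: "coeff_decay p \<epsilon>"
      unfolding coeff_decay_def
    proof (intro conjI allI impI)
      fix n :: nat and m :: int assume nm: "1 \<le> n" "\<bar>m\<bar> \<le> int n"
      have "1 * 1 \<le> real n * (real n + 1)" using nm by (intro mult_mono) auto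
      then have "1 * \<bar>p n m\<bar> \<le> (real n * (real n + 1)) * \<bar>p n m\<bar>" by (intro mult_right_mono) auto
      also have "\<dots> = \<bar>w n m\<bar>" unfolding wp[OF nm(2)] by (simp add: abs_mult)
      also have "\<dots> \<le> \<epsilon> / real n ^ 4" using dw nm by (simp add: coeff_decay_def)
      finally show "\<bar>p n m\<bar> \<le> \<epsilon> / real n ^ 4" by simp
    qed (use \<epsilon> in simp)
    have d2: "coeff_decay (\<lambda>n m. 2 * p n m) (2 * \<epsilon>)"
      using coeff_decay_scale[OF dp, of 2] by simp
    have dg: "coeff_decay g (3 * \<epsilon>)"
      using coeff_decay_add[OF dw d2] by (simp add: g_def)
    have gp: "g n m = (2 - real n * (real n + 1)) * p n m" if "\<bar>m\<bar> \<le> int n" for n m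
      using wp[OF that] by (simp add: g_def algebra_simps)
    \<comment> \<open>The reference harmonic has order 0 and does not affect the coefficients of
      orders 1 and -1, so the orthogonality hypothesis passes to \<open>w\<close>, and dividing by
      the eigenvalue passes it to \<open>p\<close>.\<close>
    have p1: "p 1 m = 0" if "\<bar>m\<bar> = 1" for m
    proof -
      have "w 1 m = 0"
        using c1[OF that] that unfolding w_def by (subst sph_coeff_add_harm[OF \<Omega>c]) (auto simp:
            sph_coeff_def)
      then show ?thesis using wp[of m 1] that by simp
    qed
    have \<Omega>s: "\<Omega> (sph \<theta> \<phi>) + 2 * b * cos \<theta> = harm_series harm_fun w (\<theta>, \<phi>)" if "0 < \<theta>" "\<theta> < pi" for
        \<theta> \<phi>
      using harm_series_harm_fun_eq[OF _ _ dw that, of "\<lambda>x. \<Omega> x + 2 * \<alpha> * sph_harm 1 0 x" \<phi>]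
      by (simp add: w_def b_def sph_harm_1(1)[unfolded One_nat_def] continuous_intros \<Omega>c
          continuous_on_sph_harm)
    have \<Psi>s: "\<Psi> (sph \<theta> \<phi>) + - b * cos \<theta> = harm_series harm_fun p (\<theta>, \<phi>)" if "0 < \<theta>" "\<theta> < pi" for \<theta> \<phi>
      using harm_series_harm_fun_eq[OF _ _ dp that, of "\<lambda>x. \<Psi> x + - \<alpha> * sph_harm 1 0 x" \<phi>]
      by (simp add: p_def b_def sph_harm_1(1)[unfolded One_nat_def] continuous_intros \<Psi>c
          continuous_on_sph_harm)
    have d\<Omega>: "d_theta \<Omega> \<theta> \<phi> = harm_series harm_theta_fun w (\<theta>, \<phi>) + 2 * b * sin \<theta>" "d_phi \<Omega> \<theta> \<phi> =
        sin \<theta> * harm_series harm_phi_fun w (\<theta>, \<phi>)"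
      if "0 < \<theta>" "\<theta> < pi" for \<theta> \<phi>
      by (rule harm_series_deriv_on_sphere[OF _ dw that]; erule (1) \<Omega>s)+
    have d\<Psi>: "d_theta \<Psi> \<theta> \<phi> = harm_series harm_theta_fun p (\<theta>, \<phi>) + - b * sin \<theta>" "d_phi \<Psi> \<theta> \<phi> = sin
        \<theta> * harm_series harm_phi_fun p (\<theta>, \<phi>)"
      if "0 < \<theta>" "\<theta> < pi" for \<theta> \<phi>
      by (rule harm_series_deriv_on_sphere[OF _ dp that]; erule (1) \<Psi>s)+
    have "(sin \<theta> * harm_series harm_phi_fun g (\<theta>, \<phi>))\<^sup>2 \<le> (harm_series harm_theta_fun
        (nonzonal_part p) (\<theta>, \<phi>))\<^sup>2 + (harm_series harm_phi_fun p (\<theta>, \<phi>))\<^sup>2"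
      if \<theta>: "0 < \<theta>" "\<theta> < pi" for \<theta> \<phi>
    proof -
      let ?x = "(\<theta>, \<phi>)"
      have s: "0 < sin \<theta>" "sin \<theta> \<le> 1" using sin_gt_zero[OF \<theta>] by simp_all
      have add: "harm_series harm_theta_fun g ?x = harm_series harm_theta_fun w ?x + 2 *
          harm_series harm_theta_fun p ?x" "harm_series harm_phi_fun g ?x = harm_series
          harm_phi_fun w ?x + 2 * harm_series harm_phi_fun p ?x"
        unfolding g_def T.harm_series_add[OF dw d2] Q.harm_series_add[OF dw d2]
            T.harm_series_scale[OF dp] Q.harm_series_scale[OF dp] by simp_all
      have "1 / sin \<theta> * d_phi \<Psi> \<theta> \<phi> * d_theta \<Omega> \<theta> \<phi> - d_theta \<Psi> \<theta> \<phi> * (1 / sin \<theta> * d_phi \<Omega> \<theta> \<phi>) = 0"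
        using euler[OF \<theta>, of \<phi>] unfolding Ueq[OF \<theta>] sph_perp_grad_inner_grad .
      then have "harm_series harm_phi_fun p ?x * (harm_series harm_theta_fun w ?x + 2 * b * sin \<theta>)
          - (harm_series harm_theta_fun p ?x + - b * sin \<theta>) * harm_series harm_phi_fun w ?x = 0"
        unfolding d\<Omega>[OF \<theta>] d\<Psi>[OF \<theta>] using s by simp
      \<comment> \<open>Replacing the derivatives of the vorticity perturbation by those of g adds
        the product of the two derivatives of psi twice with opposite signs, and it collects both
        background terms on the left.\<close>
      then have "b * sin \<theta> * harm_series harm_phi_fun g ?x = harm_series harm_theta_fun p ?x *
          harm_series harm_phi_fun g ?x - harm_series harm_phi_fun p ?x * harm_series
          harm_theta_fun g ?x"
        unfolding add by (simp add: algebra_simps)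
      then have eq: "b * sin \<theta> * harm_series harm_phi_fun g ?x
        = (harm_series harm_theta_fun (zonal_part p) ?x + harm_series harm_theta_fun (nonzonal_part
            p) ?x) * harm_series harm_phi_fun g ?x
          - harm_series harm_phi_fun p ?x * (harm_series harm_theta_fun (zonal_part g) ?x +
              harm_series harm_theta_fun (nonzonal_part g) ?x)"
        by (simp only: harm_series_harm_theta_fun_parts[OF dp] harm_series_harm_theta_fun_parts[OF
            dg])
      \<comment> \<open>The zonal bound gives 2 K with K at most 3 \<epsilon>; it is relaxed to 36
        \<epsilon> so that all four bounds share the same E.\<close>
      have zb: "\<bar>harm_series harm_theta_fun (zonal_part c) ?x\<bar> \<le> sin \<theta> * (36 * \<epsilon> * Z)" if
          "coeff_decay c K" "K \<le> 3 * \<epsilon>" for c K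
      proof -
        have "\<bar>harm_series harm_theta_fun (zonal_part c) ?x\<bar> \<le> \<bar>sin \<theta>\<bar> * (2 * K * Z)"
          using harm_series_zonal_bound[OF coeff_decay_parts(1)[OF that(1)], of ?x] by (simp add:
              zonal_part_def Z_def)
        also have "\<dots> \<le> sin \<theta> * (36 * \<epsilon> * Z)"
          using s that Z \<epsilon> by (simp add: mult_right_mono)
        finally show ?thesis .
      qed
      have h1: "\<bar>harm_series harm_theta_fun (nonzonal_part g) ?x\<bar> \<le> 36 * \<epsilon> * Z"
        using T.harm_series_bound[OF coeff_decay_parts(2)[OF dg] harm_theta_fun_0, of ?x] by (simp
            add: Z_def)
      have Gq: "\<bar>harm_series harm_phi_fun g ?x\<bar> \<le> 36 * \<epsilon> * Z"
        using Q.harm_series_bound[OF dg harm_phi_fun_0, of ?x] by (simp add: Z_def)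
      show ?thesis
        using steady_poisson_estimate[OF s E b eq zb[OF dp] zb[OF dg] h1 Gq] \<epsilon> by simp
    qed
    note key = this
    have p0: "p n m = 0" if "\<bar>m\<bar> \<le> int n" "m \<noteq> 0" for n m
      by (rule nonzonal_coeffs_vanish[OF dp dg gp p1 p1 key that]) auto
    have w0: "w n m = 0" if "\<bar>m\<bar> \<le> int n" "m \<noteq> 0" for n m
      using wp[OF that(1)] p0[OF that] by simp
    have "\<Omega> (sph \<theta> \<phi>) = \<Omega> (sph \<theta> 0)" if "0 \<le> \<theta>" "\<theta> \<le> pi" for \<theta> \<phi>
    \<comment> \<open>The series represents the vorticity only off the poles; at a pole all
      longitudes give the same point.\<close>
    proof (cases "\<theta> = 0 \<or> \<theta> = pi")
      case True
      then show ?thesis by (auto simp: sph_def)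
    next
      case False
      then have "0 < \<theta>" "\<theta> < pi" using that by auto
      then have "harm_series harm_fun w (\<theta>, \<phi>) = \<Omega> (sph \<theta> \<phi>) + 2 * b * cos \<theta>" "harm_series harm_fun
          w (\<theta>, 0) = \<Omega> (sph \<theta> 0) + 2 * b * cos \<theta>"
        by (simp_all only: \<Omega>s)
      moreover have "harm_series harm_fun w (\<theta>, \<phi>) = harm_series harm_fun w (\<theta>, 0)"
        by (rule harm_series_zonal(1)[of w, OF w0])
      ultimately show ?thesis by linarith
    qed
    then have "zonal_function \<Omega>"
      unfolding zonal_function_def by (intro exI[of _ "\<lambda>\<theta>. \<Omega> (sph \<theta> 0)"] allI impI) (elim conjE)
    \<comment> \<open>The component of the velocity along \<open>e_theta\<close> is the longitude
      derivative of the stream function, which vanishes once only zonal coefficients are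
      left.\<close>
    moreover have "U (sph \<theta> \<phi>) = (- d_theta \<Psi> \<theta> 0) *\<^sub>R e_phi \<theta> \<phi>" if "0 < \<theta>" "\<theta> < pi" for \<theta> \<phi>
      unfolding Ueq[OF that] sph_perp_grad_eq d\<Psi>[OF that]
      using harm_series_zonal(2)[of p \<theta> \<phi> 0, OF p0] harm_series_zonal(3)[of p \<theta> \<phi>, OF p0]
      by (simp add: scaleR_left_diff_distrib)
    then have "zonal_vector_field U"
      unfolding zonal_vector_field_def by (intro exI[of _ "\<lambda>\<theta>. - d_theta \<Psi> \<theta> 0"] allI impI) (elim
          conjE)
    ultimately show ?thesis by blast
  qed
  then show ?thesis using \<epsilon> by blast
qed

end
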